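(* Let $\xi\colon\partial\mathbf{T}\to\partial\mathbf{T}$ be a diffeomorphism of the boundary of the solid torus $\mathbf{T}=S^1\times D^2$, let $L_\xi$ be the lens space obtained by gluing two copies of $\mathbf{T}$ along their boundaries via $\xi$, and let $\mathcal{F}_\xi$ be its polar foliation. Then the group $\mathcal{D}^{lp}(\mathcal{F}_\xi)$ is a strong deformation retract of $\mathcal{D}^{fol}_{+}(\mathcal{F}_\xi)$.
   Context: $D^2=\{z\in\mathbb{C}:|z|\le1\}$, $S^1=\partial D^2$. $L_\xi$ is the quotient of $\mathbf{T}\times\{0,1\}$ by identifying $(x,0)$ with $(\xi(x),1)$ for each $x\in\partial\mathbf{T}$. Smooth structure: let $V=S^1\times\{z\in\mathbb{C}:|z|<\sqrt2\}$. Define $j_0\colon V\to L_\xi$ by $j_0(w,z)=[((w,z),0)]$ if $|z|\le1$ and $j_0(w,z)=[((a,\sqrt{2-|z|^2}\,b),1)]$ if $1\le|z|<\sqrt2$, where $(a,b)=\xi(w,z/|z|)$; define $j_1\colon V\to L_\xi$ by $j_1(w,z)=[((w,z),1)]$ if $|z|\le1$ and $j_1(w,z)=[((a,\sqrt{2-|z|^2}\,b),0)]$ if $1\le|z|<\sqrt2$, where $(a,b)=\xi^{-1}(w,z/|z|)$. The smooth structure on $L_\xi$ is the one for which $j_0,j_1$ are open smooth embeddings. The function equal to $|z|^2$ on $\mathbf{T}\times\{0\}$ and to $2-|z|^2$ on $\mathbf{T}\times\{1\}$ induces a $C^\infty$ Morse-Bott function $g\colon L_\xi\to[0;2]$. The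 polar foliation $\mathcal{F}_\xi$ is the partition of $L_\xi$ into the level sets $g^{-1}(t)$, $t\in[0;2]$: it has two singular leaves, the central circles $C_0=g^{-1}(0)$ and $C_1=g^{-1}(2)$, and all other leaves are $2$-tori. A diffeomorphism is $\mathcal{F}_\xi$-foliated if it sends each leaf onto a leaf, and $\mathcal{F}_\xi$-leaf preserving if it sends each leaf onto itself. $\mathcal{D}^{fol}(\mathcal{F}_\xi)$ and $\mathcal{D}^{lp}(\mathcal{F}_\xi)$ are the groups of $\mathcal{F}_\xi$-foliated and $\mathcal{F}_\xi$-leaf preserving $C^\infty$ diffeomorphisms of $L_\xi$, with $C^\infty$ topologies, and $\mathcal{D}^{fol}_{+}(\mathcal{F}_\xi)=\{h\in\mathcal{D}^{fol}(\mathcal{F}_\xi)\mid h(C_i)=C_i,\ i=0,1\}$. *)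

theory Defs
  imports "HOL-Analysis.Analysis"
begin

section \<open>Smooth maps between open subsets of Euclidean spaces\<close>

text \<open>\<open>iter_partial [v\<^sub>1, \<dots>, v\<^sub>k] f\<close> is the iterated directional derivative
  \<open>\<partial>\<^bsub>v1\<^esub> (\<partial>\<^bsub>v2\<^esub> (\<dots> \<partial>\<^bsub>vk\<^esub> f))\<close>; for basis vectors these are the partial derivatives of order \<open>k\<close>.\<close>

primrec iter_partial ::
    "'a::euclidean_space list \<Rightarrow> ('a \<Rightarrow> 'b::euclidean_space) \<Rightarrow> 'a \<Rightarrow> 'b" where
  "iter_partial [] f = f"
| "iter_partial (v # vs) f = (\<lambda>x. frechet_derivative (iter_partial vs f) (at x) v)"

definition smooth_on :: "'a::euclidean_space set \<Rightarrow> ('a \<Rightarrow> 'b::euclidean_space) \<Rightarrow> bool" where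
  "smooth_on S f \<longleftrightarrow> open S \<and>
     (\<forall>vs. set vs \<subseteq> Basis \<longrightarrow> (\<forall>x\<in>S. iter_partial vs f differentiable (at x)))"


section \<open>Manifolds given by an atlas of local parametrizations\<close>

text \<open>An element \<open>(D, p)\<close> of an atlas is a local parametrization: \<open>D\<close> is an open subset of the
  Euclidean model space, and the chart is the inverse \<open>inv_into D p\<close> of \<open>p\<close>, defined on \<open>p ` D\<close>.\<close>

type_synonym ('e, 'p) atlas = "('e set \<times> ('e \<Rightarrow> 'p)) set"

definition man_space :: "('e, 'p) atlas \<Rightarrow> 'p set" where
  "man_space A = (\<Union>(D, p)\<in>A. p ` D)"

definition chart_rep :: "('e \<Rightarrow> 'p) \<Rightarrow> 'f set \<Rightarrow> ('f \<Rightarrow> 'q) \<Rightarrow> ('p \<Rightarrow> 'q) \<Rightarrow> 'e \<Rightarrow> 'f" where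
  "chart_rep p E q f = inv_into E q \<circ> f \<circ> p"

text \<open>\<open>smooth_on\<close> includes the requirement that the domain of each local representative is open,
  i.e. that \<open>f\<close> is continuous.\<close>

definition smooth_map ::
    "('e::euclidean_space, 'p) atlas \<Rightarrow> ('f::euclidean_space, 'q) atlas \<Rightarrow> ('p \<Rightarrow> 'q) \<Rightarrow> bool" where
  "smooth_map A B f \<longleftrightarrow> f ` man_space A \<subseteq> man_space B \<and>
     (\<forall>(D, p)\<in>A. \<forall>(E, q)\<in>B. smooth_on {x \<in> D. f (p x) \<in> q ` E} (chart_rep p E q f))"

definition diffeomorphism ::
    "('e::euclidean_space, 'p) atlas \<Rightarrow> ('f::euclidean_space, 'q) atlas \<Rightarrow> ('p \<Rightarrow> 'q) \<Rightarrow> bool" where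
  "diffeomorphism A B f \<longleftrightarrow> bij_betw f (man_space A) (man_space B) \<and>
     smooth_map A B f \<and> smooth_map B A (inv_into (man_space A) f)"

text \<open>Maps out of a manifold are represented by their extensional representatives, so that a map
  of sets corresponds to exactly one HOL function.\<close>

definition smooth_maps ::
    "('e::euclidean_space, 'p) atlas \<Rightarrow> ('f::euclidean_space, 'q) atlas \<Rightarrow> ('p \<Rightarrow> 'q) set" where
  "smooth_maps A B = {f \<in> extensional (man_space A). smooth_map A B f}"

definition diffeos :: "('e::euclidean_space, 'p) atlas \<Rightarrow> ('p \<Rightarrow> 'p) set" where
  "diffeos A = {h \<in> extensional (man_space A). diffeomorphism A A h}"

text \<open>The weak (compact-open) \<open>C\<^sup>\<infinity>\<close> topology on the space of smooth maps, generated by the usual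
  subbasis: \<open>g\<close> is close to \<open>f\<close> if, read in the charts \<open>(D, p)\<close> and \<open>(E, q)\<close>, all partial
  derivatives of order at most \<open>r\<close> are \<open>\<epsilon>\<close>-close on the compact set \<open>K\<close>.  On a compact manifold it
  coincides with the strong \<open>C\<^sup>\<infinity>\<close> topology.\<close>

definition smooth_nbhd ::
    "('e::euclidean_space, 'p) atlas \<Rightarrow> ('f::euclidean_space, 'q) atlas \<Rightarrow> ('p \<Rightarrow> 'q) \<Rightarrow>
     ('e \<Rightarrow> 'p) \<Rightarrow> 'f set \<Rightarrow> ('f \<Rightarrow> 'q) \<Rightarrow> 'e set \<Rightarrow> nat \<Rightarrow> real \<Rightarrow> ('p \<Rightarrow> 'q) set" where
  "smooth_nbhd A B f p E q K r \<epsilon> =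
     {g \<in> smooth_maps A B. g ` p ` K \<subseteq> q ` E \<and>
        (\<forall>vs. set vs \<subseteq> Basis \<and> length vs \<le> r \<longrightarrow>
          (\<forall>x\<in>K. norm (iter_partial vs (chart_rep p E q f) x
                      - iter_partial vs (chart_rep p E q g) x) < \<epsilon>))}"

definition smooth_topology ::
    "('e::euclidean_space, 'p) atlas \<Rightarrow> ('f::euclidean_space, 'q) atlas \<Rightarrow> ('p \<Rightarrow> 'q) topology" where
  "smooth_topology A B = topology_generated_by
     {smooth_nbhd A B f p E q K r \<epsilon> | f D p E q K r \<epsilon>.
        f \<in> smooth_maps A B \<and> (D, p) \<in> A \<and> (E, q) \<in> B \<and>
        compact K \<and> K \<subseteq> D \<and> f ` p ` K \<subseteq> q ` E \<and> \<epsilon> > 0}"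


section \<open>Foliated and leaf preserving diffeomorphisms\<close>

text \<open>A (singular) foliation enters only through the set of its leaves.\<close>

definition foliated_diffeos ::
    "('e::euclidean_space, 'p) atlas \<Rightarrow> 'p set set \<Rightarrow> ('p \<Rightarrow> 'p) set" where
  "foliated_diffeos A F = {h \<in> diffeos A. \<forall>l\<in>F. h ` l \<in> F}"

definition leaf_preserving_diffeos ::
    "('e::euclidean_space, 'p) atlas \<Rightarrow> 'p set set \<Rightarrow> ('p \<Rightarrow> 'p) set" where
  "leaf_preserving_diffeos A F = {h \<in> diffeos A. \<forall>l\<in>F. h ` l = l}"


section \<open>Strong deformation retracts\<close>

definition strong_deformation_retract_of_space :: "'a set \<Rightarrow> 'a topology \<Rightarrow> bool" where
  "strong_deformation_retract_of_space S X \<longleftrightarrow> S \<subseteq> topspace X \<and>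
     (\<exists>r. retraction_maps X (subtopology X S) r id \<and>
          homotopic_with (\<lambda>f. \<forall>s\<in>S. f s = s) X X id r)"


section \<open>The solid torus, lens spaces and their polar foliations\<close>

definition solid_torus :: "(complex \<times> complex) set" where
  "solid_torus = sphere 0 1 \<times> cball 0 1"

definition torus :: "(complex \<times> complex) set" where
  "torus = sphere 0 1 \<times> sphere 0 1"

text \<open>The standard smooth structure of \<open>S\<^sup>1 \<times> S\<^sup>1\<close>, in angular coordinates.\<close>

definition torus_atlas :: "(real \<times> real, complex \<times> complex) atlas" where
  "torus_atlas =
     {({a<..<a + 2 * pi} \<times> {b<..<b + 2 * pi}, \<lambda>(\<theta>, \<phi>). (cis \<theta>, cis \<phi>)) | a b. True}"

definition two_tori :: "((complex \<times> complex) \<times> nat) set" where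
  "two_tori = solid_torus \<times> {0, 1}"

definition glue :: "(complex \<times> complex \<Rightarrow> complex \<times> complex) \<Rightarrow> ((complex \<times> complex) \<times> nat) rel" where
  "glue \<xi> = {((x, 0), (\<xi> x, 1)) | x. x \<in> torus}"

text \<open>The equivalence relation on \<open>two_tori\<close> generated by \<open>glue \<xi>\<close>.\<close>

definition lens_rel :: "(complex \<times> complex \<Rightarrow> complex \<times> complex) \<Rightarrow> ((complex \<times> complex) \<times> nat) rel" where
  "lens_rel \<xi> = Id_on two_tori \<union> (glue \<xi> \<union> (glue \<xi>)\<inverse>)\<^sup>+"

type_synonym lens_point = "((complex \<times> complex) \<times> nat) set"

definition lens_space :: "(complex \<times> complex \<Rightarrow> complex \<times> complex) \<Rightarrow> lens_point set" where
  "lens_space \<xi> = two_tori // lens_rel \<xi>"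

definition lens_class ::
    "(complex \<times> complex \<Rightarrow> complex \<times> complex) \<Rightarrow> (complex \<times> complex) \<times> nat \<Rightarrow> lens_point" where
  "lens_class \<xi> y = lens_rel \<xi> `` {y}"

text \<open>The parametrizations \<open>j\<^sub>0\<close>, \<open>j\<^sub>1\<close> of the two halves by
  \<open>V = S\<^sup>1 \<times> {z. |z| < \<surd>2}\<close>.\<close>

definition lens_j0 ::
    "(complex \<times> complex \<Rightarrow> complex \<times> complex) \<Rightarrow> complex \<times> complex \<Rightarrow> lens_point" where
  "lens_j0 \<xi> = (\<lambda>(w, z).
     if norm z \<le> 1 then lens_class \<xi> ((w, z), 0)
     else let (a, b) = \<xi> (w, z / of_real (norm z))
          in lens_class \<xi> ((a, of_real (sqrt (2 - (norm z)\<^sup>2)) * b), 1))"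

definition lens_j1 ::
    "(complex \<times> complex \<Rightarrow> complex \<times> complex) \<Rightarrow> complex \<times> complex \<Rightarrow> lens_point" where
  "lens_j1 \<xi> = (\<lambda>(w, z).
     if norm z \<le> 1 then lens_class \<xi> ((w, z), 1)
     else let (a, b) = inv_into torus \<xi> (w, z / of_real (norm z))
          in lens_class \<xi> ((a, of_real (sqrt (2 - (norm z)\<^sup>2)) * b), 0))"

text \<open>The smooth structure for which \<open>j\<^sub>0\<close> and \<open>j\<^sub>1\<close> are open smooth embeddings: composing them with
  the angular coordinates \<open>(\<theta>, z) \<mapsto> (e\<^sup>i\<^sup>\<theta>, z)\<close> of \<open>V\<close> yields local parametrizations
  by open subsets of the Euclidean space \<open>\<real> \<times> \<complex>\<close>.\<close>

definition lens_atlas ::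
    "(complex \<times> complex \<Rightarrow> complex \<times> complex) \<Rightarrow> (real \<times> complex, lens_point) atlas" where
  "lens_atlas \<xi> =
     {({a<..<a + 2 * pi} \<times> ball 0 (sqrt 2), \<lambda>(\<theta>, z). j (cis \<theta>, z)) | a j.
        j \<in> {lens_j0 \<xi>, lens_j1 \<xi>}}"

text \<open>The Morse-Bott function \<open>g\<close>: \<open>|z|\<^sup>2\<close> on the first solid torus, \<open>2 - |z|\<^sup>2\<close> on the second.
  It is constant on equivalence classes, see \<open>polar_fun_class\<close> below.\<close>

definition polar_fun :: "lens_point \<Rightarrow> real" where
  "polar_fun P =
     the_elem ((\<lambda>((w, z), i). if i = 0 then (norm z)\<^sup>2 else 2 - (norm z)\<^sup>2) ` P)"

definition polar_leaf :: "(complex \<times> complex \<Rightarrow> complex \<times> complex) \<Rightarrow> real \<Rightarrow> lens_point set" where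
  "polar_leaf \<xi> t = {P \<in> lens_space \<xi>. polar_fun P = t}"

definition polar_foliation :: "(complex \<times> complex \<Rightarrow> complex \<times> complex) \<Rightarrow> lens_point set set" where
  "polar_foliation \<xi> = polar_leaf \<xi> ` {0..2}"

definition diff_lp ::
    "(complex \<times> complex \<Rightarrow> complex \<times> complex) \<Rightarrow> (lens_point \<Rightarrow> lens_point) set" where
  "diff_lp \<xi> = leaf_preserving_diffeos (lens_atlas \<xi>) (polar_foliation \<xi>)"

text \<open>The central circles are \<open>C\<^sub>0 = polar_leaf \<xi> 0\<close> and \<open>C\<^sub>1 = polar_leaf \<xi> 2\<close>.\<close>

definition diff_fol_plus ::
    "(complex \<times> complex \<Rightarrow> complex \<times> complex) \<Rightarrow> (lens_point \<Rightarrow> lens_point) set" where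
  "diff_fol_plus \<xi> =
     {h \<in> foliated_diffeos (lens_atlas \<xi>) (polar_foliation \<xi>).
        h ` polar_leaf \<xi> 0 = polar_leaf \<xi> 0 \<and> h ` polar_leaf \<xi> 2 = polar_leaf \<xi> 2}"


section \<open>Consistency of the definitions\<close>

lemma cis_ex:
  assumes "norm w = 1" obtains a \<theta> where "\<theta> \<in> {a<..<a + 2 * pi}" "w = cis \<theta>"
proof -
  have "w = cis (Arg w)" using assms by (metis Arg_eq complex_norm_eq_1_exp cis_conv_exp mult_1 norm_zero of_real_1 zero_neq_one)
  moreover have "Arg w \<in> {Arg w - pi<..<Arg w - pi + 2 * pi}" by simp
  ultimately show thesis using that by blast
qed

lemma man_space_torus_atlas: "man_space torus_atlas = torus"
proof
  show "man_space torus_atlas \<subseteq> torus"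
    by (auto simp: man_space_def torus_atlas_def torus_def)
  show "torus \<subseteq> man_space torus_atlas"
  proof
    fix x assume "x \<in> torus"
    then obtain u v where x: "x = (u, v)" "norm u = 1" "norm v = 1" by (auto simp: torus_def)
    obtain a \<theta> where 1: "\<theta> \<in> {a<..<a + 2 * pi}" "u = cis \<theta>" using cis_ex x(2) by blast
    obtain b \<phi> where 2: "\<phi> \<in> {b<..<b + 2 * pi}" "v = cis \<phi>" using cis_ex x(3) by blast
    have "({a<..<a + 2 * pi} \<times> {b<..<b + 2 * pi}, \<lambda>(\<theta>, \<phi>). (cis \<theta>, cis \<phi>)) \<in> torus_atlas"
      unfolding torus_atlas_def by blast
    moreover have "x \<in> (\<lambda>(\<theta>, \<phi>). (cis \<theta>, cis \<phi>)) ` ({a<..<a + 2 * pi} \<times> {b<..<b + 2 * pi})"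
      using x 1 2 by (intro image_eqI[where x = "(\<theta>, \<phi>)"]) auto
    ultimately show "x \<in> man_space torus_atlas" unfolding man_space_def by blast
  qed
qed

lemma torus_subset: "torus \<subseteq> solid_torus"
  by (auto simp: torus_def solid_torus_def)

lemma lens_rel_aux:
  assumes "bij_betw \<xi> torus torus"
  shows "equiv two_tori (Id_on two_tori \<union> glue \<xi> \<union> (glue \<xi>)\<inverse>)" (is "equiv _ ?R")
proof (rule equivI)
  have im: "\<xi> x \<in> torus" if "x \<in> torus" for x using assms that by (auto simp: bij_betw_def)
  have inj: "x = y" if "x \<in> torus" "y \<in> torus" "\<xi> x = \<xi> y" for x y
    using assms that by (auto simp: bij_betw_def inj_on_def)
  have mem: "(x, 0) \<in> two_tori" "(x, Suc 0) \<in> two_tori" if "x \<in> torus" for x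
    using that torus_subset by (auto simp: two_tori_def)
  have iff: "(p, q) \<in> ?R \<longleftrightarrow> p = q \<and> p \<in> two_tori \<or> (\<exists>x\<in>torus. p = (x, 0) \<and> q = (\<xi> x, 1)) \<or>
      (\<exists>x\<in>torus. q = (x, 0) \<and> p = (\<xi> x, 1))" for p q
    by (simp only: glue_def Un_iff converse_iff Id_on_iff mem_Collect_eq prod.inject) blast
  show "?R \<subseteq> two_tori \<times> two_tori"
  proof (rule subrelI)
    fix p q assume "(p, q) \<in> ?R"
    then show "(p, q) \<in> two_tori \<times> two_tori"
      unfolding iff by (elim disjE conjE bexE) (simp_all add: mem im)
  qed
  show "refl_on two_tori ?R" by (auto simp: refl_on_def)
  show "sym ?R" by (auto simp: sym_def)
  show "trans ?R"
  proof (rule transI)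
    fix p q s assume "(p, q) \<in> ?R" "(q, s) \<in> ?R"
    then show "(p, s) \<in> ?R"
      unfolding iff by (elim disjE conjE bexE) (simp_all add: mem im, (metis inj mem im)+)
  qed
qed

lemma lens_rel_eq:
  assumes "bij_betw \<xi> torus torus"
  shows "lens_rel \<xi> = Id_on two_tori \<union> glue \<xi> \<union> (glue \<xi>)\<inverse>" (is "_ = ?R")
proof -
  have "trans ?R" using lens_rel_aux[OF assms] by (simp add: equiv_def)
  then have "(glue \<xi> \<union> (glue \<xi>)\<inverse>)\<^sup>+ \<subseteq> ?R"
    by (metis Un_assoc Un_upper2 trancl_id trancl_mono_subset)
  moreover have "glue \<xi> \<union> (glue \<xi>)\<inverse> \<subseteq> (glue \<xi> \<union> (glue \<xi>)\<inverse>)\<^sup>+"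
    by (meson r_into_trancl' subsetI)
  ultimately show ?thesis unfolding lens_rel_def by blast
qed

lemma equiv_lens_rel: "bij_betw \<xi> torus torus \<Longrightarrow> equiv two_tori (lens_rel \<xi>)"
  using lens_rel_aux lens_rel_eq by metis

lemma polar_fun_class:
  assumes "bij_betw \<xi> torus torus" "((w, z), i) \<in> two_tori"
  shows "polar_fun (lens_class \<xi> ((w, z), i)) = (if i = 0 then (norm z)\<^sup>2 else 2 - (norm z)\<^sup>2)"
proof -
  let ?f = "\<lambda>((w, z), i::nat). if i = 0 then (norm (z::complex))\<^sup>2 else 2 - (norm z)\<^sup>2"
  have im: "\<xi> x \<in> torus" if "x \<in> torus" for x using assms that by (auto simp: bij_betw_def)
  have eq: "?f p = ?f q" if "(p, q) \<in> lens_rel \<xi>" for p q :: "(complex \<times> complex) \<times> nat"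
    using that im unfolding lens_rel_eq[OF assms(1)] glue_def torus_def
    by (fastforce simp: Id_on_def split: prod.splits)
  have "((w, z), i) \<in> lens_class \<xi> ((w, z), i)"
    using assms(2) by (auto simp: lens_class_def lens_rel_def)
  moreover have "?f p = ?f ((w, z), i)" if "p \<in> lens_class \<xi> ((w, z), i)" for p
    using eq[of "((w, z), i)" p] that unfolding lens_class_def by (simp only: Image_singleton_iff)
  ultimately have "?f ` lens_class \<xi> ((w, z), i) = {?f ((w, z), i)}" by blast
  then show ?thesis unfolding polar_fun_def by simp
qed

lemma man_space_lens_atlas:
  assumes "bij_betw \<xi> torus torus"
  shows "man_space (lens_atlas \<xi>) = lens_space \<xi>"
proof
  have cls: "lens_class \<xi> ((w, z), i) \<in> lens_space \<xi>"
    if "norm w = 1" "norm z \<le> 1" "i \<in> {0, 1}" for w z i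
    using that unfolding lens_space_def lens_class_def
    by (intro quotientI) (auto simp: two_tori_def solid_torus_def)
  have unit: "(w, z / of_real (norm z)) \<in> torus" if "norm w = 1" "\<not> norm z \<le> 1" for w z :: complex
    using that by (auto simp: torus_def norm_divide)
  have rad: "norm (of_real (sqrt (2 - (norm z)\<^sup>2)) * b :: complex) \<le> 1"
    if z: "norm z < sqrt 2" "\<not> norm z \<le> 1" and b: "norm b = 1" for z b :: complex
  proof -
    have "(norm z)\<^sup>2 < 2" using z(1) by (metis norm_ge_zero real_sqrt_less_iff real_sqrt_abs abs_norm_cancel)
    moreover have "(norm z)\<^sup>2 \<ge> 1" using z(2) by (simp add: one_le_power)
    ultimately show ?thesis using b by (simp add: norm_mult)
  qed
  have j0: "lens_j0 \<xi> (w, z) \<in> lens_space \<xi>" if "norm w = 1" "norm z < sqrt 2" for w z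
  proof (cases "norm z \<le> 1")
    case True then show ?thesis using cls that by (simp add: lens_j0_def)
  next
    case False
    obtain a b where ab: "\<xi> (w, z / of_real (norm z)) = (a, b)" by fastforce
    have "(a, b) \<in> torus"
      using bij_betw_apply[OF assms unit[OF that(1) False]] ab by simp
    then show ?thesis
      using False ab cls[of a _ 1] rad[OF that(2) False, of b] by (simp add: lens_j0_def torus_def)
  qed
  have j1: "lens_j1 \<xi> (w, z) \<in> lens_space \<xi>" if "norm w = 1" "norm z < sqrt 2" for w z
  proof (cases "norm z \<le> 1")
    case True then show ?thesis using cls that by (simp add: lens_j1_def)
  next
    case False
    obtain a b where ab: "inv_into torus \<xi> (w, z / of_real (norm z)) = (a, b)" by fastforce
    have "(a, b) \<in> torus"
      using bij_betw_apply[OF bij_betw_inv_into[OF assms] unit[OF that(1) False]] ab by simp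
    then show ?thesis
      using False ab cls[of a _ 0] rad[OF that(2) False, of b] by (simp add: lens_j1_def torus_def)
  qed
  show "man_space (lens_atlas \<xi>) \<subseteq> lens_space \<xi>"
    using j0 j1 by (auto simp: man_space_def lens_atlas_def)
  show "lens_space \<xi> \<subseteq> man_space (lens_atlas \<xi>)"
  proof
    fix P assume "P \<in> lens_space \<xi>"
    then obtain w z i where P: "P = lens_class \<xi> ((w, z), i)" "norm w = 1" "norm z \<le> 1" "i \<in> {0, 1}"
      unfolding lens_space_def lens_class_def quotient_def two_tori_def solid_torus_def by auto
    define j where "j = (if i = 0 then lens_j0 \<xi> else lens_j1 \<xi>)"
    have Pj: "P = j (w, z)" using P by (auto simp: j_def lens_j0_def lens_j1_def)
    obtain a \<theta> where 1: "\<theta> \<in> {a<..<a + 2 * pi}" "w = cis \<theta>" using cis_ex P(2) by blast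
    have "(1::real) < sqrt 2" by simp
    then have z: "z \<in> ball 0 (sqrt 2)" using P(3) by (simp add: order_le_less_trans)
    have "({a<..<a + 2 * pi} \<times> ball 0 (sqrt 2), \<lambda>(\<theta>, z). j (cis \<theta>, z)) \<in> lens_atlas \<xi>"
      unfolding lens_atlas_def j_def by auto
    moreover have "P \<in> (\<lambda>(\<theta>, z). j (cis \<theta>, z)) ` ({a<..<a + 2 * pi} \<times> ball 0 (sqrt 2))"
      using Pj 1 z by (intro image_eqI[where x = "(\<theta>, z)"]) auto
    ultimately show "P \<in> man_space (lens_atlas \<xi>)" unfolding man_space_def by blast
  qed
qed

end

theory Submission
  imports Defs
begin

text \<open>A foliated diffeomorphism \<open>h\<close> fixing the central circles satisfies \<open>g \<circ> h = \<sigma> \<circ> g\<close> for an increasing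
  diffeomorphism \<open>\<sigma>\<close> of \<open>[0; 2]\<close>. Move \<open>h(P)\<close> along its ray to the level \<open>(1 - t) g(h(P)) + t g(P)\<close>.
  For \<open>t = 0\<close> this is \<open>h\<close>, for \<open>t = 1\<close> the result preserves every leaf, and nothing moves if \<open>h\<close> is leaf
  preserving. In the tube around \<open>C\<^sub>0\<close>, if \<open>h\<close> takes \<open>(w, z)\<close> to \<open>(w', z')\<close>, the deformed map takes it to
  \<open>(w', (1 - t + t |z|\<^sup>2 / |z'|\<^sup>2)\<^bsup>1/2\<^esup> z')\<close>. The radial function \<open>|z'|\<^sup>2 = \<sigma>(|z|\<^sup>2)\<close> is divisible by \<open>|z|\<^sup>2\<close> with
  a smooth positive quotient depending continuously on \<open>h\<close>.

  Continuity into the \<open>C\<^sup>\<infinity>\<close> topology is joint continuity, in the parameter and the point, of all partial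
  derivatives of the local representatives; such families are closed under composition, so smoothness and
  continuity of the deformation are read off from this formula together.\<close>

section \<open>Parametrized families of smooth maps\<close>

text \<open>The squared radius of \<open>h\<close> in the tube is \<sigma>(|z|^2), and smoothness of
  \<open>h\<close> gives smoothness of z \<mapsto> \<sigma>(|z|^2) only. The quotient by |z|^2 has
  to be smooth and positive at z = 0 and continuous in \<open>h\<close>. Writing it as an integral
  of derivatives yields smoothness and continuity at once. Positivity at the centre comes from the
  inverse of \<open>h\<close>: the two quotients multiply to 1. The factor |z|^2 / |z'|^2 is used in
  two forms. As a function of the image point z' it is the quotient of the inverse of
  \<open>h\<close>; the deformed map is then \<open>h\<close> followed by a radial map of the disc,
  whose inverse is controlled by its radial derivative. As a function of the source point it is the
  reciprocal of the quotient of \<open>h\<close>, where \<open>h\<close> enters explicitly, and this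
  form gives continuity. A source point in the tube of the other circle has positive level, so its
  image is off the centre and the ratio is formed directly. Levels are interpolated linearly because
  a convex combination of increasing functions is increasing, so every intermediate map permutes the
  levels.\<close>

text \<open>A family \<open>F\<close> of maps of the variable \<open>u\<close> is indexed by the points of a topological space \<open>X\<close>.
  Points outside the carrier of \<open>X\<close> impose no condition, because \<open>nhdsin\<close> is the bottom filter there.\<close>

definition joint_cont ::
    "'x topology \<Rightarrow> ('x \<times> 'a::topological_space) set \<Rightarrow> ('x \<Rightarrow> 'a \<Rightarrow> 'b::topological_space) \<Rightarrow> bool" where
  "joint_cont X W F \<longleftrightarrow>
     (\<forall>(x, u)\<in>W. ((\<lambda>(x, u). F x u) \<longlongrightarrow> F x u) (nhdsin (prod_topology X euclidean) (x, u)))"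

text \<open>The C^k condition with parameters: partial derivatives of order below \<open>k\<close>
  are totally differentiable, and those of order up to \<open>k\<close> are jointly continuous. The
  parameter space carries only a topology, so nothing is differentiated in \<open>x\<close>. The
  recursion on \<open>k\<close> allows closure rules to be proved by induction from the formula for
  the derivative.\<close>

primrec diff_family ::
    "nat \<Rightarrow> 'x topology \<Rightarrow> ('x \<times> 'a::euclidean_space) set \<Rightarrow> ('x \<Rightarrow> 'a \<Rightarrow> 'b::euclidean_space) \<Rightarrow> bool" where
  "diff_family 0 X W F \<longleftrightarrow> joint_cont X W F"
| "diff_family (Suc k) X W F \<longleftrightarrow> joint_cont X W F \<and> (\<forall>(x, u)\<in>W. F x differentiable (at u)) \<and>
     (\<forall>v\<in>Basis. diff_family k X W (\<lambda>x u. frechet_derivative (F x) (at u) v))"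

section \<open>Product neighbourhoods and closure rules for families\<close>

lemma openin_prod_euclidean_obtain:
  assumes "openin (prod_topology X euclidean) W" "(x, u) \<in> W"
  obtains U V where "openin X U" "open V" "x \<in> U" "u \<in> V" "U \<times> V \<subseteq> W"
proof -
  have 1: "\<forall>x y. (x,y) \<in> W \<longrightarrow> (\<exists>U V. openin X U \<and> openin euclidean V \<and> x \<in> U \<and> y \<in> V \<and> U \<times> V \<subseteq> W)"
    using assms(1) by (rule openin_prod_topology_alt[THEN iffD1])
  have 2: "\<exists>U V. openin X U \<and> openin euclidean V \<and> x \<in> U \<and> u \<in> V \<and> U \<times> V \<subseteq> W"
    by (rule 1[rule_format, OF assms(2)])
  show thesis using 2 that by auto
qed

lemma eventually_nhdsin_prod:
  assumes "x \<in> topspace X"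
  shows "eventually P (nhdsin (prod_topology X euclidean) (x, u)) \<longleftrightarrow>
    (\<exists>U V. openin X U \<and> open V \<and> x \<in> U \<and> u \<in> V \<and> (\<forall>y\<in>U. \<forall>v\<in>V. P (y, v)))" (is "?L \<longleftrightarrow> ?R")
proof
  assume ?L
  then obtain S where "openin (prod_topology X euclidean) S" "(x, u) \<in> S" "\<forall>q\<in>S. P q"
    using assms by (auto simp: eventually_nhdsin)
  moreover from this obtain U V where "openin X U" "open V" "x \<in> U" "u \<in> V" "U \<times> V \<subseteq> S"
    by (auto elim: openin_prod_euclidean_obtain)
  ultimately show ?R by blast
next
  assume ?R
  then obtain U V where "openin X U" "open V" "x \<in> U" "u \<in> V" "\<forall>y\<in>U. \<forall>v\<in>V. P (y, v)" by blast
  then show ?L unfolding eventually_nhdsin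
    by (intro disjI2 exI[of _ "U \<times> V"]) (auto simp: openin_prod_Times_iff)
qed

lemma eventually_nhdsin_open: "openin Z S \<Longrightarrow> p \<in> S \<Longrightarrow> eventually (\<lambda>q. q \<in> S) (nhdsin Z p)"
  by (auto simp: eventually_nhdsin)

lemma openin_prod_slice:
  assumes "openin (prod_topology X euclidean) W"
  shows "open {u. (x, u) \<in> W}"
proof (subst open_subopen, safe)
  fix u assume "(x, u) \<in> W"
  then obtain U V where "openin X U" "open V" "x \<in> U" "u \<in> V" "U \<times> V \<subseteq> W"
    using assms by (auto elim: openin_prod_euclidean_obtain)
  then show "\<exists>T. open T \<and> u \<in> T \<and> T \<subseteq> {u. (x, u) \<in> W}" by (intro exI[of _ V]) auto
qed

lemma joint_cont_openin_preimage:
  assumes W: "openin (prod_topology X euclidean) W" and F: "joint_cont X W F" and V: "open V"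
  shows "openin (prod_topology X euclidean) {(x, u) \<in> W. F x u \<in> V}"
proof (subst openin_subopen, intro ballI)
  fix p assume p: "p \<in> {(x, u) \<in> W. F x u \<in> V}"
  obtain x u where xu: "p = (x, u)" "(x, u) \<in> W" "F x u \<in> V" using p by auto
  have "((\<lambda>(x, u). F x u) \<longlongrightarrow> F x u) (nhdsin (prod_topology X euclidean) p)"
    using F xu by (auto simp: joint_cont_def)
  then have "eventually (\<lambda>q. (\<lambda>(x, u). F x u) q \<in> V) (nhdsin (prod_topology X euclidean) p)"
    using V xu(3) by (rule topological_tendstoD)
  moreover have "p \<in> topspace (prod_topology X euclidean)"
    using xu openin_subset[OF W] by blast
  ultimately obtain S where S: "openin (prod_topology X euclidean) S" "p \<in> S"
    "\<forall>q\<in>S. (\<lambda>(x, u). F x u) q \<in> V"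
    unfolding eventually_nhdsin by blast
  show "\<exists>T. openin (prod_topology X euclidean) T \<and> p \<in> T \<and> T \<subseteq> {(x, u) \<in> W. F x u \<in> V}"
    using S xu by (intro exI[of _ "S \<inter> W"] conjI openin_Int[OF S(1) W]) auto
qed

lemma diff_family_imp_joint_cont: "diff_family k X W F \<Longrightarrow> joint_cont X W F"
  by (cases k) auto

lemma diff_family_Suc_imp: "diff_family (Suc k) X W F \<Longrightarrow> diff_family k X W F"
  by (induction k arbitrary: F) auto

lemma joint_cont_subset: "joint_cont X W F \<Longrightarrow> W' \<subseteq> W \<Longrightarrow> joint_cont X W' F"
  by (auto simp: joint_cont_def)

lemma diff_family_subset: "diff_family k X W F \<Longrightarrow> W' \<subseteq> W \<Longrightarrow> diff_family k X W' F"
  by (induction k arbitrary: F) (auto intro: joint_cont_subset)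

text \<open>Limits are taken along neighbourhoods in the full product and not relative to
  \<open>W\<close>, so the condition is imposed point by point and glues over any cover. It serves
  where the chart has to change with the point.\<close>

lemma diff_family_local:
  "(\<And>p. p \<in> W \<Longrightarrow> \<exists>W'. p \<in> W' \<and> diff_family k X W' F) \<Longrightarrow> diff_family k X W F"
proof (induction k arbitrary: F)
  case 0
  then show ?case by (fastforce simp: joint_cont_def)
next
  case (Suc k)
  have "joint_cont X W F" "\<forall>(x, u)\<in>W. F x differentiable (at u)"
    using Suc.prems by (fastforce simp: joint_cont_def)+
  moreover have "diff_family k X W (\<lambda>x u. frechet_derivative (F x) (at u) v)" if "v \<in> Basis" for v
    using Suc.prems that by (intro Suc.IH) (metis diff_family.simps(2))
  ultimately show ?case by simp
qed

lemma joint_cont_cong: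
  assumes W: "openin (prod_topology X euclidean) W"
    and eq: "\<And>x u. (x, u) \<in> W \<Longrightarrow> F x u = G x u" and F: "joint_cont X W F"
  shows "joint_cont X W G"
  unfolding joint_cont_def
proof safe
  fix x u assume p: "(x, u) \<in> W"
  have "((\<lambda>(x, u). F x u) \<longlongrightarrow> G x u) (nhdsin (prod_topology X euclidean) (x, u))"
    using F p eq by (auto simp: joint_cont_def)
  moreover have "eventually (\<lambda>q. (\<lambda>(x, u). F x u) q = (\<lambda>(x, u). G x u) q) (nhdsin (prod_topology X euclidean) (x, u))"
    using eventually_nhdsin_open[OF W p] by eventually_elim (auto simp: eq)
  ultimately show "((\<lambda>(x, u). G x u) \<longlongrightarrow> G x u) (nhdsin (prod_topology X euclidean) (x, u))"
    using Lim_transform_eventually by blast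
qed

lemma frechet_derivative_cong_open:
  assumes "open S" "x \<in> S" "\<And>y. y \<in> S \<Longrightarrow> f y = g y"
  shows "frechet_derivative f (at x) = frechet_derivative g (at x)"
    and "f differentiable (at x) \<longleftrightarrow> g differentiable (at x)"
proof -
  have "(f has_derivative D) (at x) \<longleftrightarrow> (g has_derivative D) (at x)" for D
    using assms has_derivative_transform_within_open[of _ _ x UNIV S] by metis
  then show "frechet_derivative f (at x) = frechet_derivative g (at x)"
    "f differentiable (at x) \<longleftrightarrow> g differentiable (at x)"
    by (simp_all add: frechet_derivative_def differentiable_def)
qed

lemma diff_family_cong:
  assumes W: "openin (prod_topology X euclidean) W"
  shows "(\<And>x u. (x, u) \<in> W \<Longrightarrow> F x u = G x u) \<Longrightarrow> diff_family k X W F \<Longrightarrow> diff_family k X W G"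
proof (induction k arbitrary: F G)
  case 0
  show ?case unfolding diff_family.simps
    by (rule joint_cont_cong[OF W 0(1) 0(2)[unfolded diff_family.simps]])
next
  case (Suc k)
  have *: "frechet_derivative (F x) (at u) = frechet_derivative (G x) (at u)"
    "F x differentiable (at u) \<longleftrightarrow> G x differentiable (at u)" if "(x, u) \<in> W" for x u
    using frechet_derivative_cong_open[OF openin_prod_slice[OF W, of x], of u "F x" "G x"]
      that Suc.prems(1) by auto
  have jF: "joint_cont X W F" and d: "\<forall>(x, u)\<in>W. F x differentiable (at u)"
    and D: "\<And>v. v \<in> Basis \<Longrightarrow> diff_family k X W (\<lambda>x u. frechet_derivative (F x) (at u) v)"
    using Suc.prems(2) by auto
  have "joint_cont X W G" by (rule joint_cont_cong[OF W Suc.prems(1) jF])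
  moreover have "diff_family k X W (\<lambda>x u. frechet_derivative (G x) (at u) v)" if "v \<in> Basis" for v
    by (rule Suc.IH[OF _ D[OF that]]) (simp add: *)
  ultimately show ?case using d * by auto
qed

text \<open>Raises the order once the derivative is exhibited by a formula: uniqueness of
  derivatives identifies it with \<open>frechet_derivative\<close> at the points of
  \<open>W\<close>, and openness of \<open>W\<close> carries the agreement to higher
  derivatives.\<close>

lemma diff_family_SucI:
  assumes W: "openin (prod_topology X euclidean) W"
    and "joint_cont X W F"
    and D: "\<And>x u. (x, u) \<in> W \<Longrightarrow> (F x has_derivative D x u) (at u)"
    and "\<And>v. v \<in> Basis \<Longrightarrow> diff_family k X W (\<lambda>x u. D x u v)"
  shows "diff_family (Suc k) X W F"
proof -
  have eq: "D x u v = frechet_derivative (F x) (at u) v" if "(x, u) \<in> W" for x u v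
    using frechet_derivative_at[OF D[OF that]] by simp
  then have "diff_family k X W (\<lambda>x u. frechet_derivative (F x) (at u) v)" if "v \<in> Basis" for v
    by (rule diff_family_cong[OF W _ assms(4)[OF that]]) (use eq in auto)
  then show ?thesis using assms(2) D by (auto simp: differentiable_def)
qed

lemma diff_family_SucD:
  assumes "diff_family (Suc k) X W F" "(x, u) \<in> W"
  shows "(F x has_derivative frechet_derivative (F x) (at u)) (at u)"
  using assms by (auto simp: frechet_derivative_works[symmetric])

lemma joint_cont_const_param:
  assumes "continuous_map X euclidean c"
  shows "joint_cont X W (\<lambda>x u. c x)"
  unfolding joint_cont_def
proof safe
  fix x u assume "(x, u) \<in> W"
  show "((\<lambda>(x, u). c x) \<longlongrightarrow> c x) (nhdsin (prod_topology X euclidean) (x, u))"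
  proof (cases "x \<in> topspace X")
    case True
    show ?thesis
    proof (rule topological_tendstoI)
      fix S assume S: "open S" "c x \<in> S"
      have "openin X {y \<in> topspace X. c y \<in> S}"
        using assms S by (simp add: continuous_map_def)
      then show "\<forall>\<^sub>F q in nhdsin (prod_topology X euclidean) (x, u). (case q of (x, u) \<Rightarrow> c x) \<in> S"
        unfolding eventually_nhdsin_prod[OF True]
        by (intro exI[of _ "{y \<in> topspace X. c y \<in> S}"] exI[of _ UNIV]) (use S True in auto)
    qed
  qed simp
qed

lemma joint_cont_snd_on:
  assumes f: "continuous_on S f" and S: "open S" and W: "W \<subseteq> UNIV \<times> S"
  shows "joint_cont X W (\<lambda>x u. f u)"
  unfolding joint_cont_def
proof safe
  fix x u assume p: "(x, u) \<in> W"
  then have u: "u \<in> S" using W by auto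
  show "((\<lambda>(x, u). f u) \<longlongrightarrow> f u) (nhdsin (prod_topology X euclidean) (x, u))"
  proof (cases "x \<in> topspace X")
    case True
    show ?thesis
    proof (rule topological_tendstoI)
      fix T assume T: "open T" "f u \<in> T"
      have "open (f -` T \<inter> S)" using f S T(1) continuous_on_open_vimage by blast
      then show "\<forall>\<^sub>F q in nhdsin (prod_topology X euclidean) (x, u). (case q of (x, u) \<Rightarrow> f u) \<in> T"
        unfolding eventually_nhdsin_prod[OF True]
        by (intro exI[of _ "topspace X"] exI[of _ "f -` T \<inter> S"]) (use T True u in auto)
    qed
  qed simp
qed

lemma joint_cont_snd: "continuous_on UNIV f \<Longrightarrow> joint_cont X W (\<lambda>x u. f u)"
  by (rule joint_cont_snd_on[of UNIV]) auto

lemma diff_family_const: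
  assumes W: "openin (prod_topology X euclidean) W" and c: "continuous_map X euclidean c"
  shows "diff_family k X W (\<lambda>x u. c x)"
proof (cases k)
  case (Suc n)
  have 0: "diff_family n X W (\<lambda>x u. 0 :: 'c::euclidean_space)" for n
    by (induction n) (auto intro!: joint_cont_const_param)
  show ?thesis unfolding Suc
    by (rule diff_family_SucI[OF W, of _ "\<lambda>x u v. 0"]) (auto intro: joint_cont_const_param c 0)
qed (auto intro: joint_cont_const_param c)

lemma diff_family_linear:
  assumes W: "openin (prod_topology X euclidean) W" and L: "bounded_linear L"
  shows "diff_family k X W (\<lambda>x u. L u)"
proof (cases k)
  case 0
  then show ?thesis using L by (auto intro!: joint_cont_snd linear_continuous_on)
next
  case (Suc n)
  show ?thesis unfolding Suc
    by (rule diff_family_SucI[OF W, of _ "\<lambda>x u. L"])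
      (use L in \<open>auto intro!: joint_cont_snd linear_continuous_on diff_family_const[OF W]
         bounded_linear_imp_has_derivative\<close>)
qed

lemma diff_family_bounded_linear:
  assumes W: "openin (prod_topology X euclidean) W" and L: "bounded_linear L"
  shows "diff_family k X W F \<Longrightarrow> diff_family k X W (\<lambda>x u. L (F x u))"
proof (induction k arbitrary: F)
  case 0
  then show ?case using bounded_linear.tendsto[OF L]
    by (fastforce simp: joint_cont_def split_def)
next
  case (Suc k)
  note D = diff_family_SucD[OF Suc.prems]
  show ?case
  proof (rule diff_family_SucI[OF W, of _ "\<lambda>x u v. L (frechet_derivative (F x) (at u) v)"])
    show "joint_cont X W (\<lambda>x u. L (F x u))"
      using Suc.prems bounded_linear.tendsto[OF L] by (fastforce simp: joint_cont_def split_def)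
    show "((\<lambda>u. L (F x u)) has_derivative (\<lambda>v. L (frechet_derivative (F x) (at u) v))) (at u)"
      if "(x, u) \<in> W" for x u
      using bounded_linear.has_derivative[OF L D[OF that]] .
    show "diff_family k X W (\<lambda>x u. L (frechet_derivative (F x) (at u) v))" if "v \<in> Basis" for v
      using Suc that by auto
  qed
qed

lemma diff_family_add:
  assumes W: "openin (prod_topology X euclidean) W"
  shows "diff_family k X W F \<Longrightarrow> diff_family k X W G \<Longrightarrow> diff_family k X W (\<lambda>x u. F x u + G x u)"
proof (induction k arbitrary: F G)
  case 0
  then show ?case by (auto simp: joint_cont_def split_def intro!: tendsto_add)
next
  case (Suc k)
  show ?case
  proof (rule diff_family_SucI[OF W])
    show "joint_cont X W (\<lambda>x u. F x u + G x u)"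
      using Suc.prems by (auto simp: joint_cont_def split_def intro!: tendsto_add)
    show "((\<lambda>u. F x u + G x u) has_derivative
        (\<lambda>v. frechet_derivative (F x) (at u) v + frechet_derivative (G x) (at u) v)) (at u)"
      if "(x, u) \<in> W" for x u
      using diff_family_SucD[OF Suc.prems(1) that] diff_family_SucD[OF Suc.prems(2) that]
      by (rule has_derivative_add)
  qed (use Suc in auto)
qed

lemma diff_family_bilinear:
  assumes W: "openin (prod_topology X euclidean) W" and B: "bounded_bilinear B"
  shows "diff_family k X W F \<Longrightarrow> diff_family k X W G \<Longrightarrow> diff_family k X W (\<lambda>x u. B (F x u) (G x u))"
proof (induction k arbitrary: F G)
  case 0
  then show ?case using bounded_bilinear.tendsto[OF B]
    by (fastforce simp: joint_cont_def split_def)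
next
  case (Suc k)
  show ?case
  proof (rule diff_family_SucI[OF W])
    show "joint_cont X W (\<lambda>x u. B (F x u) (G x u))"
      using Suc.prems bounded_bilinear.tendsto[OF B] by (fastforce simp: joint_cont_def split_def)
    show "((\<lambda>u. B (F x u) (G x u)) has_derivative
        (\<lambda>v. B (F x u) (frechet_derivative (G x) (at u) v) + B (frechet_derivative (F x) (at u) v) (G x u))) (at u)"
      if "(x, u) \<in> W" for x u
      using bounded_bilinear.FDERIV[OF B diff_family_SucD[OF Suc.prems(1) that]
        diff_family_SucD[OF Suc.prems(2) that]] .
    show "diff_family k X W (\<lambda>x u. B (F x u) (frechet_derivative (G x) (at u) v) + B (frechet_derivative (F x) (at u) v) (G x u))"
      if "v \<in> Basis" for v
    proof -
      have F: "diff_family k X W F" and G: "diff_family k X W G"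
        using Suc.prems diff_family_Suc_imp by blast+
      have DF: "diff_family k X W (\<lambda>x u. frechet_derivative (F x) (at u) v)"
        and DG: "diff_family k X W (\<lambda>x u. frechet_derivative (G x) (at u) v)"
        using Suc.prems that by simp_all
      show ?thesis by (rule diff_family_add[OF W Suc.IH[OF F DG] Suc.IH[OF DF G]])
    qed
  qed
qed

lemma diff_family_sum:
  assumes W: "openin (prod_topology X euclidean) W"
    and "finite I" "\<And>i. i \<in> I \<Longrightarrow> diff_family k X W (F i)"
  shows "diff_family k X W (\<lambda>x u. \<Sum>i\<in>I. F i x u)"
  using assms(2,3)
  by (induction I rule: finite_induct) (auto intro!: diff_family_add[OF W] diff_family_const[OF W])

lemma joint_cont_compose:
  assumes W: "W \<subseteq> topspace (prod_topology X euclidean)"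
    and F: "joint_cont X W F" and G: "joint_cont X W' G" and sub: "\<And>x u. (x, u) \<in> W \<Longrightarrow> (x, F x u) \<in> W'"
  shows "joint_cont X W (\<lambda>x u. G x (F x u))"
  unfolding joint_cont_def
proof safe
  fix x u assume p: "(x, u) \<in> W"
  then have x: "x \<in> topspace X" using W by auto
  let ?N = "nhdsin (prod_topology X euclidean)"
  have "filterlim (\<lambda>(x, u). (x, F x u)) (?N (x, F x u)) (?N (x, u))"
    unfolding filterlim_iff
  proof safe
    fix P assume "eventually P (?N (x, F x u))"
    then obtain U V where UV: "openin X U" "open V" "x \<in> U" "F x u \<in> V" "\<forall>y\<in>U. \<forall>v\<in>V. P (y, v)"
      unfolding eventually_nhdsin_prod[OF x] by blast
    have "((\<lambda>(x, u). F x u) \<longlongrightarrow> F x u) (?N (x, u))" using F p by (auto simp: joint_cont_def)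
    then have 1: "eventually (\<lambda>q. (\<lambda>(x, u). F x u) q \<in> V) (?N (x, u))"
      using UV topological_tendstoD by blast
    have 2: "eventually (\<lambda>q. fst q \<in> U) (?N (x, u))"
      unfolding eventually_nhdsin_prod[OF x] using UV(1,3) by (intro exI[of _ U] exI[of _ UNIV]) auto
    show "eventually (\<lambda>q. P (case q of (x, u) \<Rightarrow> (x, F x u))) (?N (x, u))"
      using 1 2 by eventually_elim (use UV in auto)
  qed
  moreover have "((\<lambda>(x, u). G x u) \<longlongrightarrow> G x (F x u)) (?N (x, F x u))"
    using G sub[OF p] by (auto simp: joint_cont_def)
  ultimately have "((\<lambda>q. (\<lambda>(x, u). G x u) ((\<lambda>(x, u). (x, F x u)) q)) \<longlongrightarrow> G x (F x u)) (?N (x, u))"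
    using filterlim_compose by blast
  then show "((\<lambda>(x, u). G x (F x u)) \<longlongrightarrow> G x (F x u)) (?N (x, u))" by (simp add: split_def)
qed

text \<open>By the chain rule, written in components, the derivative is a sum of products of a
  component of the derivative of \<open>F\<close> with a partial derivative of \<open>G\<close>
  evaluated at \<open>F\<close>. The latter is again a composition, one order lower, so the
  induction on \<open>k\<close> runs over arbitrary \<open>G\<close> with \<open>F\<close>
  fixed.\<close>

lemma diff_family_compose:
  assumes W: "openin (prod_topology X euclidean) W"
    and sub: "\<And>x u. (x, u) \<in> W \<Longrightarrow> (x, F x u) \<in> W'"
  shows "diff_family k X W F \<Longrightarrow> diff_family k X W' G \<Longrightarrow> diff_family k X W (\<lambda>x u. G x (F x u))"
proof (induction k arbitrary: G)
  case 0
  then show ?case using joint_cont_compose[OF openin_subset[OF W]] sub by auto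
next
  case (Suc k)
  have F: "diff_family k X W F" and G: "diff_family k X W' G"
    using Suc.prems diff_family_Suc_imp by blast+
  show ?case
  proof (rule diff_family_SucI[OF W])
    show "joint_cont X W (\<lambda>x u. G x (F x u))"
      using joint_cont_compose[OF openin_subset[OF W]] sub Suc.prems by auto
    show "((\<lambda>u. G x (F x u)) has_derivative
       (\<lambda>v. \<Sum>b\<in>Basis. (frechet_derivative (F x) (at u) v \<bullet> b) *\<^sub>R frechet_derivative (G x) (at (F x u)) b)) (at u)"
      if p: "(x, u) \<in> W" for x u
    proof -
      note DG = diff_family_SucD[OF Suc.prems(2) sub[OF p]]
      interpret bounded_linear "frechet_derivative (G x) (at (F x u))"
        using DG has_derivative_bounded_linear by blast
      have eq: "frechet_derivative (G x) (at (F x u)) w = (\<Sum>b\<in>Basis. (w \<bullet> b) *\<^sub>R frechet_derivative (G x) (at (F x u)) b)" for w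
        by (subst euclidean_representation[of w, symmetric]) (simp add: sum scaleR)
      have "((\<lambda>u. G x (F x u)) has_derivative
          (\<lambda>v. frechet_derivative (G x) (at (F x u)) (frechet_derivative (F x) (at u) v))) (at u)"
        using diff_chain_at[OF diff_family_SucD[OF Suc.prems(1) p] DG] unfolding o_def .
      then show ?thesis by (rule back_subst) (intro arg_cong[where f = "\<lambda>D. (_ has_derivative D) _"] ext eq)
    qed
    show "diff_family k X W (\<lambda>x u. \<Sum>b\<in>Basis. (frechet_derivative (F x) (at u) v \<bullet> b) *\<^sub>R frechet_derivative (G x) (at (F x u)) b)"
      if v: "v \<in> Basis" for v
      using Suc.prems v
      by (intro diff_family_sum[OF W] diff_family_bilinear[OF W bounded_bilinear_scaleR]
          diff_family_bounded_linear[OF W bounded_linear_inner_left] Suc.IH[OF F]) auto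
  qed
qed

lemma diff_family_Pair:
  assumes W: "openin (prod_topology X euclidean) W" and "diff_family k X W F" "diff_family k X W G"
  shows "diff_family k X W (\<lambda>x u. (F x u, G x u))"
proof -
  have "diff_family k X W (\<lambda>x u. (F x u, 0) + (0, G x u))"
    by (intro diff_family_add[OF W] diff_family_bounded_linear[OF W, of "\<lambda>y. (y, 0)"]
        diff_family_bounded_linear[OF W, of "\<lambda>y. (0, y)"] assms)
      (auto intro!: bounded_linear_Pair bounded_linear_ident bounded_linear_zero)
  then show ?thesis by simp
qed

text \<open>The derivative of 1 / u is minus the square of 1 / u, so the induction hypothesis and
  the product rule already supply the next order.\<close>

lemma diff_family_inverse:
  "diff_family k X (topspace X \<times> {0<..}) (\<lambda>x u. inverse u :: real)"
proof (induction k)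
  case 0
  have "((\<lambda>(x, u). inverse u) \<longlongrightarrow> inverse u) (nhdsin (prod_topology X euclidean) (x, u))" if "u > 0" for x :: 'a and u :: real
  proof -
    have "((\<lambda>(x, u). u) \<longlongrightarrow> u) (nhdsin (prod_topology X euclidean) (x, u))"
      using joint_cont_snd[of "\<lambda>u. u" X UNIV] by (auto simp: joint_cont_def)
    then show ?thesis using that by (auto simp: split_def intro!: tendsto_inverse)
  qed
  then show ?case by (auto simp: joint_cont_def)
next
  case (Suc k)
  have W: "openin (prod_topology X euclidean) (topspace X \<times> {0::real<..})"
    by (simp add: openin_prod_Times_iff)
  show ?case
  proof (rule diff_family_SucI[OF W, of _ "\<lambda>x u v. - (v * (inverse u * inverse u))"])
    show "joint_cont X (topspace X \<times> {0::real<..}) (\<lambda>x. inverse)"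
      using diff_family_imp_joint_cont[OF Suc] .
    show "(inverse has_derivative (\<lambda>v. - (v * (inverse u * inverse u)))) (at u)"
      if "(x, u) \<in> topspace X \<times> {0<..}" for x and u :: real
      using that by (auto intro!: derivative_eq_intros)
    show "diff_family k X (topspace X \<times> {0<..}) (\<lambda>x u. - (v * (inverse u * inverse u)))" for v :: real
      by (intro diff_family_bounded_linear[OF W bounded_linear_minus[OF bounded_linear_mult_right]]
          diff_family_bilinear[OF W bounded_bilinear_mult] Suc)
  qed
qed

text \<open>The derivative is half the reciprocal of sqrt u, that is, the reciprocal composed with
  the induction hypothesis.\<close>

lemma diff_family_sqrt:
  "diff_family k X (topspace X \<times> {0<..}) (\<lambda>x u. sqrt u)"
proof (induction k)
  case 0
  have "joint_cont X (topspace X \<times> {0<..}) (\<lambda>x u. sqrt u)"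
    by (intro joint_cont_snd continuous_intros)
  then show ?case by simp
next
  case (Suc k)
  have W: "openin (prod_topology X euclidean) (topspace X \<times> {0::real<..})"
    by (simp add: openin_prod_Times_iff)
  show ?case
  proof (rule diff_family_SucI[OF W, of _ "\<lambda>x u v. (v / 2) * inverse (sqrt u)"])
    show "joint_cont X (topspace X \<times> {0::real<..}) (\<lambda>x. sqrt)"
      using diff_family_imp_joint_cont[OF Suc] .
    show "(sqrt has_derivative (\<lambda>v. (v / 2) * inverse (sqrt u))) (at u)"
      if "(x, u) \<in> topspace X \<times> {0<..}" for x and u :: real
      using that by (auto intro!: derivative_eq_intros simp: field_simps)
    show "diff_family k X (topspace X \<times> {0<..}) (\<lambda>x u. (v / 2) * inverse (sqrt u))" for v :: real
      by (intro diff_family_bounded_linear[OF W bounded_linear_mult_right]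
          diff_family_compose[OF W _ Suc diff_family_inverse]) auto
  qed
qed

section \<open>Smoothness and the smooth topology in terms of families\<close>

lemma iter_partial_append:
  "iter_partial (vs @ [v]) f = iter_partial vs (\<lambda>x. frechet_derivative f (at x) v)"
  by (induction vs) auto

lemma diff_family_iter_partial:
  "diff_family (k + length vs) X W F \<Longrightarrow> set vs \<subseteq> Basis \<Longrightarrow>
    diff_family k X W (\<lambda>x. iter_partial vs (F x))"
proof (induction vs arbitrary: k)
  case (Cons v vs)
  then have "diff_family (Suc k) X W (\<lambda>x. iter_partial vs (F x))"
    by (intro Cons.IH) (simp_all del: diff_family.simps)
  then show ?case using Cons.prems(2) by simp
qed auto

text \<open>\<open>iter_partial\<close> applies the last vector of the list first, while
  \<open>diff_family\<close> peels off the innermost derivative; hence the step appends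
  \<open>v\<close> at the end of the list.\<close>

lemma diff_family_of_iter_partial:
  fixes F :: "'x \<Rightarrow> 'a::euclidean_space \<Rightarrow> 'b::euclidean_space"
  assumes "\<And>vs. set vs \<subseteq> Basis \<Longrightarrow> joint_cont X W (\<lambda>x. iter_partial vs (F x))"
    and "\<And>vs x u. set vs \<subseteq> Basis \<Longrightarrow> (x, u) \<in> W \<Longrightarrow> iter_partial vs (F x) differentiable (at u)"
  shows "diff_family k X W F"
  using assms
proof (induction k arbitrary: F)
  case 0
  then show ?case using 0(1)[of "[]"] by simp
next
  case (Suc k)
  have "diff_family k X W (\<lambda>x u. frechet_derivative (F x) (at u) v)" if "v \<in> Basis" for v
  proof (rule Suc.IH)
    fix vs :: "'a list" assume vs: "set vs \<subseteq> Basis"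
    show "joint_cont X W (\<lambda>x. iter_partial vs (\<lambda>u. frechet_derivative (F x) (at u) v))"
      using Suc.prems(1)[of "vs @ [v]"] vs that by (simp add: iter_partial_append)
    show "iter_partial vs (\<lambda>u. frechet_derivative (F x) (at u) v) differentiable (at u)"
      if "(x, u) \<in> W" for x u
      using Suc.prems(2)[of "vs @ [v]" x u] vs that \<open>v \<in> Basis\<close> by (simp add: iter_partial_append)
  qed
  then show ?case using Suc.prems(1)[of "[]"] Suc.prems(2)[of "[]"] by auto
qed

lemma smooth_on_slice:
  fixes F :: "'x \<Rightarrow> 'a::euclidean_space \<Rightarrow> 'b::euclidean_space"
  assumes W: "openin (prod_topology X euclidean) W" and F: "\<And>k. diff_family k X W F"
  shows "smooth_on {u. (x, u) \<in> W} (F x)"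
  unfolding smooth_on_def
proof (intro conjI allI impI ballI)
  show "open {u. (x, u) \<in> W}" by (rule openin_prod_slice[OF W])
  fix vs :: "'a list" and u assume vs: "set vs \<subseteq> Basis" and u: "u \<in> {u. (x, u) \<in> W}"
  have "diff_family (Suc 0) X W (\<lambda>x. iter_partial vs (F x))"
    by (rule diff_family_iter_partial[OF F vs])
  then show "iter_partial vs (F x) differentiable (at u)" using u by auto
qed

lemma smooth_on_diff_family:
  fixes f :: "'a::euclidean_space \<Rightarrow> 'b::euclidean_space" and X :: "'x topology"
  assumes "smooth_on S f" "W \<subseteq> UNIV \<times> S"
  shows "diff_family k X W (\<lambda>_. f)"
proof (rule diff_family_of_iter_partial)
  fix vs :: "'a list" assume vs: "set vs \<subseteq> Basis"
  have "continuous_on S (iter_partial vs f)"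
    using assms(1) vs unfolding smooth_on_def
    by (intro continuous_at_imp_continuous_on ballI differentiable_imp_continuous_within) auto
  then show "joint_cont X W (\<lambda>x. iter_partial vs f)"
    using assms by (intro joint_cont_snd_on[of S]) (auto simp: smooth_on_def)
  show "iter_partial vs f differentiable (at u)" if "(x, u) \<in> W" for x u
    using assms vs that by (auto simp: smooth_on_def)
qed

lemma smooth_on_iff_family:
  assumes "open S" "x \<in> topspace X"
  shows "smooth_on S f \<longleftrightarrow> (\<forall>k. diff_family k X (topspace X \<times> S) (\<lambda>_. f))"
proof
  assume "smooth_on S f"
  then show "\<forall>k. diff_family k X (topspace X \<times> S) (\<lambda>_. f)"
    by (intro allI smooth_on_diff_family) auto
next
  assume F: "\<forall>k. diff_family k X (topspace X \<times> S) (\<lambda>_. f)"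
  have "openin (prod_topology X euclidean) (topspace X \<times> S)"
    using assms by (simp add: openin_prod_Times_iff)
  then have "smooth_on {u. (x, u) \<in> topspace X \<times> S} f"
    using F by (intro smooth_on_slice[of X _ "\<lambda>_. f"]) auto
  then show "smooth_on S f" using assms by simp
qed

lemma smooth_on_imp_open: "smooth_on S f \<Longrightarrow> open S"
  by (simp add: smooth_on_def)

lemma smooth_on_has_derivative:
  assumes "smooth_on S f" "x \<in> S"
  shows "(f has_derivative frechet_derivative f (at x)) (at x)"
  using assms unfolding smooth_on_def frechet_derivative_works[symmetric]
  by (metis empty_set empty_subsetI iter_partial.simps(1))

text \<open>The set on which the local representative makes sense varies with the parameter, so it
  is recorded as a subset of the product. Its openness there is the part of continuity that concerns
  values staying in a chart.\<close>

definition rep_dom ::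
    "'x topology \<Rightarrow> 'e set \<Rightarrow> ('e \<Rightarrow> 'p) \<Rightarrow> 'f set \<Rightarrow> ('f \<Rightarrow> 'q) \<Rightarrow> ('x \<Rightarrow> 'p \<Rightarrow> 'q) \<Rightarrow> ('x \<times> 'e) set" where
  "rep_dom X D p E q \<Phi> = {(y, x). y \<in> topspace X \<and> x \<in> D \<and> \<Phi> y (p x) \<in> q ` E}"

lemma topspace_smooth_topology_subset: "topspace (smooth_topology A B) \<subseteq> smooth_maps A B"
  by (auto simp: smooth_topology_def topology_generated_by_topspace smooth_nbhd_def)

lemma openin_smooth_nbhd:
  assumes "f \<in> smooth_maps A B" "(D, p) \<in> A" "(E, q) \<in> B" "compact K" "K \<subseteq> D" "f ` p ` K \<subseteq> q ` E" "\<epsilon> > 0"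
  shows "openin (smooth_topology A B) (smooth_nbhd A B f p E q K r \<epsilon>)"
  unfolding smooth_topology_def
  by (rule topology_generated_by_Basis) (use assms in blast)

lemma smooth_maps_rep:
  assumes "f \<in> smooth_maps A B" "(D, p) \<in> A" "(E, q) \<in> B"
  shows "smooth_on {x \<in> D. f (p x) \<in> q ` E} (chart_rep p E q f)"
  using assms by (auto simp: smooth_maps_def smooth_map_def)

lemma smooth_on_continuous_iter_partial:
  "smooth_on S f \<Longrightarrow> set vs \<subseteq> Basis \<Longrightarrow> continuous_on S (iter_partial vs f)"
  unfolding smooth_on_def
  by (intro continuous_at_imp_continuous_on ballI differentiable_imp_continuous_within) auto

text \<open>A closed ball around \<open>x0\<close> serves as the compact set of a subbasic
  neighbourhood of \<open>\<Phi> y0\<close>. Membership in it gives both facts: images stay in the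
  target chart, and derivatives up to order \<open>r\<close> are uniformly close on the
  ball.\<close>

lemma smooth_topology_eval_aux:
  assumes \<Phi>: "continuous_map Y (smooth_topology A B) \<Phi>" and p: "(D, p) \<in> A" and q: "(E, q) \<in> B"
    and y0: "(y0, x0) \<in> rep_dom Y D p E q \<Phi>" and "\<epsilon> > 0"
  obtains U V where "openin Y U" "open V" "y0 \<in> U" "x0 \<in> V" "U \<times> V \<subseteq> rep_dom Y D p E q \<Phi>"
    "\<And>y x vs. y \<in> U \<Longrightarrow> x \<in> V \<Longrightarrow> set vs \<subseteq> Basis \<Longrightarrow> length vs \<le> r \<Longrightarrow>
      norm (iter_partial vs (chart_rep p E q (\<Phi> y0)) x - iter_partial vs (chart_rep p E q (\<Phi> y)) x) < \<epsilon>"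
proof -
  let ?f = "\<Phi> y0"
  have yY: "y0 \<in> topspace Y" and x0: "x0 \<in> {x \<in> D. ?f (p x) \<in> q ` E}" using y0 by (auto simp: rep_dom_def)
  have f: "?f \<in> smooth_maps A B"
    using \<Phi> yY topspace_smooth_topology_subset by (fastforce simp: continuous_map_def)
  have "open {x \<in> D. ?f (p x) \<in> q ` E}" using smooth_on_imp_open[OF smooth_maps_rep[OF f p q]] .
  then obtain d where d: "d > 0" "cball x0 d \<subseteq> {x \<in> D. ?f (p x) \<in> q ` E}"
    using x0 open_contains_cball by blast
  define N where "N = smooth_nbhd A B ?f p E q (cball x0 d) r \<epsilon>"
  have "openin (smooth_topology A B) N"
    unfolding N_def by (rule openin_smooth_nbhd[OF f p q]) (use d \<open>\<epsilon> > 0\<close> in auto)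
  then have U: "openin Y {y \<in> topspace Y. \<Phi> y \<in> N}" using \<Phi> by (simp add: continuous_map_def)
  have fN: "?f \<in> N" using f d \<open>\<epsilon> > 0\<close> by (auto simp: N_def smooth_nbhd_def)
  have 1: "\<Phi> y (p x) \<in> q ` E" if "\<Phi> y \<in> N" "x \<in> ball x0 d" for y x
    using that by (auto simp: N_def smooth_nbhd_def image_subset_iff)
  show thesis
  proof (rule that[OF U])
    show "open (ball x0 d)" "x0 \<in> ball x0 d" using d by auto
    show "y0 \<in> {y \<in> topspace Y. \<Phi> y \<in> N}" using yY fN by blast
    show "{y \<in> topspace Y. \<Phi> y \<in> N} \<times> ball x0 d \<subseteq> rep_dom Y D p E q \<Phi>"
      using 1 subset_trans[OF ball_subset_cball d(2)] by (auto simp: rep_dom_def)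
    show "norm (iter_partial vs (chart_rep p E q ?f) x - iter_partial vs (chart_rep p E q (\<Phi> y)) x) < \<epsilon>"
      if "y \<in> {y \<in> topspace Y. \<Phi> y \<in> N}" "x \<in> ball x0 d" "set vs \<subseteq> Basis" "length vs \<le> r" for y x vs
      using that by (auto simp: N_def smooth_nbhd_def)
  qed
qed

text \<open>Joint continuity splits by the triangle inequality into closeness of
  \<open>\<Phi> y\<close> to \<open>\<Phi> y0\<close>, uniform near \<open>x0\<close>, and
  continuity of a partial derivative of the single map \<open>\<Phi> y0\<close>.\<close>

lemma smooth_topology_eval:
  fixes A :: "('a::euclidean_space, 'p) atlas" and B :: "('b::euclidean_space, 'q) atlas"
  assumes \<Phi>: "continuous_map Y (smooth_topology A B) \<Phi>" and p: "(D, p) \<in> A" and q: "(E, q) \<in> B"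
  shows "openin (prod_topology Y euclidean) (rep_dom Y D p E q \<Phi>)"
    and "diff_family k Y (rep_dom Y D p E q \<Phi>) (\<lambda>y. chart_rep p E q (\<Phi> y))"
proof -
  let ?W = "rep_dom Y D p E q \<Phi>"
  show "openin (prod_topology Y euclidean) ?W"
    unfolding openin_prod_topology_alt
  proof (intro allI impI)
    fix y x assume "(y, x) \<in> ?W"
    then obtain U V where "openin Y U" "open V" "y \<in> U" "x \<in> V" "U \<times> V \<subseteq> ?W"
      using smooth_topology_eval_aux[OF \<Phi> p q, of y x 1] by (metis zero_less_one)
    then show "\<exists>U V. openin Y U \<and> openin euclidean V \<and> y \<in> U \<and> x \<in> V \<and> U \<times> V \<subseteq> ?W" by auto
  qed
  have sm: "smooth_on {x. (y, x) \<in> ?W} (chart_rep p E q (\<Phi> y))" if "y \<in> topspace Y" for y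
  proof -
    have "\<Phi> y \<in> smooth_maps A B"
      using \<Phi> that topspace_smooth_topology_subset by (fastforce simp: continuous_map_def)
    then show ?thesis using smooth_maps_rep[OF _ p q, of "\<Phi> y"] that by (simp add: rep_dom_def)
  qed
  show "diff_family k Y ?W (\<lambda>y. chart_rep p E q (\<Phi> y))"
  proof (rule diff_family_of_iter_partial)
    fix vs :: "'a list" assume vs: "set vs \<subseteq> Basis"
    let ?G = "\<lambda>y. iter_partial vs (chart_rep p E q (\<Phi> y))"
    show "?G y differentiable (at x)" if "(y, x) \<in> ?W" for y x
      using sm[of y] that vs by (auto simp: smooth_on_def rep_dom_def)
    show "joint_cont Y ?W ?G"
      unfolding joint_cont_def
    proof safe
      fix y0 x0 assume p0: "(y0, x0) \<in> ?W"
      then have y0: "y0 \<in> topspace Y" by (simp add: rep_dom_def)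
      show "((\<lambda>(y, x). ?G y x) \<longlongrightarrow> ?G y0 x0) (nhdsin (prod_topology Y euclidean) (y0, x0))"
      proof (rule tendstoI)
        fix e :: real assume e: "e > 0"
        obtain U V where UV: "openin Y U" "open V" "y0 \<in> U" "x0 \<in> V"
          "\<And>y x. y \<in> U \<Longrightarrow> x \<in> V \<Longrightarrow> norm (?G y0 x - ?G y x) < e / 2"
          using smooth_topology_eval_aux[OF \<Phi> p q p0 half_gt_zero[OF e], of "length vs"] vs
          by (metis order_refl)
        have "isCont (?G y0) x0"
          using sm[OF y0] p0 vs
          by (auto simp: smooth_on_def intro: differentiable_imp_continuous_within)
        then have "(?G y0 \<longlongrightarrow> ?G y0 x0) (nhds x0)"
          by (simp add: isCont_def tendsto_at_iff_tendsto_nhds)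
        then have "\<forall>\<^sub>F x in nhds x0. dist (?G y0 x) (?G y0 x0) < e / 2"
          using half_gt_zero[OF e] by (rule tendstoD)
        then obtain V' where V': "open V'" "x0 \<in> V'" "\<And>x. x \<in> V' \<Longrightarrow> dist (?G y0 x) (?G y0 x0) < e / 2"
          unfolding eventually_nhds by blast
        show "\<forall>\<^sub>F z in nhdsin (prod_topology Y euclidean) (y0, x0). dist (case z of (y, x) \<Rightarrow> ?G y x) (?G y0 x0) < e"
          unfolding eventually_nhdsin_prod[OF y0]
        proof (intro exI[of _ U] exI[of _ "V \<inter> V'"] conjI ballI)
          fix y x assume yx: "y \<in> U" "x \<in> V \<inter> V'"
          have "dist (?G y x) (?G y0 x0) \<le> dist (?G y0 x) (?G y x) + dist (?G y0 x) (?G y0 x0)"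
            by (rule dist_triangle3)
          also have "\<dots> < e / 2 + e / 2"
            using UV(5)[of y x] V'(3)[of x] yx by (intro add_strict_mono) (auto simp: dist_norm)
          finally show "dist (case (y, x) of (y, x) \<Rightarrow> ?G y x) (?G y0 x0) < e" by simp
        qed (use UV V' in auto)
      qed
    qed
  qed
qed

lemma topspace_smooth_topology:
  assumes "A \<noteq> {}" "B \<noteq> {}"
  shows "topspace (smooth_topology A B) = smooth_maps A B"
proof (rule antisym[OF topspace_smooth_topology_subset], rule subsetI)
  fix f assume f: "f \<in> smooth_maps A B"
  obtain D p E q where "(D, p) \<in> A" "(E, q) \<in> B" using assms by auto
  then have "openin (smooth_topology A B) (smooth_nbhd A B f p E q {} 0 1)"
    using f by (intro openin_smooth_nbhd) auto
  moreover have "f \<in> smooth_nbhd A B f p E q {} 0 1" using f by (simp add: smooth_nbhd_def)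
  ultimately show "f \<in> topspace (smooth_topology A B)" using openin_subset by blast
qed

text \<open>The converse of \<open>smooth_topology_eval\<close>. A subbasic neighbourhood imposes
  finitely many strict inequalities over a compact set; each cuts out an open subset of the product,
  and the tube lemma makes them hold over all of \<open>K\<close> for nearby parameters.\<close>

lemma continuous_map_into_smooth_topology:
  fixes A :: "('a::euclidean_space, 'p) atlas" and B :: "('b::euclidean_space, 'q) atlas"
  assumes ne: "A \<noteq> {}" "B \<noteq> {}" and sm: "\<And>y. y \<in> topspace Y \<Longrightarrow> \<Phi> y \<in> smooth_maps A B"
    and op: "\<And>D p E q. (D, p) \<in> A \<Longrightarrow> (E, q) \<in> B \<Longrightarrow>
      openin (prod_topology Y euclidean) (rep_dom Y D p E q \<Phi>)"
    and fam: "\<And>D p E q k. (D, p) \<in> A \<Longrightarrow> (E, q) \<in> B \<Longrightarrow>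
      diff_family k Y (rep_dom Y D p E q \<Phi>) (\<lambda>y. chart_rep p E q (\<Phi> y))"
  shows "continuous_map Y (smooth_topology A B) \<Phi>"
  unfolding smooth_topology_def
proof (rule continuous_on_generated_topo)
  show "\<Phi> ` topspace Y \<subseteq> \<Union> {smooth_nbhd A B f p E q K r \<epsilon> | f D p E q K r \<epsilon>.
        f \<in> smooth_maps A B \<and> (D, p) \<in> A \<and> (E, q) \<in> B \<and>
        compact K \<and> K \<subseteq> D \<and> f ` p ` K \<subseteq> q ` E \<and> \<epsilon> > 0}"
    using sm topspace_smooth_topology[OF ne] unfolding smooth_topology_def topology_generated_by_topspace
    by (intro image_subsetI) metis
next
  fix U assume "U \<in> {smooth_nbhd A B f p E q K r \<epsilon> | f D p E q K r \<epsilon>.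
        f \<in> smooth_maps A B \<and> (D, p) \<in> A \<and> (E, q) \<in> B \<and>
        compact K \<and> K \<subseteq> D \<and> f ` p ` K \<subseteq> q ` E \<and> \<epsilon> > 0}"
  then obtain f D p E q K r \<epsilon> where U: "U = smooth_nbhd A B f p E q K r \<epsilon>"
    and f: "f \<in> smooth_maps A B" and p: "(D, p) \<in> A" and q: "(E, q) \<in> B"
    and K: "compact K" "K \<subseteq> D" "f ` p ` K \<subseteq> q ` E" and "\<epsilon> > 0"
    by (elim CollectE exE conjE) (rule that)
  let ?Z = "prod_topology Y euclidean"
  let ?F = "\<lambda>vs. iter_partial vs (chart_rep p E q f)"
  let ?G = "\<lambda>vs y. iter_partial vs (chart_rep p E q (\<Phi> y))"
  define Sf where "Sf = {x \<in> D. f (p x) \<in> q ` E}"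
  have smf: "smooth_on Sf (chart_rep p E q f)" unfolding Sf_def by (rule smooth_maps_rep[OF f p q])
  have KS: "K \<subseteq> Sf" using K by (auto simp: Sf_def)
  define W where "W = rep_dom Y D p E q \<Phi> \<inter> (topspace Y \<times> Sf)"
  have W: "openin ?Z W"
    unfolding W_def using smooth_on_imp_open[OF smf]
    by (intro openin_Int op p q) (simp add: openin_prod_Times_iff)
  define VS where "VS = {vs :: 'a list. set vs \<subseteq> Basis \<and> length vs \<le> r}"
  have VS: "finite VS" "VS \<noteq> {}"
    unfolding VS_def by (auto intro: finite_lists_length_le exI[of _ "[]"])
  define Q where "Q vs = {(y, x) \<in> W. norm (?F vs x - ?G vs y x) \<in> {..<\<epsilon>}}" for vs
  have Q: "openin ?Z (Q vs)" if "vs \<in> VS" for vs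
    unfolding Q_def
  proof (rule joint_cont_openin_preimage[OF W])
    have vs: "set vs \<subseteq> Basis" using that by (simp add: VS_def)
    have "joint_cont Y W (\<lambda>y x. ?F vs x)"
      using smooth_on_continuous_iter_partial[OF smf vs] smooth_on_imp_open[OF smf]
      by (rule joint_cont_snd_on) (auto simp: W_def)
    moreover have "joint_cont Y W (?G vs)"
      using diff_family_iter_partial[OF fam[OF p q] vs, of 0]
      by (rule joint_cont_subset[OF diff_family_imp_joint_cont]) (auto simp: W_def)
    ultimately show "joint_cont Y W (\<lambda>y x. norm (?F vs x - ?G vs y x))"
      unfolding joint_cont_def by (fastforce simp: split_def intro!: tendsto_norm tendsto_diff)
  qed auto
  have oInt: "openin ?Z (\<Inter> (Q ` VS))"
    using VS Q by (intro openin_Inter) auto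
  show "openin Y (\<Phi> -` U \<inter> topspace Y)"
  proof (subst openin_subopen, intro ballI)
    fix y assume y: "y \<in> \<Phi> -` U \<inter> topspace Y"
    have "{y} \<times> K \<subseteq> \<Inter> (Q ` VS)"
      using y K KS by (auto simp: Q_def W_def VS_def U smooth_nbhd_def rep_dom_def image_subset_iff)
    then obtain N V where N: "openin Y N" "y \<in> N" "K \<subseteq> V" "N \<times> V \<subseteq> \<Inter> (Q ` VS)"
      using tube_lemma_right[OF oInt, of K y] K(1) y by (auto simp: compactin_euclidean_iff)
    have "\<Phi> z \<in> U" if z: "z \<in> N" for z
    proof -
      have *: "(z, x) \<in> Q vs" if "x \<in> K" "vs \<in> VS" for x vs using N z that by blast
      have zY: "z \<in> topspace Y" using N(1) z openin_subset by blast
      \<comment> \<open>The empty list lies in \<open>VS\<close> even for r = 0, so membership in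
        \<open>Q []\<close> records that the image stays in the target chart.\<close>
      have "(z, x) \<in> W" if "x \<in> K" for x using *[OF that, of "[]"] by (auto simp: VS_def Q_def)
      then have "\<Phi> z ` p ` K \<subseteq> q ` E" by (auto simp: W_def rep_dom_def)
      then show ?thesis
        using * sm[OF zY] unfolding U smooth_nbhd_def by (auto simp: Q_def VS_def)
    qed
    then show "\<exists>T. openin Y T \<and> y \<in> T \<and> T \<subseteq> \<Phi> -` U \<inter> topspace Y"
      using N openin_subset[OF N(1)] by (intro exI[of _ N]) auto
  qed
qed

section \<open>Radial means and smooth radial functions\<close>

text \<open>A substitute for Whitney's theorem on even functions: in polar coordinates
  \<open>r\<^sup>2 \<Delta>f = (r \<partial>\<^sub>r)\<^sup>2 f\<close> for radial \<open>f\<close>, so integrating twice along rays expresses \<open>(f(z) - f(0)) / |z|\<^sup>2\<close>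
  as an iterated mean of \<open>\<Delta>f\<close>, which depends smoothly on \<open>z\<close> and on parameters.\<close>

definition radial_mean :: "nat \<Rightarrow> ('a::euclidean_space \<Rightarrow> 'b::euclidean_space) \<Rightarrow> 'a \<Rightarrow> 'b" where
  "radial_mean n g z = integral {0..1} (\<lambda>s. s ^ n *\<^sub>R g (s *\<^sub>R z))"

lemma joint_cont_slice:
  fixes F :: "'x \<Rightarrow> 'a::real_normed_vector \<Rightarrow> 'b::topological_space"
  assumes "joint_cont X (topspace X \<times> S) F" "x \<in> topspace X"
  shows "continuous_on S (F x)"
proof (intro continuous_at_imp_continuous_on ballI)
  fix u assume "u \<in> S"
  then have *: "((\<lambda>(x, u). F x u) \<longlongrightarrow> F x u) (nhdsin (prod_topology X euclidean) (x, u))"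
    using assms by (auto simp: joint_cont_def)
  have "filterlim (\<lambda>v. (x, v)) (nhdsin (prod_topology X euclidean) (x, u)) (nhds u)"
    unfolding filterlim_iff eventually_nhdsin_prod[OF assms(2)] eventually_nhds by blast
  then have "((\<lambda>v. (\<lambda>(x, u). F x u) (x, v)) \<longlongrightarrow> F x u) (nhds u)"
    using filterlim_compose[OF *] by blast
  then show "isCont (F x) u"
    by (simp add: isCont_def tendsto_at_iff_tendsto_nhds)
qed

lemma scaleR_mem_ball:
  fixes z :: "'a::real_normed_vector"
  assumes "z \<in> ball 0 R" "s \<in> {0..1}"
  shows "s *\<^sub>R z \<in> ball 0 R"
proof -
  have "norm (s *\<^sub>R z) \<le> norm z" using assms by (simp add: mult_left_le_one_le)
  then show ?thesis using assms by simp
qed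

lemma continuous_on_Pair_const: "continuous_on S (Pair z)"
  by (intro continuous_intros)

lemma continuous_on_radial:
  fixes g :: "'a::euclidean_space \<Rightarrow> 'b::euclidean_space"
  assumes "continuous_on (ball 0 R) g"
  shows "continuous_on (ball 0 R \<times> {0..1}) (\<lambda>(z, s). s ^ n *\<^sub>R g (s *\<^sub>R z))"
proof -
  have "continuous_on (ball 0 R \<times> {0..1}) (\<lambda>p. g (snd p *\<^sub>R fst p))"
    by (rule continuous_on_compose2[OF assms])
      (auto intro!: continuous_intros dest: scaleR_mem_ball)
  then show ?thesis by (auto simp: split_def intro!: continuous_intros)
qed

lemma integrable_radial:
  fixes g :: "'a::euclidean_space \<Rightarrow> 'b::euclidean_space"
  assumes "continuous_on (ball 0 R) g" "z \<in> ball 0 R"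
  shows "(\<lambda>s. s ^ n *\<^sub>R g (s *\<^sub>R z)) integrable_on {0..1}"
proof (rule integrable_continuous_real)
  show "continuous_on {0..1} (\<lambda>s. s ^ n *\<^sub>R g (s *\<^sub>R z))"
    using continuous_on_compose2[OF continuous_on_radial[OF assms(1), of n] continuous_on_Pair_const]
      image_subsetI[of "{0..1}" "Pair z" "ball 0 R \<times> {0..1::real}"] assms(2) by simp
qed

text \<open>The integrands have to be close uniformly along the segment from 0 to z. This comes from
  compactness of [0,1], by the tube lemma applied once for the parameter and once for
  \<open>z\<close>.\<close>

lemma joint_cont_radial_mean:
  fixes G :: "'x \<Rightarrow> 'b::euclidean_space \<Rightarrow> 'c::euclidean_space"
  assumes G: "joint_cont X (topspace X \<times> ball 0 R) G"
  shows "joint_cont X (topspace X \<times> ball 0 R) (\<lambda>x. radial_mean n (G x))"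
  unfolding joint_cont_def
proof safe
  fix x0 and z0 :: 'b assume x0: "x0 \<in> topspace X" and z0: "z0 \<in> ball 0 R"
  let ?E = "euclidean :: ('b \<times> real) topology"
  show "((\<lambda>(x, z). radial_mean n (G x) z) \<longlongrightarrow> radial_mean n (G x0) z0)
      (nhdsin (prod_topology X euclidean) (x0, z0))"
  proof (rule tendstoI)
    fix e :: real assume e: "e > 0"
    \<comment> \<open>Here \<open>s\<close> ranges over all reals so that \<open>S\<close> is open;
      the extra conditions keep both integrands inside the ball, and on {z0} \<times> [0,1] they
      hold automatically.\<close>
    define S where "S = {(z, s). z \<in> ball 0 R \<and> s *\<^sub>R z \<in> ball (0 :: 'b) R \<and> s *\<^sub>R z0 \<in> ball 0 R}"
    have S: "open S"
      unfolding S_def split_def by (auto intro!: open_Collect_conj open_Collect_less continuous_intros)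
    define W where "W = topspace X \<times> S"
    have W: "openin (prod_topology X ?E) W" using S by (simp add: W_def openin_prod_Times_iff)
    have 1: "joint_cont X W (\<lambda>x p. G x (snd p *\<^sub>R fst p))"
      by (rule joint_cont_compose[OF openin_subset[OF W] _ G])
        (auto simp: W_def S_def intro!: joint_cont_snd continuous_intros)
    have 2: "joint_cont X W (\<lambda>x p. G x0 (snd p *\<^sub>R z0))"
    proof (rule joint_cont_snd_on[OF _ S])
      have "continuous_on (ball 0 R) (G x0)" using joint_cont_slice[OF G x0] .
      then show "continuous_on S (\<lambda>p. G x0 (snd p *\<^sub>R z0))"
        by (rule continuous_on_compose2) (auto simp: S_def intro!: continuous_intros)
    qed (auto simp: W_def)
    have 3: "joint_cont X W (\<lambda>x p. norm (G x (snd p *\<^sub>R fst p) - G x0 (snd p *\<^sub>R z0)))"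
      using 1 2 unfolding joint_cont_def by (fastforce simp: split_def intro!: tendsto_norm tendsto_diff)
    define Q where "Q = {(x, p) \<in> W. norm (G x (snd p *\<^sub>R fst p) - G x0 (snd p *\<^sub>R z0)) \<in> {..<e / 2}}"
    have Q: "openin (prod_topology X ?E) Q"
      unfolding Q_def by (rule joint_cont_openin_preimage[OF W 3]) simp
    have "{x0} \<times> ({z0} \<times> {0..1}) \<subseteq> Q"
      using e x0 z0 scaleR_mem_ball[OF z0] by (auto simp: Q_def W_def S_def)
    moreover have "compactin ?E ({z0} \<times> {0..1})" by (simp add: compactin_euclidean_iff compact_Times)
    ultimately obtain N V where N: "openin X N" "x0 \<in> N" and V: "openin ?E V" "{z0} \<times> {0..1} \<subseteq> V"
      and NV: "N \<times> V \<subseteq> Q"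
      using tube_lemma_right[OF Q _ x0, of "{z0} \<times> {0..1}"] by blast
    obtain V0 where V0: "z0 \<in> V0" "open V0" "V0 \<times> {0..1} \<subseteq> V"
      using Elementary_Topology.tube_lemma[where K = "{0..1::real}" and W = V and ?x0.0 = z0] V by auto
    show "\<forall>\<^sub>F p in nhdsin (prod_topology X euclidean) (x0, z0).
        dist (case p of (x, z) \<Rightarrow> radial_mean n (G x) z) (radial_mean n (G x0) z0) < e"
      unfolding eventually_nhdsin_prod[OF x0]
    proof (intro exI[of _ N] exI[of _ V0] conjI ballI)
      fix x z assume x: "x \<in> N" and z: "z \<in> V0"
      have xX: "x \<in> topspace X" using N(1) x openin_subset by blast
      have zR: "z \<in> ball 0 R"
        using NV V0 x z by (force simp: Q_def W_def S_def)
      have b: "norm (G x (s *\<^sub>R z) - G x0 (s *\<^sub>R z0)) < e / 2" if "s \<in> {0..1}" for s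
      proof -
        have "(x, (z, s)) \<in> Q" using NV V0 x z that by blast
        then show ?thesis by (simp add: Q_def)
      qed
      have i: "(\<lambda>s. s ^ n *\<^sub>R G x (s *\<^sub>R z)) integrable_on {0..1}"
        "(\<lambda>s. s ^ n *\<^sub>R G x0 (s *\<^sub>R z0)) integrable_on {0..1}"
        using integrable_radial[OF _ zR, of "G x"] integrable_radial[OF _ z0, of "G x0"]
          joint_cont_slice[OF G xX] joint_cont_slice[OF G x0] by simp_all
      have "dist (radial_mean n (G x) z) (radial_mean n (G x0) z0)
          = norm (integral {0..1} (\<lambda>s. s ^ n *\<^sub>R G x (s *\<^sub>R z) - s ^ n *\<^sub>R G x0 (s *\<^sub>R z0)))"
        using i by (simp add: radial_mean_def dist_norm integral_diff)
      also have "\<dots> \<le> e / 2 * (1 - 0)"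
      proof (rule integral_bound)
        show "continuous_on {0..1} (\<lambda>s. s ^ n *\<^sub>R G x (s *\<^sub>R z) - s ^ n *\<^sub>R G x0 (s *\<^sub>R z0))"
        proof -
          have c: "continuous_on (ball 0 R) (G x)" "continuous_on (ball 0 R) (G x0)"
            using joint_cont_slice[OF G xX] joint_cont_slice[OF G x0] by simp_all
          show ?thesis
            by (intro continuous_intros continuous_on_compose2[OF c(1)] continuous_on_compose2[OF c(2)])
              (use scaleR_mem_ball[OF zR] scaleR_mem_ball[OF z0] in auto)
        qed
        fix s :: real assume s: "s \<in> {0..1}"
        have "norm (s ^ n *\<^sub>R G x (s *\<^sub>R z) - s ^ n *\<^sub>R G x0 (s *\<^sub>R z0))
            = s ^ n * norm (G x (s *\<^sub>R z) - G x0 (s *\<^sub>R z0))"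
          using s by (simp add: scaleR_diff_right[symmetric])
        also have "\<dots> \<le> 1 * (e / 2)"
          using b[OF s] s by (intro mult_mono power_le_one) auto
        finally show "norm (s ^ n *\<^sub>R G x (s *\<^sub>R z) - s ^ n *\<^sub>R G x0 (s *\<^sub>R z0)) \<le> e / 2" by simp
      qed simp
      finally show "dist (case (x, z) of (x, z) \<Rightarrow> radial_mean n (G x) z) (radial_mean n (G x0) z0) < e"
        using e by simp
    qed (use N V0 in auto)
  qed
qed

text \<open>Differentiating g(s z) in z brings out a factor s, which raises the weight by one. Means
  with weights s^n are therefore closed under differentiation, and the induction for families runs
  over arbitrary \<open>n\<close>.\<close>

lemma has_derivative_radial_mean:
  fixes g :: "'a::euclidean_space \<Rightarrow> 'b::euclidean_space"
  assumes g: "\<And>z. z \<in> ball 0 R \<Longrightarrow> (g has_derivative g' z) (at z)"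
    and g': "\<And>v. v \<in> Basis \<Longrightarrow> continuous_on (ball 0 R) (\<lambda>z. g' z v)"
    and z: "z \<in> ball 0 R"
  shows "(radial_mean n g has_derivative (\<lambda>v. radial_mean (Suc n) (\<lambda>z. g' z v) z)) (at z)"
proof -
  have lin: "bounded_linear (g' z)" if "z \<in> ball 0 R" for z
    using g[OF that] by (rule has_derivative_bounded_linear)
  \<comment> \<open>The Leibniz rule asks for a derivative that is continuous in operator norm; in
    finite dimension this can be checked on basis vectors, where the assumption on \<open>g'\<close>
    applies.\<close>
  define fx where "fx z s = s ^ Suc n *\<^sub>R Blinfun (g' (s *\<^sub>R z))" for z s
  have ap: "blinfun_apply (fx z s) v = s ^ Suc n *\<^sub>R g' (s *\<^sub>R z) v" if "z \<in> ball 0 R" "s \<in> {0..1}" for z s v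
    using lin[OF scaleR_mem_ball[OF that]] by (simp add: fx_def scaleR_blinfun.rep_eq bounded_linear_Blinfun_apply)
  have cg: "continuous_on (ball 0 R) g"
    by (intro continuous_at_imp_continuous_on ballI has_derivative_continuous[OF g])
  have cfx: "continuous_on (ball 0 R \<times> {0..1}) (\<lambda>(z, s). fx z s)"
  proof (rule continuous_on_blinfun_componentwise)
    fix v :: 'a assume "v \<in> Basis"
    from continuous_on_radial[OF g'[OF this], of "Suc n"]
    show "continuous_on (ball 0 R \<times> {0..1}) (\<lambda>p. blinfun_apply (case p of (z, s) \<Rightarrow> fx z s) v)"
      by (rule continuous_on_cong[THEN iffD1, rotated 2]) (auto simp: ap)
  qed
  have "((\<lambda>z. integral (cbox 0 1) (\<lambda>s. s ^ n *\<^sub>R g (s *\<^sub>R z))) has_derivative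
      blinfun_apply (integral (cbox 0 1) (fx z))) (at z within ball 0 R)"
  proof (rule leibniz_rule)
    fix z :: 'a and s :: real assume z: "z \<in> ball 0 R" and s: "s \<in> cbox 0 1"
    have sz: "s *\<^sub>R z \<in> ball 0 R" using scaleR_mem_ball[OF z] s by auto
    interpret bounded_linear "g' (s *\<^sub>R z)" by (rule lin[OF sz])
    have "((\<lambda>z. g (s *\<^sub>R z)) has_derivative (\<lambda>v. g' (s *\<^sub>R z) (s *\<^sub>R v))) (at z)"
      by (rule has_derivative_compose[where f = "\<lambda>z. s *\<^sub>R z" and s = UNIV and g = g, OF _ g[OF sz]])
        (auto intro!: derivative_eq_intros)
    then have "((\<lambda>z. s ^ n *\<^sub>R g (s *\<^sub>R z)) has_derivative (\<lambda>v. s ^ n *\<^sub>R g' (s *\<^sub>R z) (s *\<^sub>R v))) (at z)"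
      by (rule has_derivative_scaleR_right)
    then have "((\<lambda>z. s ^ n *\<^sub>R g (s *\<^sub>R z)) has_derivative blinfun_apply (fx z s)) (at z)"
      by (rule back_subst) (use z s in \<open>auto simp: ap scaleR intro!: arg_cong[where f = "\<lambda>D. (_ has_derivative D) _"] ext\<close>)
    then show "((\<lambda>z. s ^ n *\<^sub>R g (s *\<^sub>R z)) has_derivative blinfun_apply (fx z s)) (at z within ball 0 R)"
      by (rule has_derivative_at_withinI)
  next
    fix z :: 'a assume "z \<in> ball 0 R"
    then show "(\<lambda>s. s ^ n *\<^sub>R g (s *\<^sub>R z)) integrable_on cbox 0 1"
      using integrable_radial[OF cg] by simp
  qed (use z cfx in \<open>auto simp: cbox_interval\<close>)
  then have 1: "(radial_mean n g has_derivative blinfun_apply (integral {0..1} (fx z))) (at z)"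
    using z by (simp add: radial_mean_def[abs_def] at_within_open[OF _ open_ball])
  have "fx z integrable_on {0..1}"
  proof (rule integrable_continuous_real)
    show "continuous_on {0..1} (fx z)"
      using continuous_on_compose2[OF cfx continuous_on_Pair_const]
        image_subsetI[of "{0..1}" "Pair z" "ball 0 R \<times> {0..1::real}"] z by simp
  qed
  then have "blinfun_apply (integral {0..1} (fx z)) v = integral {0..1} (\<lambda>s. blinfun_apply (fx z s) v)" for v
    by (rule blinfun_apply_integral)
  also have "\<dots> v = radial_mean (Suc n) (\<lambda>z. g' z v) z" for v
    unfolding radial_mean_def by (rule integral_cong) (use ap z in auto)
  finally show ?thesis using 1 by (metis (no_types, lifting) ext)
qed

lemma diff_family_radial_mean:
  fixes G :: "'x \<Rightarrow> 'a::euclidean_space \<Rightarrow> 'b::euclidean_space"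
  shows "diff_family k X (topspace X \<times> ball 0 R) G \<Longrightarrow>
    diff_family k X (topspace X \<times> ball 0 R) (\<lambda>x. radial_mean n (G x))"
proof (induction k arbitrary: G n)
  case 0
  then show ?case using joint_cont_radial_mean by simp
next
  case (Suc k)
  let ?W = "topspace X \<times> ball (0 :: 'a) R"
  have W: "openin (prod_topology X euclidean) ?W" by (simp add: openin_prod_Times_iff)
  let ?D = "\<lambda>v x z. frechet_derivative (G x) (at z) v"
  have D: "diff_family k X ?W (?D v)" if "v \<in> Basis" for v using Suc.prems that by simp
  show ?case
  proof (rule diff_family_SucI[OF W])
    show "joint_cont X ?W (\<lambda>x. radial_mean n (G x))"
      using Suc.prems by (intro joint_cont_radial_mean) simp
    show "(radial_mean n (G x) has_derivative (\<lambda>v. radial_mean (Suc n) (?D v x) z)) (at z)"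
      if p: "(x, z) \<in> ?W" for x z
    proof (rule has_derivative_radial_mean)
      show "(G x has_derivative frechet_derivative (G x) (at z)) (at z)" if "z \<in> ball 0 R" for z
        using diff_family_SucD[OF Suc.prems] p that by simp
      show "continuous_on (ball 0 R) (?D v x)" if "v \<in> Basis" for v
        by (rule joint_cont_slice[OF diff_family_imp_joint_cont[OF D[OF that]]]) (use p in simp)
      show "z \<in> ball 0 R" using p by simp
    qed
    show "diff_family k X ?W (\<lambda>x z. radial_mean (Suc n) (?D v x) z)" if "v \<in> Basis" for v
      by (rule Suc.IH[OF D[OF that]])
  qed
qed

section \<open>The Laplacian of a radial function\<close>

definition laplacian :: "(complex \<Rightarrow> real) \<Rightarrow> complex \<Rightarrow> real" where
  "laplacian f z = iter_partial [1, 1] f z + iter_partial [\<i>, \<i>] f z"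

lemma linear_complex_eq:
  fixes L :: "complex \<Rightarrow> real"
  assumes "linear L" shows "L v = Re v * L 1 + Im v * L \<i>"
proof -
  have "v = Re v *\<^sub>R 1 + Im v *\<^sub>R \<i>" by (simp add: complex_eq_iff)
  then have "L v = L (Re v *\<^sub>R 1 + Im v *\<^sub>R \<i>)" by simp
  then show ?thesis using assms by (simp add: linear_add linear_scale)
qed

text \<open>Let E f(z) be the derivative of f at z in the direction z. Along a ray, s \<mapsto> E
  f(s z) has derivative s |z|^2 \<Delta>f(s z), which integrates to the first claim. The derivative
  of s \<mapsto> f(s z) is E f(s z) / s; by the first claim it is s |z|^2 times a mean of \<Delta>f
  at s z, and it integrates to the second.\<close>

lemma radial_smooth_laplacian:
  fixes f :: "complex \<Rightarrow> real"
  assumes f: "smooth_on (ball 0 R) f"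
    and rad: "\<And>z z'. z \<in> ball 0 R \<Longrightarrow> norm z = norm z' \<Longrightarrow> f z = f z'"
    and z: "z \<in> ball 0 R"
  shows "frechet_derivative f (at z) z = (norm z)\<^sup>2 * radial_mean 1 (laplacian f) z"
    and "f z - f 0 = (norm z)\<^sup>2 * radial_mean 1 (radial_mean 1 (laplacian f)) z"
proof -
  define f1 where "f1 z = frechet_derivative f (at z) 1" for z
  define f2 where "f2 z = frechet_derivative f (at z) \<i>" for z
  let ?D = "\<lambda>f z. frechet_derivative f (at z)"
  have df: "(f has_derivative ?D f z) (at z)" if "z \<in> ball 0 R" for z
    using smooth_on_has_derivative[OF f that] .
  have df1: "(f1 has_derivative ?D f1 z) (at z)" if "z \<in> ball 0 R" for z
  proof -
    have "iter_partial [1] f differentiable (at z)"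
      using f that by (simp add: smooth_on_def Basis_complex_def del: iter_partial.simps)
    then show ?thesis by (simp add: f1_def[abs_def] frechet_derivative_works)
  qed
  have df2: "(f2 has_derivative ?D f2 z) (at z)" if "z \<in> ball 0 R" for z
  proof -
    have "iter_partial [\<i>] f differentiable (at z)"
      using f that by (simp add: smooth_on_def Basis_complex_def del: iter_partial.simps)
    then show ?thesis by (simp add: f2_def[abs_def] frechet_derivative_works)
  qed
  have lap: "laplacian f z = ?D f1 z 1 + ?D f2 z \<i>" for z
    by (simp add: laplacian_def f1_def[abs_def] f2_def[abs_def])
  have Df: "?D f z v = Re v * f1 z + Im v * f2 z" if "z \<in> ball 0 R" for z v
    unfolding f1_def f2_def by (rule linear_complex_eq[OF has_derivative_linear[OF df[OF that]]])
  have Df1: "?D f1 z v = Re v * ?D f1 z 1 + Im v * ?D f1 z \<i>" if "z \<in> ball 0 R" for z v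
    by (rule linear_complex_eq[OF has_derivative_linear[OF df1[OF that]]])
  have Df2: "?D f2 z v = Re v * ?D f2 z 1 + Im v * ?D f2 z \<i>" if "z \<in> ball 0 R" for z v
    by (rule linear_complex_eq[OF has_derivative_linear[OF df2[OF that]]])
  \<comment> \<open>Rotation invariance, differentiated along e^(is) z at s = 0: the angular
    derivative vanishes.\<close>
  have ang: "Re z * f2 z - Im z * f1 z = 0" if z: "z \<in> ball 0 R" for z
  proof -
    have "((\<lambda>s. cis s * z) has_derivative (\<lambda>s. s *\<^sub>R (\<i> * z))) (at 0)"
      by (rule has_derivative_eq_rhs, (rule derivative_intros)+) (auto simp: fun_eq_iff scaleR_conv_of_real)
    then have "((\<lambda>s. f (cis s * z)) has_derivative (\<lambda>s. ?D f z (s *\<^sub>R (\<i> * z)))) (at 0)"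
      using has_derivative_compose[of "\<lambda>s. cis s * z" _ 0 UNIV f "?D f z"] df[OF z] by simp
    moreover have eq: "(\<lambda>s. f (cis s * z)) = (\<lambda>s. f z)"
      by (intro ext sym[OF rad[OF z]]) (simp add: norm_mult)
    have "((\<lambda>s. f (cis s * z)) has_derivative (\<lambda>s. 0)) (at 0)"
      unfolding eq by (rule has_derivative_const)
    ultimately have "(\<lambda>s. ?D f z (s *\<^sub>R (\<i> * z))) = (\<lambda>s::real. 0)"
      by (rule has_derivative_unique)
    from fun_cong[OF this, of 1] have "?D f z (\<i> * z) = 0" by simp
    then show ?thesis unfolding Df[OF z, of "\<i> * z"] by simp
  qed
  \<comment> \<open>The angular derivative vanishes on the whole disc, so its derivative at w in the
    direction i w is zero as well. Combined with the second radial derivative this leaves |w|^2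
    times the Laplacian, the mixed terms cancelling in pairs.\<close>
  have pol: "Re w * f1 w + Im w * f2 w + ?D f1 w w * Re w + ?D f2 w w * Im w = (norm w)\<^sup>2 * laplacian f w"
    if w: "w \<in> ball 0 R" for w
  proof -
    have "((\<lambda>z. Re z * f2 z - Im z * f1 z) has_derivative
       (\<lambda>v. (Re w * ?D f2 w v + Re v * f2 w) - (Im w * ?D f1 w v + Im v * f1 w))) (at w)"
      by (intro has_derivative_diff has_derivative_mult has_derivative_Re has_derivative_Im
          has_derivative_ident df1 df2 w)
    moreover have "((\<lambda>z. Re z * f2 z - Im z * f1 z) has_derivative (\<lambda>v. 0)) (at w)"
      by (rule has_derivative_transform_within_open[of "\<lambda>_. 0" _ _ _ "ball 0 R"]) (use w ang in auto)
    ultimately have "(\<lambda>v. (Re w * ?D f2 w v + Re v * f2 w) - (Im w * ?D f1 w v + Im v * f1 w)) = (\<lambda>v. 0)"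
      by (rule has_derivative_unique)
    from fun_cong[OF this, of "\<i> * w"]
    have "(Re w * ?D f2 w (\<i> * w) + Re (\<i> * w) * f2 w) - (Im w * ?D f1 w (\<i> * w) + Im (\<i> * w) * f1 w) = 0" .
    then have "Re w * f1 w + Im w * f2 w
        = Re w * (Re w * ?D f2 w \<i> - Im w * ?D f2 w 1) - Im w * (Re w * ?D f1 w \<i> - Im w * ?D f1 w 1)"
      unfolding Df1[OF w, of "\<i> * w"] Df2[OF w, of "\<i> * w"] by (simp add: algebra_simps)
    then show ?thesis
      unfolding lap cmod_power2 Df1[OF w, of w] Df2[OF w, of w] by (simp add: algebra_simps power2_eq_square)
  qed
  have sz: "s *\<^sub>R z \<in> ball 0 R" if "s \<in> {0..1}" "z \<in> ball 0 R" for s and z :: complex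
    using scaleR_mem_ball that by blast
  have drv: "((\<lambda>s. g (s *\<^sub>R z)) has_vector_derivative ?D g (s *\<^sub>R z) z) (at s)"
    if "(g has_derivative ?D g (s *\<^sub>R z)) (at (s *\<^sub>R z))" for g :: "complex \<Rightarrow> real" and z s
  proof -
    have "((\<lambda>s. s *\<^sub>R z) has_derivative (\<lambda>t. t *\<^sub>R z)) (at s)"
      by (auto intro!: derivative_eq_intros)
    from has_derivative_compose[OF this that]
    have "((\<lambda>s. g (s *\<^sub>R z)) has_derivative (\<lambda>t. ?D g (s *\<^sub>R z) (t *\<^sub>R z))) (at s)" .
    then show ?thesis
      unfolding has_vector_derivative_def
      using linear_scale[OF has_derivative_linear[OF that]] by simp
  qed
  have cont: "continuous_on {0..1} (\<lambda>s. g (s *\<^sub>R z))"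
    if "\<And>z. z \<in> ball 0 R \<Longrightarrow> (g has_derivative ?D g z) (at z)" "z \<in> ball 0 R" for g :: "complex \<Rightarrow> real" and z
    using drv[OF that(1)[OF sz[OF _ that(2)]]]
    by (intro continuous_at_imp_continuous_on ballI) (blast intro: has_vector_derivative_continuous)
  have first: "?D f z z = (norm z)\<^sup>2 * radial_mean 1 (laplacian f) z" if z: "z \<in> ball 0 R" for z
  proof -
    \<comment> \<open>\<open>e s\<close> is the derivative of \<open>f\<close> at s z in the
      direction s z.\<close>
    define e where "e s = s * (Re z * f1 (s *\<^sub>R z) + Im z * f2 (s *\<^sub>R z))" for s
    have "((\<lambda>s. (norm z)\<^sup>2 * (s * laplacian f (s *\<^sub>R z))) has_integral e 1 - e 0) {0..1}"
    proof (rule fundamental_theorem_of_calculus_interior)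
      show "continuous_on {0..1} e"
        unfolding e_def by (intro continuous_intros cont df1 df2 z)
      fix s :: real assume s: "s \<in> {0<..<1}"
      let ?w = "s *\<^sub>R z"
      have w: "?w \<in> ball 0 R" using sz[OF _ z] s by simp
      have "(e has_vector_derivative s * (Re z * ?D f1 ?w z + Im z * ?D f2 ?w z) + 1 * (Re z * f1 ?w + Im z * f2 ?w)) (at s)"
        unfolding e_def
        by (intro has_vector_derivative_mult has_vector_derivative_add has_vector_derivative_mult_right
            drv df1 df2 w has_vector_derivative_id)
      moreover have "s * (Re z * ?D f1 ?w z + Im z * ?D f2 ?w z) + 1 * (Re z * f1 ?w + Im z * f2 ?w)
          = (norm z)\<^sup>2 * (s * laplacian f ?w)"
      proof -
        \<comment> \<open>\<open>pol\<close> at s z carries one more factor s, which is cancelled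
          because s > 0. For this reason the fundamental theorem is used in the form that asks for
          the derivative in the interior only.\<close>
        have "s * (s * (Re z * ?D f1 ?w z + Im z * ?D f2 ?w z) + 1 * (Re z * f1 ?w + Im z * f2 ?w))
            = s * ((norm z)\<^sup>2 * (s * laplacian f ?w))"
          using pol[OF w, unfolded Df1[OF w, of ?w] Df2[OF w, of ?w]]
          unfolding Df1[OF w, of z] Df2[OF w, of z] by (simp add: algebra_simps power2_eq_square)
        then show ?thesis using s by (simp only: mult_cancel_left) auto
      qed
      ultimately show "(e has_vector_derivative (norm z)\<^sup>2 * (s * laplacian f ?w)) (at s)" by metis
    qed simp
    then have "e 1 - e 0 = integral {0..1} (\<lambda>s. (norm z)\<^sup>2 * (s * laplacian f (s *\<^sub>R z)))"
      by (rule integral_unique[symmetric])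
    also have "\<dots> = (norm z)\<^sup>2 * radial_mean 1 (laplacian f) z"
      by (simp add: radial_mean_def)
    finally show ?thesis using Df[OF z, of z] by (simp add: e_def)
  qed
  show "?D f z z = (norm z)\<^sup>2 * radial_mean 1 (laplacian f) z" by (rule first[OF z])
  have "((\<lambda>s. (norm z)\<^sup>2 * (s * radial_mean 1 (laplacian f) (s *\<^sub>R z))) has_integral f (1 *\<^sub>R z) - f (0 *\<^sub>R z)) {0..1}"
  proof (rule fundamental_theorem_of_calculus_interior)
    show "continuous_on {0..1} (\<lambda>s. f (s *\<^sub>R z))" by (intro cont df z)
    fix s :: real assume s: "s \<in> {0<..<1}"
    let ?w = "s *\<^sub>R z"
    have w: "?w \<in> ball 0 R" using sz[OF _ z] s by simp
    have "s * ?D f ?w z = ?D f ?w ?w" using linear_scale[OF has_derivative_linear[OF df[OF w]]] by simp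
    also have "\<dots> = s * ((norm z)\<^sup>2 * (s * radial_mean 1 (laplacian f) ?w))"
      unfolding first[OF w] by (simp add: power2_eq_square)
    finally have "?D f ?w z = (norm z)\<^sup>2 * (s * radial_mean 1 (laplacian f) ?w)" using s by simp
    then show "((\<lambda>s. f (s *\<^sub>R z)) has_vector_derivative (norm z)\<^sup>2 * (s * radial_mean 1 (laplacian f) ?w)) (at s)"
      using drv[OF df[OF w]] by simp
  qed simp
  from integral_unique[OF this, symmetric]
  have "f z - f 0 = integral {0..1} (\<lambda>s. (norm z)\<^sup>2 * (s * radial_mean 1 (laplacian f) (s *\<^sub>R z)))"
    by simp
  also have "\<dots> = (norm z)\<^sup>2 * integral {0..1} (\<lambda>s. s * radial_mean 1 (laplacian f) (s *\<^sub>R z))"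
    by (rule integral_mult_right)
  also have "integral {0..1} (\<lambda>s. s * radial_mean 1 (laplacian f) (s *\<^sub>R z)) =
      radial_mean 1 (radial_mean 1 (laplacian f)) z"
    unfolding radial_mean_def[of 1 "radial_mean 1 _"] by simp
  finally show "f z - f 0 = (norm z)\<^sup>2 * radial_mean 1 (radial_mean 1 (laplacian f)) z" .
qed

lemma diff_family_laplacian:
  assumes W: "openin (prod_topology X euclidean) W" and F: "\<And>k. diff_family k X W F"
  shows "diff_family k X W (\<lambda>x. laplacian (F x))"
proof -
  have "diff_family k X W (\<lambda>x. iter_partial [v, v] (F x))" if "v \<in> Basis" for v
    by (rule diff_family_iter_partial[OF F]) (use that in simp)
  then have "diff_family k X W (\<lambda>x u. iter_partial [1, 1] (F x) u + iter_partial [\<i>, \<i>] (F x) u)"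
    by (intro diff_family_add[OF W]) (auto simp: Basis_complex_def simp del: iter_partial.simps)
  then show ?thesis by (simp add: laplacian_def[abs_def])
qed

section \<open>Reciprocals, roots and inverses of radial scalings\<close>

lemma diff_family_inverse_pos:
  assumes W: "openin (prod_topology X euclidean) W" and F: "diff_family k X W F"
    and pos: "\<And>x u. (x, u) \<in> W \<Longrightarrow> F x u > (0::real)"
  shows "diff_family k X W (\<lambda>x u. inverse (F x u))"
  using openin_subset[OF W] pos
  by (intro diff_family_compose[OF W _ F diff_family_inverse]) auto

lemma diff_family_sqrt_pos:
  assumes W: "openin (prod_topology X euclidean) W" and F: "diff_family k X W F"
    and pos: "\<And>x u. (x, u) \<in> W \<Longrightarrow> F x u > 0"
  shows "diff_family k X W (\<lambda>x u. sqrt (F x u))"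
  using openin_subset[OF W] pos
  by (intro diff_family_compose[OF W _ F diff_family_sqrt]) auto

lemma diff_family_diff:
  assumes W: "openin (prod_topology X euclidean) W" and "diff_family k X W F" "diff_family k X W G"
  shows "diff_family k X W (\<lambda>x u. F x u - G x u)"
  using diff_family_add[OF W assms(2) diff_family_bounded_linear[OF W bounded_linear_minus[OF bounded_linear_ident] assms(3)]]
  by simp

lemma diff_family_norm_power2:
  assumes W: "openin (prod_topology X euclidean) W" and "diff_family k X W F"
  shows "diff_family k X W (\<lambda>x u. (norm (F x u))\<^sup>2)"
  using diff_family_bilinear[OF W bounded_bilinear_inner assms(2,2)] by (simp add: power2_norm_eq_inner)

lemma openin_family_preimage:
  assumes W: "openin (prod_topology X euclidean) W" and W': "openin (prod_topology X euclidean) W'"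
    and F: "joint_cont X W F"
  shows "openin (prod_topology X euclidean) {(x, u) \<in> W. (x, F x u) \<in> W'}"
proof (subst openin_subopen, intro ballI)
  fix p assume "p \<in> {(x, u) \<in> W. (x, F x u) \<in> W'}"
  then obtain x u where p: "p = (x, u)" "(x, u) \<in> W" "(x, F x u) \<in> W'" by auto
  obtain U V where UV: "openin X U" "open V" "x \<in> U" "F x u \<in> V" "U \<times> V \<subseteq> W'"
    using W' p(3) by (rule openin_prod_euclidean_obtain)
  let ?T = "{(x, u) \<in> W. F x u \<in> V} \<inter> U \<times> UNIV"
  have "openin (prod_topology X euclidean) ?T"
    using UV by (intro openin_Int joint_cont_openin_preimage[OF W F]) (auto simp: openin_prod_Times_iff)
  then show "\<exists>T. openin (prod_topology X euclidean) T \<and> p \<in> T \<and> T \<subseteq> {(x, u) \<in> W. (x, F x u) \<in> W'}"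
    using UV p by (intro exI[of _ ?T]) auto
qed

text \<open>Over a one-point parameter space, \<open>diff_family\<close> for all \<open>k\<close> is
  ordinary smoothness, so every closure rule for families doubles as one for single maps.\<close>

abbreviation point_topology :: "unit topology" where
  "point_topology \<equiv> discrete_topology UNIV"

lemma smooth_on_iff_point_family:
  "open S \<Longrightarrow> smooth_on S f \<longleftrightarrow> (\<forall>k. diff_family k point_topology (UNIV \<times> S) (\<lambda>_. f))"
  using smooth_on_iff_family[of S "()" point_topology f] by simp

text \<open>The derivative of z \<mapsto> m(z) z is a multiple of the identity plus a map of rank
  one. It acts as \<open>m z\<close> on the kernel of \<open>m'\<close> and as
  \<open>m z + m' z z\<close> on the line of \<open>z\<close>, so \<open>pos\<close> and
  \<open>pos'\<close> make it invertible. The derivative of \<open>\<Psi>\<close> is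
  \<open>J\<close> evaluated at \<open>\<Psi>\<close>, with \<open>J\<close> smooth, and this raises
  the order of differentiability one step at a time.\<close>

lemma smooth_on_inverse_scaling:
  fixes m :: "'a::euclidean_space \<Rightarrow> real"
  assumes m: "smooth_on S m" and pos: "\<And>z. z \<in> S \<Longrightarrow> m z > 0"
    and pos': "\<And>z. z \<in> S \<Longrightarrow> m z + frechet_derivative m (at z) z > 0"
    and inv: "\<And>z. z \<in> S \<Longrightarrow> \<Psi> (m z *\<^sub>R z) = z"
  shows "smooth_on ((\<lambda>z. m z *\<^sub>R z) ` S) \<Psi>"
proof -
  let ?f = "\<lambda>z. m z *\<^sub>R z" and ?m' = "\<lambda>z. frechet_derivative m (at z)"
  let ?W = "\<lambda>S. (UNIV :: unit set) \<times> S" and ?P = point_topology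
  have S: "open S" using m by (rule smooth_on_imp_open)
  have dm: "(m has_derivative ?m' z) (at z)" if "z \<in> S" for z
    using smooth_on_has_derivative[OF m that] .
  have df: "(?f has_derivative (\<lambda>v. m z *\<^sub>R v + ?m' z v *\<^sub>R z)) (at z)" if "z \<in> S" for z
    by (rule has_derivative_scaleR[OF dm[OF that] has_derivative_ident])
  have cf: "continuous_on S ?f"
    by (intro continuous_at_imp_continuous_on ballI has_derivative_continuous[OF df])
  have inj: "inj_on ?f S" by (metis (no_types, lifting) inj_onI inv)
  define T where "T = ?f ` S"
  have T: "open T" unfolding T_def by (rule invariance_of_domain[OF cf S inj])
  \<comment> \<open>Sherman-Morrison: \<open>J z\<close> inverts the derivative \<open>v \<mapsto> m z v + (m' z v) z\<close> of \<open>z \<mapsto> m z z\<close>.\<close>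
  define J where "J z w = inverse (m z) *\<^sub>R (w - (?m' z w * inverse (m z + ?m' z z)) *\<^sub>R z)" for z w
  have d\<Psi>: "(\<Psi> has_derivative J (\<Psi> y)) (at y)" "\<Psi> y \<in> S" if "y \<in> T" for y
  proof -
    obtain z where z: "z \<in> S" "y = ?f z" using \<open>y \<in> T\<close> by (auto simp: T_def)
    interpret L: bounded_linear "?m' z" by (rule has_derivative_bounded_linear[OF dm[OF z(1)]])
    have "(\<Psi> has_derivative J z) (at (?f z))"
    proof (rule has_derivative_inverse_strong[OF S z(1) cf inv df[OF z(1)]])
      have nz: "m z \<noteq> 0" "m z + ?m' z z \<noteq> 0" using pos pos' z(1) by fastforce+
      have "m z *\<^sub>R J z w + ?m' z (J z w) *\<^sub>R z = w" for w
      proof -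
        have "?m' z (J z w) = inverse (m z) * (?m' z w - ?m' z w * inverse (m z + ?m' z z) * ?m' z z)"
          by (simp add: J_def L.scaleR L.diff)
        also have "\<dots> = ?m' z w * inverse (m z + ?m' z z)"
          using nz by (simp add: field_simps)
        finally show ?thesis using nz(1) by (simp add: J_def)
      qed
      then show "(\<lambda>v. m z *\<^sub>R v + ?m' z v *\<^sub>R z) \<circ> J z = id" by (simp add: fun_eq_iff)
    qed auto
    then show "(\<Psi> has_derivative J (\<Psi> y)) (at y)" "\<Psi> y \<in> S" using z inv by simp_all
  qed
  have WS: "openin (prod_topology ?P euclidean) (?W S)" and WT: "openin (prod_topology ?P euclidean) (?W T)"
    using S T by (simp_all add: openin_prod_Times_iff)
  have fm: "diff_family k ?P (?W S) (\<lambda>_. m)" for k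
    using m smooth_on_iff_point_family[OF S] by blast
  have fm': "diff_family k ?P (?W S) (\<lambda>_ z. ?m' z b)" if "b \<in> Basis" for k b
    using fm[of "Suc k"] that by simp
  have fz: "diff_family k ?P (?W S) (\<lambda>_ z. z)" for k
    by (rule diff_family_linear[OF WS bounded_linear_ident])
  \<comment> \<open>Families control derivatives in basis directions, so the derivative in the
    moving direction \<open>z\<close> is expanded in the basis.\<close>
  have euler: "?m' z z = (\<Sum>b\<in>Basis. (z \<bullet> b) *\<^sub>R ?m' z b)" if "z \<in> S" for z
  proof -
    interpret L: bounded_linear "?m' z" by (rule has_derivative_bounded_linear[OF dm[OF that]])
    have "?m' z z = ?m' z (\<Sum>b\<in>Basis. (z \<bullet> b) *\<^sub>R b)" by (simp add: euclidean_representation)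
    then show ?thesis by (simp only: L.sum L.scaleR)
  qed
  have fe: "diff_family k ?P (?W S) (\<lambda>_ z. ?m' z z)" for k
  proof (rule diff_family_cong[OF WS])
    show "diff_family k ?P (?W S) (\<lambda>_ z. \<Sum>b\<in>Basis. (z \<bullet> b) *\<^sub>R ?m' z b)"
      by (intro diff_family_sum[OF WS] diff_family_bilinear[OF WS bounded_bilinear_scaleR]
          diff_family_bounded_linear[OF WS bounded_linear_inner_left] fz fm') auto
  qed (use euler in auto)
  have fJ: "diff_family k ?P (?W S) (\<lambda>_ z. J z w)" if "w \<in> Basis" for k w
    unfolding J_def
    by (intro diff_family_bilinear[OF WS bounded_bilinear_scaleR] diff_family_diff[OF WS]
        diff_family_bilinear[OF WS bounded_bilinear_mult] diff_family_inverse_pos[OF WS]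
        diff_family_add[OF WS] diff_family_const[OF WS] fm fm' fe fz that) (auto simp: pos pos')
  have "diff_family k ?P (?W T) (\<lambda>_. \<Psi>)" for k
  proof (induction k)
    case 0
    have "continuous_on T \<Psi>"
      by (intro continuous_at_imp_continuous_on ballI has_derivative_continuous[OF d\<Psi>(1)])
    then show ?case by (auto intro: joint_cont_snd_on T)
  next
    case (Suc k)
    show ?case
    proof (rule diff_family_SucI[OF WT diff_family_imp_joint_cont[OF Suc]])
      show "(\<Psi> has_derivative J (\<Psi> y)) (at y)" if "(x, y) \<in> ?W T" for x :: unit and y
        using d\<Psi>(1) that by simp
      show "diff_family k ?P (?W T) (\<lambda>_ y. J (\<Psi> y) w)" if "w \<in> Basis" for w
        by (rule diff_family_compose[OF WT _ Suc fJ[OF that]]) (use d\<Psi>(2) in simp)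
    qed
  qed
  then show ?thesis using smooth_on_iff_point_family[OF T, of \<Psi>] by (simp add: T_def)
qed

text \<open>For smooth radial \<open>f\<close> this represents (f(z) - f(0)) / |z|^2; being an
  integral expression it needs no separate value at z = 0.\<close>

definition radial_quotient :: "(complex \<Rightarrow> real) \<Rightarrow> complex \<Rightarrow> real" where
  "radial_quotient f = radial_mean 1 (radial_mean 1 (laplacian f))"

lemma diff_family_radial_quotient:
  assumes "\<And>k. diff_family k X (topspace X \<times> ball 0 R) F"
  shows "diff_family k X (topspace X \<times> ball 0 R) (\<lambda>x. radial_quotient (F x))"
  unfolding radial_quotient_def
  by (intro diff_family_radial_mean diff_family_laplacian assms) (simp add: openin_prod_Times_iff)

section \<open>Polar spaces\<close>

abbreviation cylinder :: "(complex \<times> complex) set" where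
  "cylinder \<equiv> sphere 0 1 \<times> ball 0 (sqrt 2)"

definition polar_atlas ::
    "(complex \<times> complex \<Rightarrow> 'p) \<Rightarrow> (complex \<times> complex \<Rightarrow> 'p) \<Rightarrow> (real \<times> complex, 'p) atlas" where
  "polar_atlas j0 j1 =
     {({a<..<a + 2 * pi} \<times> ball 0 (sqrt 2), \<lambda>(\<theta>, z). j (cis \<theta>, z)) | a j. j \<in> {j0, j1}}"

text \<open>The foliated diffeomorphisms preserving both circles, described through \<open>g\<close>
  alone: the first equivalence says that \<open>h\<close> induces an injective map of levels,
  without naming \<sigma>. The description is unchanged when \<open>g\<close> is replaced by 2 -
  \<open>g\<close>.\<close>

definition level_diffeos :: "('p \<Rightarrow> real) \<Rightarrow> ('e::euclidean_space, 'p) atlas \<Rightarrow> ('p \<Rightarrow> 'p) set" where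
  "level_diffeos g A = {h \<in> diffeos A.
     (\<forall>P\<in>man_space A. \<forall>Q\<in>man_space A. g (h P) = g (h Q) \<longleftrightarrow> g P = g Q) \<and>
     (\<forall>P\<in>man_space A. g (h P) = 0 \<longleftrightarrow> g P = 0) \<and> (\<forall>P\<in>man_space A. g (h P) = 2 \<longleftrightarrow> g P = 2)}"

text \<open>The point of level \<open>u\<close> on the ray of \<open>Q\<close>, for \<open>g\<close>
  the squared radius in the tube \<open>j\<close>. Points of both circles are left in place: on the
  circle of level 0 there is no direction z / |z|, and the circle of level 2 lies outside the
  tube.\<close>

definition ray_point :: "('p \<Rightarrow> real) \<Rightarrow> (complex \<times> complex \<Rightarrow> 'p) \<Rightarrow> 'p \<Rightarrow> real \<Rightarrow> 'p" where
  "ray_point g j Q u =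
     (if 0 < g Q \<and> g Q < 2
      then let (w, z) = inv_into cylinder j Q in j (w, (sqrt u / norm z) *\<^sub>R z) else Q)"

lemma norm_less_sqrt_iff: "norm z < sqrt u \<longleftrightarrow> (norm z)\<^sup>2 < u"
  by (metis norm_ge_zero real_sqrt_abs abs_of_nonneg real_sqrt_less_iff)

lemma convex_pos: "t \<in> {0..1} \<Longrightarrow> a > 0 \<Longrightarrow> b > 0 \<Longrightarrow> (1 - t) * a + t * b > (0::real)"
  by (cases "t = 0") (auto intro!: add_nonneg_pos)

lemma convex_less: "t \<in> {0..1} \<Longrightarrow> a < a' \<Longrightarrow> b < b' \<Longrightarrow> (1 - t) * a + t * b < (1 - t) * a' + t * (b' :: real)"
  using convex_pos[of t "a' - a" "b' - b"] by (simp add: algebra_simps)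

lemma chart_rep_mem: "h (p x) \<in> q ` E \<Longrightarrow> chart_rep p E q h x \<in> E \<and> q (chart_rep p E q h x) = h (p x)"
  by (simp add: chart_rep_def inv_into_into f_inv_into_f)

text \<open>The axiom \<open>ray\<close> says that radial motion looks the same in both tubes. The axioms are invariant under exchanging the tubes and replacing
  \<open>g\<close> by \<open>2 - g\<close>, so each local statement is proved near the circle \<open>g = 0\<close> only.\<close>

locale polar_space =
  fixes L :: "'p set" and g :: "'p \<Rightarrow> real" and j0 j1 :: "complex \<times> complex \<Rightarrow> 'p"
  assumes bij_j0: "bij_betw j0 cylinder {P \<in> L. g P < 2}"
    and bij_j1: "bij_betw j1 cylinder {P \<in> L. g P > 0}"
    and g_j0: "(w, z) \<in> cylinder \<Longrightarrow> g (j0 (w, z)) = (norm z)\<^sup>2"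
    and g_j1: "(w, z) \<in> cylinder \<Longrightarrow> g (j1 (w, z)) = 2 - (norm z)\<^sup>2"
    and ray: "(w, z) \<in> cylinder \<Longrightarrow> (w', z') \<in> cylinder \<Longrightarrow> j0 (w, z) = j1 (w', z') \<Longrightarrow>
      s > 0 \<Longrightarrow> s' > 0 \<Longrightarrow> s\<^sup>2 * (norm z)\<^sup>2 + s'\<^sup>2 * (norm z')\<^sup>2 = 2 \<Longrightarrow>
      j0 (w, s *\<^sub>R z) = j1 (w', s' *\<^sub>R z')"
begin

lemma swap: "polar_space L (\<lambda>P. 2 - g P) j1 j0"
proof unfold_locales
  show "j1 (w, s *\<^sub>R z) = j0 (w', s' *\<^sub>R z')"
    if "(w, z) \<in> cylinder" "(w', z') \<in> cylinder" "j1 (w, z) = j0 (w', z')" "s > 0" "s' > 0"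
      "s\<^sup>2 * (norm z)\<^sup>2 + s'\<^sup>2 * (norm z')\<^sup>2 = 2" for w z w' z' s s'
    using ray[of w' z' w z s' s] that by (simp add: add.commute)
qed (use bij_j0 bij_j1 g_j0 g_j1 in auto)

lemma j0_mem: "(w, z) \<in> cylinder \<Longrightarrow> j0 (w, z) \<in> L"
  using bij_betwE[OF bij_j0] by blast

lemma j1_mem: "(w, z) \<in> cylinder \<Longrightarrow> j1 (w, z) \<in> L"
  using bij_betwE[OF bij_j1] by blast

lemma j0_inject: "p \<in> cylinder \<Longrightarrow> q \<in> cylinder \<Longrightarrow> j0 p = j0 q \<longleftrightarrow> p = q"
  using bij_j0 by (meson bij_betw_imp_inj_on inj_on_eq_iff)

lemma j0_obtain:
  assumes "P \<in> L" "g P < 2"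
  obtains w z where "(w, z) \<in> cylinder" "P = j0 (w, z)"
proof -
  have "P \<in> j0 ` cylinder" using assms bij_betw_imp_surj_on[OF bij_j0] by blast
  then show thesis using that by blast
qed

lemma g_bounds: assumes "P \<in> L" shows "0 \<le> g P" "g P \<le> 2"
proof -
  interpret sw: polar_space L "\<lambda>P. 2 - g P" j1 j0 by (rule swap)
  have "0 \<le> g P \<and> g P \<le> 2"
  proof (cases "g P < 2")
    case True
    then show ?thesis using assms by (elim j0_obtain) (auto simp: g_j0)
  next
    case False
    then obtain w z where "(w, z) \<in> cylinder" "P = j1 (w, z)"
      using sw.j0_obtain[OF assms] by auto
    then show ?thesis using False by (simp add: g_j1)
  qed
  then show "0 \<le> g P" "g P \<le> 2" by auto
qed

lemma man_space: "man_space (polar_atlas j0 j1) = L"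
proof -
  interpret sw: polar_space L "\<lambda>P. 2 - g P" j1 j0 by (rule swap)
  have 1: "(\<lambda>(\<theta>, z). j (cis \<theta>, z)) ` ({a<..<a + 2 * pi} \<times> ball 0 (sqrt 2)) \<subseteq> j ` cylinder" for j :: "_ \<Rightarrow> 'p" and a
    by auto
  have 2: "j ` cylinder \<subseteq> man_space (polar_atlas j0 j1)" if "j \<in> {j0, j1}" for j
  proof safe
    fix w z :: complex assume wz: "w \<in> sphere 0 1" "z \<in> ball (0::complex) (sqrt 2)"
    obtain a \<theta> where a: "\<theta> \<in> {a<..<a + 2 * pi}" "w = cis \<theta>" using cis_ex[of w] wz(1) by (metis mem_sphere_0)
    have "({a<..<a + 2 * pi} \<times> ball 0 (sqrt 2), \<lambda>(\<theta>, z). j (cis \<theta>, z)) \<in> polar_atlas j0 j1"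
      using that unfolding polar_atlas_def by blast
    moreover have "j (w, z) \<in> (\<lambda>(\<theta>, z). j (cis \<theta>, z)) ` ({a<..<a + 2 * pi} \<times> ball 0 (sqrt 2))"
      using a wz by (intro image_eqI[of _ _ "(\<theta>, z)"]) auto
    ultimately show "j (w, z) \<in> man_space (polar_atlas j0 j1)" unfolding man_space_def by blast
  qed
  have "man_space (polar_atlas j0 j1) = j0 ` cylinder \<union> j1 ` cylinder"
  proof
    show "man_space (polar_atlas j0 j1) \<subseteq> j0 ` cylinder \<union> j1 ` cylinder"
      unfolding man_space_def polar_atlas_def using 1[of j0] 1[of j1] by blast
  qed (use 2 in auto)
  also have "\<dots> = {P \<in> L. g P < 2} \<union> {P \<in> L. g P > 0}"
    using bij_j0 bij_j1 by (simp add: bij_betw_imp_surj_on)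
  also have "\<dots> = L" by auto
  finally show ?thesis .
qed

lemma ray_point_j0:
  assumes p: "(w, z) \<in> cylinder" and u: "0 \<le> u" "u < 2" "u = 0 \<longleftrightarrow> z = 0"
  shows "ray_point g j0 (j0 (w, z)) u = j0 (w, (sqrt u / norm z) *\<^sub>R z)"
proof (cases "z = 0")
  case True
  then show ?thesis using g_j0[OF p] by (simp add: ray_point_def)
next
  case False
  have "inv_into cylinder j0 (j0 (w, z)) = (w, z)"
    using p bij_j0 by (meson bij_betw_imp_inj_on inv_into_f_f)
  moreover have "0 < g (j0 (w, z))" "g (j0 (w, z)) < 2"
    using False p g_j0[OF p] norm_less_sqrt_iff[of z 2] by auto
  ultimately show ?thesis by (simp add: ray_point_def)
qed

text \<open>The axiom \<open>ray\<close> with the scalings sqrt u / |z| and sqrt (2 - u) / |z'|: the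
  new squared radii are u and 2 - u, which add up to 2 as required.\<close>

lemma ray_point_swap:
  assumes Q: "Q \<in> L" and u: "0 < g Q \<Longrightarrow> g Q < 2 \<Longrightarrow> 0 < u \<and> u < 2"
  shows "ray_point (\<lambda>P. 2 - g P) j1 Q (2 - u) = ray_point g j0 Q u"
proof (cases "0 < g Q \<and> g Q < 2")
  case True
  interpret sw: polar_space L "\<lambda>P. 2 - g P" j1 j0 by (rule swap)
  obtain w z where wz: "(w, z) \<in> cylinder" "Q = j0 (w, z)" using True Q by (auto elim: j0_obtain)
  obtain w' z' where wz': "(w', z') \<in> cylinder" "Q = j1 (w', z')" using True Q by (auto elim: sw.j0_obtain)
  have z: "(norm z)\<^sup>2 = g Q" "(norm z')\<^sup>2 = 2 - g Q" using wz wz' g_j0[OF wz(1)] g_j1[OF wz'(1)] by simp_all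
  then have nz: "z \<noteq> 0" "z' \<noteq> 0" using True by auto
  have u: "0 < u" "u < 2" using u True by auto
  have "ray_point g j0 Q u = j0 (w, (sqrt u / norm z) *\<^sub>R z)"
    unfolding wz(2) using u nz by (intro ray_point_j0[OF wz(1)]) auto
  also have "\<dots> = j1 (w', (sqrt (2 - u) / norm z') *\<^sub>R z')"
    using wz wz' u nz by (intro ray) (auto simp: power_divide)
  also have "\<dots> = ray_point (\<lambda>P. 2 - g P) j1 Q (2 - u)"
    unfolding wz'(2) using u nz by (intro sw.ray_point_j0[OF wz'(1), symmetric]) auto
  finally show ?thesis by simp
qed (auto simp: ray_point_def)

end

lemma polar_atlas_swap: "polar_atlas j1 j0 = polar_atlas j0 j1"
  unfolding polar_atlas_def by (simp add: insert_commute)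

lemma level_diffeos_swap: "level_diffeos (\<lambda>P. 2 - g P) A = level_diffeos g A"
proof -
  have eq: "2 - g P = 2 - g Q \<longleftrightarrow> g P = g Q" "2 - g P = 0 \<longleftrightarrow> g P = 2" "2 - g P = 2 \<longleftrightarrow> g P = 0" for P Q
    by auto
  show ?thesis unfolding level_diffeos_def eq by blast
qed

lemma smooth_on_cong:
  assumes f: "smooth_on S f" and eq: "\<And>x. x \<in> S \<Longrightarrow> f x = f' x"
  shows "smooth_on S f'"
proof -
  have S: "open S" using f by (rule smooth_on_imp_open)
  have W: "openin (prod_topology point_topology euclidean) (UNIV \<times> S)"
    using S by (simp add: openin_prod_Times_iff)
  have "diff_family k point_topology (UNIV \<times> S) (\<lambda>_. f')" for k
    by (rule diff_family_cong[OF W, of "\<lambda>_. f"]) (use f eq in \<open>auto simp: smooth_on_iff_point_family[OF S]\<close>)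
  then show ?thesis by (simp add: smooth_on_iff_point_family[OF S])
qed

lemma smooth_map_iff:
  "smooth_map A B f \<longleftrightarrow> f ` man_space A \<subseteq> man_space B \<and>
    (\<forall>D p E q. (D, p) \<in> A \<longrightarrow> (E, q) \<in> B \<longrightarrow>
      smooth_on {x \<in> D. f (p x) \<in> q ` E} (chart_rep p E q f))"
  unfolding smooth_map_def by auto

lemma smooth_map_cong:
  assumes eq: "\<And>P. P \<in> man_space A \<Longrightarrow> f P = f' P" and f: "smooth_map A B f"
  shows "smooth_map A B f'"
  unfolding smooth_map_iff
proof (intro conjI allI impI)
  have "f ` man_space A = f' ` man_space A" using eq by (rule image_cong[OF refl])
  then show "f' ` man_space A \<subseteq> man_space B" using f by (auto simp: smooth_map_def)
  fix D p E q assume D: "(D, p) \<in> A" and E: "(E, q) \<in> B"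
  have eqD: "f (p x) = f' (p x)" if "x \<in> D" for x
    using D that by (intro eq) (auto simp: man_space_def)
  have "smooth_on {x \<in> D. f (p x) \<in> q ` E} (chart_rep p E q f)"
    using f D E by (auto simp: smooth_map_iff)
  moreover have "{x \<in> D. f (p x) \<in> q ` E} = {x \<in> D. f' (p x) \<in> q ` E}" using eqD by auto
  ultimately have "smooth_on {x \<in> D. f' (p x) \<in> q ` E} (chart_rep p E q f)" by simp
  then show "smooth_on {x \<in> D. f' (p x) \<in> q ` E} (chart_rep p E q f')"
    by (rule smooth_on_cong) (use eqD in \<open>auto simp: chart_rep_def\<close>)
qed

lemma diffeos_inverse:
  assumes h: "h \<in> diffeos A"
  shows "restrict (inv_into (man_space A) h) (man_space A) \<in> diffeos A"
proof -
  let ?M = "man_space A" and ?k = "restrict (inv_into (man_space A) h) (man_space A)"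
  have b: "bij_betw h ?M ?M" and s: "smooth_map A A h" "smooth_map A A (inv_into ?M h)"
    using h by (auto simp: diffeos_def diffeomorphism_def)
  have kb: "bij_betw ?k ?M ?M"
    using bij_betw_inv_into[OF b] by (simp cong: bij_betw_cong)
  have "inv_into ?M ?k P = h P" if P: "P \<in> ?M" for P
  proof -
    have "h P \<in> ?M" using b P bij_betwE by blast
    moreover have "?k (h P) = P" using b P by (simp add: \<open>h P \<in> ?M\<close> bij_betw_inv_into_left)
    ultimately show ?thesis using kb by (metis bij_betw_imp_inj_on inv_into_f_f)
  qed
  then have "smooth_map A A (inv_into ?M ?k)" using smooth_map_cong[OF _ s(1), of "inv_into ?M ?k"] by simp
  moreover have "smooth_map A A ?k" using smooth_map_cong[OF _ s(2), of ?k] by simp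
  ultimately show ?thesis using kb by (simp add: diffeos_def diffeomorphism_def)
qed

section \<open>The level function of a diffeomorphism and its quotient by the squared radius\<close>

context polar_space
begin

abbreviation "A \<equiv> polar_atlas j0 j1"
abbreviation "G \<equiv> level_diffeos g A"

lemma A_nonempty: "A \<noteq> {}"
  by (auto simp: polar_atlas_def)

lemma chart_mem: "({a<..<a + 2 * pi} \<times> ball 0 (sqrt 2), \<lambda>(\<theta>, z). j0 (cis \<theta>, z)) \<in> A"
  unfolding polar_atlas_def by blast

definition inverse_diffeo :: "('p \<Rightarrow> 'p) \<Rightarrow> 'p \<Rightarrow> 'p" where
  "inverse_diffeo h = restrict (inv_into L h) L"

text \<open>This is \<sigma>(|z|^2), read on the disc over the base point 1. By
  \<open>level_j0\<close> every other base point gives the same value.\<close>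

definition level :: "('p \<Rightarrow> 'p) \<Rightarrow> complex \<Rightarrow> real" where
  "level h z = g (h (j0 (1, z)))"

lemma G_smooth_maps: "h \<in> G \<Longrightarrow> h \<in> smooth_maps A A"
  by (simp add: level_diffeos_def diffeos_def diffeomorphism_def smooth_maps_def)

lemma G_constant_family:
  "h \<in> G \<Longrightarrow> continuous_map point_topology (smooth_topology A A) (\<lambda>_. h)"
  using G_smooth_maps[of h] by (simp add: topspace_smooth_topology[OF A_nonempty A_nonempty])

lemma G_bij: "h \<in> G \<Longrightarrow> bij_betw h L L"
  by (simp add: level_diffeos_def diffeos_def diffeomorphism_def man_space)

lemma G_mem: "h \<in> G \<Longrightarrow> P \<in> L \<Longrightarrow> h P \<in> L"
  using G_bij bij_betwE by blast

lemma G_level: "h \<in> G \<Longrightarrow> P \<in> L \<Longrightarrow> Q \<in> L \<Longrightarrow> g (h P) = g (h Q) \<longleftrightarrow> g P = g Q"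
  by (simp add: level_diffeos_def man_space)

lemma G_level_0: "h \<in> G \<Longrightarrow> P \<in> L \<Longrightarrow> g (h P) = 0 \<longleftrightarrow> g P = 0"
  by (simp add: level_diffeos_def man_space)

lemma G_level_2: "h \<in> G \<Longrightarrow> P \<in> L \<Longrightarrow> g (h P) = 2 \<longleftrightarrow> g P = 2"
  by (simp add: level_diffeos_def man_space)

lemma inverse_diffeo_left: "h \<in> G \<Longrightarrow> P \<in> L \<Longrightarrow> inverse_diffeo h (h P) = P"
  using G_bij[of h] G_mem[of h P] by (simp add: inverse_diffeo_def bij_betw_inv_into_left)

lemma inverse_diffeo_right: "h \<in> G \<Longrightarrow> P \<in> L \<Longrightarrow> h (inverse_diffeo h P) = P"
  using G_bij[of h] by (simp add: inverse_diffeo_def bij_betw_inv_into_right)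

lemma inverse_diffeo_mem: "h \<in> G \<Longrightarrow> P \<in> L \<Longrightarrow> inverse_diffeo h P \<in> L"
  using bij_betwE[OF bij_betw_inv_into[OF G_bij[of h]]] by (simp add: inverse_diffeo_def)

lemma inverse_diffeo_G:
  assumes h: "h \<in> G" shows "inverse_diffeo h \<in> G"
proof -
  let ?k = "inverse_diffeo h"
  have "?k \<in> diffeos A"
    using diffeos_inverse[of h A] h by (simp add: level_diffeos_def inverse_diffeo_def man_space)
  moreover have "g (?k P) = g (?k Q) \<longleftrightarrow> g P = g Q" if "P \<in> L" "Q \<in> L" for P Q
    using G_level[OF h, of "?k P" "?k Q"] that by (simp add: inverse_diffeo_right[OF h] inverse_diffeo_mem[OF h])
  moreover have "g (?k P) = 0 \<longleftrightarrow> g P = 0" "g (?k P) = 2 \<longleftrightarrow> g P = 2" if "P \<in> L" for P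
    using G_level_0[OF h, of "?k P"] G_level_2[OF h, of "?k P"] that
    by (simp_all add: inverse_diffeo_right[OF h] inverse_diffeo_mem[OF h])
  ultimately show ?thesis by (simp add: level_diffeos_def man_space)
qed

lemma level_j0:
  assumes "h \<in> G" "(w, z) \<in> cylinder"
  shows "g (h (j0 (w, z))) = level h z"
  unfolding level_def using assms by (subst G_level) (auto intro!: j0_mem simp: g_j0)

lemma level_radial:
  assumes "h \<in> G" "z \<in> ball 0 (sqrt 2)" "norm z = norm z'"
  shows "level h z = level h z'"
  unfolding level_def using assms by (subst G_level) (auto intro!: j0_mem simp: g_j0)

lemma level_0: "h \<in> G \<Longrightarrow> level h 0 = 0"
  unfolding level_def by (subst G_level_0) (auto intro!: j0_mem simp: g_j0)

lemma level_pos: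
  assumes "h \<in> G" "z \<in> ball 0 (sqrt 2)" "z \<noteq> 0"
  shows "level h z > 0"
proof -
  have "j0 (1, z) \<in> L" using assms by (intro j0_mem) auto
  moreover have "g (j0 (1, z)) \<noteq> 0" using assms by (subst g_j0) auto
  ultimately show ?thesis
    using G_level_0[OF assms(1)] g_bounds(1)[OF G_mem[OF assms(1)]] by (force simp: level_def)
qed

lemma level_less:
  assumes "h \<in> G" "z \<in> ball 0 (sqrt 2)"
  shows "level h z < 2"
proof -
  have "j0 (1, z) \<in> L" using assms by (intro j0_mem) auto
  moreover have "g (j0 (1, z)) \<noteq> 2"
    using assms norm_less_sqrt_iff[of z 2] by (subst g_j0) auto
  ultimately show ?thesis
    using G_level_2[OF assms(1)] g_bounds(2)[OF G_mem[OF assms(1)]] by (force simp: level_def)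
qed

text \<open>The level is the squared disc coordinate of the local representative at angle 0. The
  target chart has to contain the angle of the image point, which varies, hence the argument near
  one parameter and one point at a time.\<close>

lemma diff_family_level:
  assumes \<Phi>: "continuous_map Y (smooth_topology A A) \<Phi>" and G: "\<And>y. y \<in> topspace Y \<Longrightarrow> \<Phi> y \<in> G"
  shows "diff_family k Y (topspace Y \<times> ball 0 (sqrt 2)) (\<lambda>y. level (\<Phi> y))"
proof (rule diff_family_local)
  fix p0 assume p0: "p0 \<in> topspace Y \<times> ball (0::complex) (sqrt 2)"
  obtain y0 z0 where yz: "p0 = (y0, z0)" "y0 \<in> topspace Y" "z0 \<in> ball 0 (sqrt 2)" using p0 by auto
  have "j0 (1, z0) \<in> L" using yz by (intro j0_mem) auto
  then have "\<Phi> y0 (j0 (1, z0)) \<in> L" "g (\<Phi> y0 (j0 (1, z0))) < 2"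
    using G_mem[OF G[OF yz(2)]] level_less[OF G[OF yz(2)] yz(3)] by (auto simp: level_def)
  then obtain w' z' where wz': "(w', z') \<in> cylinder" "\<Phi> y0 (j0 (1, z0)) = j0 (w', z')"
    by (rule j0_obtain)
  obtain a \<theta> where a: "\<theta> \<in> {a<..<a + 2 * pi}" "w' = cis \<theta>"
    using cis_ex[of w'] wz'(1) by (metis mem_Sigma_iff mem_sphere_0)
  define p where "p = (\<lambda>(\<theta>::real, z). j0 (cis \<theta>, z))"
  \<comment> \<open>The angle interval is centred at 0, so that the base point 1 = cis 0 lies in the
    chart.\<close>
  define D where "D = {-pi<..<-pi + 2 * pi} \<times> ball (0::complex) (sqrt 2)"
  define E where "E = {a<..<a + 2 * pi} \<times> ball (0::complex) (sqrt 2)"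
  have D: "(D, p) \<in> A" and E: "(E, p) \<in> A" unfolding D_def E_def p_def by (rule chart_mem)+
  let ?R = "rep_dom Y D p E p \<Phi>"
  let ?B = "topspace Y \<times> ball (0::complex) (sqrt 2)"
  have B: "openin (prod_topology Y euclidean) ?B" by (simp add: openin_prod_Times_iff)
  have lin: "bounded_linear (\<lambda>z::complex. (0::real, z))"
    by (intro bounded_linear_Pair bounded_linear_zero bounded_linear_ident)
  define W where "W = {(y, z) \<in> ?B. (y, (0, z)) \<in> ?R}"
  have W: "openin (prod_topology Y euclidean) W"
    unfolding W_def
    by (rule openin_family_preimage[OF B smooth_topology_eval(1)[OF \<Phi> D E]
        diff_family_imp_joint_cont[OF diff_family_linear[OF B lin, of 0]]])
  have eq: "(norm (snd (chart_rep p E p (\<Phi> y) (0, z))))\<^sup>2 = level (\<Phi> y) z" if "(y, z) \<in> W" for y z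
  proof -
    have "\<Phi> y (p (0, z)) \<in> p ` E" using that by (auto simp: W_def rep_dom_def)
    then obtain e where e: "chart_rep p E p (\<Phi> y) (0, z) = e" "e \<in> E" "p e = \<Phi> y (p (0, z))"
      by (simp add: chart_rep_def inv_into_into f_inv_into_f)
    have "level (\<Phi> y) z = g (p e)" by (simp add: e(3)) (simp add: p_def level_def)
    also have "\<dots> = (norm (snd e))\<^sup>2"
      using e(2) g_j0[of "cis (fst e)" "snd e"] by (auto simp: p_def E_def split_def)
    finally show ?thesis by (simp add: e(1))
  qed
  have "diff_family k Y W (\<lambda>y z. (norm (snd (chart_rep p E p (\<Phi> y) (0, z))))\<^sup>2)"
    by (intro diff_family_norm_power2[OF W] diff_family_bounded_linear[OF W bounded_linear_snd]
        diff_family_compose[OF W _ diff_family_linear[OF W lin] smooth_topology_eval(2)[OF \<Phi> D E]])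
      (auto simp: W_def)
  then have "diff_family k Y W (\<lambda>y. level (\<Phi> y))"
    using eq by (rule diff_family_cong[OF W, rotated])
  moreover have "p0 \<in> W"
  proof -
    have "\<Phi> y0 (p (0, z0)) \<in> p ` E"
      using a wz' by (intro image_eqI[of _ _ "(\<theta>, z')"]) (auto simp: p_def E_def)
    then show ?thesis using yz by (auto simp: W_def rep_dom_def D_def)
  qed
  ultimately show "\<exists>W'. p0 \<in> W' \<and> diff_family k Y W' (\<lambda>y. level (\<Phi> y))" by blast
qed

lemma smooth_level:
  assumes h: "h \<in> G"
  shows "smooth_on (ball 0 (sqrt 2)) (level h)"
proof -
  from diff_family_level[OF G_constant_family[OF h]] h show ?thesis by (simp add: smooth_on_iff_point_family)
qed

lemma level_has_derivative:
  assumes "h \<in> G" "z \<in> ball 0 (sqrt 2)"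
  shows "(level h has_derivative frechet_derivative (level h) (at z)) (at z)"
  using smooth_on_has_derivative[OF smooth_level[OF assms(1)] assms(2)] .

definition level_quotient :: "('p \<Rightarrow> 'p) \<Rightarrow> complex \<Rightarrow> real" where
  "level_quotient h = radial_quotient (level h)"

lemma level_eq_quotient:
  assumes "h \<in> G" "z \<in> ball 0 (sqrt 2)"
  shows "level h z = (norm z)\<^sup>2 * level_quotient h z"
  using radial_smooth_laplacian(2)[OF smooth_level[OF assms(1)] level_radial[OF assms(1)] assms(2)] level_0[OF assms(1)]
  by (simp add: level_quotient_def radial_quotient_def)

lemma diff_family_level_quotient:
  assumes "continuous_map Y (smooth_topology A A) \<Phi>" and "\<And>y. y \<in> topspace Y \<Longrightarrow> \<Phi> y \<in> G"
  shows "diff_family k Y (topspace Y \<times> ball 0 (sqrt 2)) (\<lambda>y. level_quotient (\<Phi> y))"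
  unfolding level_quotient_def
  by (intro diff_family_radial_quotient diff_family_level assms)

lemma smooth_level_quotient:
  assumes h: "h \<in> G"
  shows "smooth_on (ball 0 (sqrt 2)) (level_quotient h)"
proof -
  from diff_family_level_quotient[OF G_constant_family[OF h]] h show ?thesis by (simp add: smooth_on_iff_point_family)
qed

lemma level_inverse:
  assumes h: "h \<in> G" and z: "z \<in> ball 0 (sqrt 2)" and z': "(norm z')\<^sup>2 = level h z"
  shows "z' \<in> ball 0 (sqrt 2)" "level (inverse_diffeo h) z' = (norm z)\<^sup>2"
proof -
  show b: "z' \<in> ball 0 (sqrt 2)" using level_less[OF h z] z' by (simp add: norm_less_sqrt_iff)
  have m: "j0 (1, z) \<in> L" "j0 (1, z') \<in> L" using z b by (auto intro!: j0_mem)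
  have "g (h (j0 (1, z))) = g (j0 (1, z'))" using z' b g_j0[of 1 z'] by (simp add: level_def)
  then have "g (inverse_diffeo h (h (j0 (1, z)))) = g (inverse_diffeo h (j0 (1, z')))"
    using G_level[OF inverse_diffeo_G[OF h] G_mem[OF h m(1)] m(2)] by simp
  then show "level (inverse_diffeo h) z' = (norm z)\<^sup>2"
    using g_j0[of 1 z] z by (simp add: inverse_diffeo_left[OF h m(1)] level_def)
qed

text \<open>Along a ray the level is continuous and injective, hence strictly monotone; it is 0 at
  the centre and positive elsewhere, so it increases.\<close>

lemma level_strict_mono:
  assumes h: "h \<in> G" and z': "z' \<in> ball 0 (sqrt 2)" and less: "norm z < norm z'"
  shows "level h z < level h z'"
proof (cases "z = 0")
  case True
  then show ?thesis using level_pos[OF h z'] level_0[OF h] less by auto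
next
  case False
  let ?s = "\<lambda>r::real. level h (of_real r)"
  have sub: "complex_of_real r \<in> ball 0 (sqrt 2)" if "r \<in> {0..norm z'}" for r
    using that z' by auto
  have "continuous_on {0..norm z'} ?s"
  proof (rule continuous_on_compose2[of "ball 0 (sqrt 2)" "level h"])
    show "continuous_on (ball 0 (sqrt 2)) (level h)"
      using smooth_on_continuous_iter_partial[OF smooth_level[OF h], of "[]"] by simp
  qed (use sub in \<open>auto intro!: continuous_intros\<close>)
  moreover have "inj_on ?s {0..norm z'}"
  proof (rule inj_onI)
    fix r s assume r: "r \<in> {0..norm z'}" and s: "s \<in> {0..norm z'}" and eq: "?s r = ?s s"
    have "g (j0 (1, of_real r)) = g (j0 (1, of_real s))"
      using eq sub[OF r] sub[OF s] unfolding level_def by (subst (asm) G_level[OF h]) (auto intro!: j0_mem)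
    then have "r\<^sup>2 = s\<^sup>2" using sub[OF r] sub[OF s] by (simp add: g_j0)
    then show "r = s" using r s by simp
  qed
  ultimately have "?s 0 < ?s (norm z) \<and> ?s (norm z) < ?s (norm z') \<or> ?s (norm z') < ?s (norm z) \<and> ?s (norm z) < ?s 0"
    using False less by (intro continuous_inj_imp_mono) auto
  moreover have "?s 0 < ?s (norm z)"
    using level_pos[OF h, of "of_real (norm z)"] level_0[OF h] sub[of "norm z"] False less by auto
  moreover have "?s (norm z) = level h z" "?s (norm z') = level h z'"
    using sub[of "norm z"] sub[of "norm z'"] less by (auto intro!: level_radial[OF h])
  ultimately show ?thesis by auto
qed

text \<open>At z = 0 the inverse of \<open>h\<close> decides. For z \<noteq> 0 and |z'|^2 =
  \<open>level h z\<close>, the quotient of \<open>h\<close> at z times that of its inverse at z' is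
  1. As z tends to 0 so does z', hence the two quotients at 0 have product 1; that of
  \<open>h\<close> is a limit of nonnegative numbers, so it is positive.\<close>

lemma level_quotient_pos:
  assumes h: "h \<in> G" and z: "z \<in> ball 0 (sqrt 2)"
  shows "level_quotient h z > 0"
proof (cases "z = 0")
  case False
  then show ?thesis
    using level_pos[OF h z] level_eq_quotient[OF h z] by (simp add: zero_less_mult_iff)
next
  case True
  let ?k = "inverse_diffeo h" and ?B = "ball (0::complex) (sqrt 2)"
  have k: "?k \<in> G" by (rule inverse_diffeo_G[OF h])
  have B: "open ?B" "0 \<in> ?B" by auto
  have c: "isCont (level_quotient h') 0" "isCont (level h') 0" if "h' \<in> G" for h'
    using smooth_on_continuous_iter_partial[OF smooth_level_quotient[OF that], of "[]"]
      smooth_on_continuous_iter_partial[OF smooth_level[OF that], of "[]"]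
    by (simp_all add: continuous_on_eq_continuous_at)
  let ?z' = "\<lambda>z. complex_of_real (sqrt (level h z))"
  have ev: "eventually (\<lambda>z. z \<in> ?B \<and> z \<noteq> 0) (at 0)"
    using eventually_at_in_open'[OF B] by (simp add: eventually_at_filter eventually_conj_iff)
  have pos: "eventually (\<lambda>z. level_quotient h z \<ge> 0) (at 0)"
    using ev by eventually_elim
      (use level_pos[OF h] level_eq_quotient[OF h] in \<open>force simp: zero_less_mult_iff\<close>)
  have one: "eventually (\<lambda>z. level_quotient h z * level_quotient ?k (?z' z) = 1) (at 0)"
    using ev
  proof eventually_elim
    case (elim z)
    then have z: "z \<in> ?B" "z \<noteq> 0" by auto
    have n: "(norm (?z' z))\<^sup>2 = level h z" using level_pos[OF h z] by simp
    have "(norm z)\<^sup>2 = (norm z)\<^sup>2 * (level_quotient h z * level_quotient ?k (?z' z))"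
      using level_inverse[OF h z(1) n] level_eq_quotient[OF k, of "?z' z"] n level_eq_quotient[OF h z(1)]
      by (simp add: mult.assoc)
    then show ?case using z(2) by simp
  qed
  have "(level h \<longlongrightarrow> 0) (at 0)"
    using c(2)[OF h] by (simp add: isCont_def level_0[OF h])
  from tendsto_of_real[OF tendsto_real_sqrt[OF this]]
  have "((\<lambda>z. ?z' z) \<longlongrightarrow> 0) (at 0)" by simp
  then have "((\<lambda>z. level_quotient ?k (?z' z)) \<longlongrightarrow> level_quotient ?k 0) (at 0)"
    by (rule isCont_tendsto_compose[OF c(1)[OF k]])
  then have "((\<lambda>z. level_quotient h z * level_quotient ?k (?z' z)) \<longlongrightarrow> level_quotient h 0 * level_quotient ?k 0) (at 0)"
    using c(1)[OF h] unfolding isCont_def by (intro tendsto_mult)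
  moreover have "((\<lambda>z. level_quotient h z * level_quotient ?k (?z' z)) \<longlongrightarrow> 1) (at 0)"
    by (rule Lim_transform_eventually[OF tendsto_const eventually_mono[OF one]]) (rule sym)
  ultimately have "level_quotient h 0 * level_quotient ?k 0 = 1"
    using tendsto_unique[OF at_neq_bot] by blast
  moreover have "level_quotient h 0 \<ge> 0"
    by (rule tendsto_lowerbound[OF _ pos]) (use c(1)[OF h] in \<open>simp_all add: isCont_def\<close>)
  moreover have "level_quotient h 0 \<noteq> 0" using calculation(1) by auto
  ultimately show ?thesis using True by simp
qed

text \<open>Monotonicity makes the derivative nonnegative. Were it zero, the chain rule would give
  derivative zero at s = 1 to \<sigma>^(-1)(\<sigma>(|s z|^2)) = s^2 |z|^2, whose derivative there
  is 2 |z|^2.\<close>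

lemma level_radial_derivative_pos:
  assumes h: "h \<in> G" and z: "z \<in> ball 0 (sqrt 2)" "z \<noteq> 0"
  shows "frechet_derivative (level h) (at z) z > 0"
proof -
  let ?k = "inverse_diffeo h"
  have k: "?k \<in> G" by (rule inverse_diffeo_G[OF h])
  let ?d = "frechet_derivative (level h) (at z) z" and ?\<phi> = "\<lambda>s::real. level h (s *\<^sub>R z)"
  have lin: "((\<lambda>s. s *\<^sub>R z) has_derivative (\<lambda>t. t *\<^sub>R z)) (at 1)"
    by (auto intro!: derivative_eq_intros)
  have dd: "(?\<phi> has_derivative (\<lambda>t. frechet_derivative (level h) (at z) (t *\<^sub>R z))) (at 1)"
    using has_derivative_compose[OF lin, of "level h"] level_has_derivative[OF h z(1)] by simp
  then have d: "(?\<phi> has_real_derivative ?d) (at 1)"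
    unfolding has_field_derivative_def
    using linear_scale[OF has_derivative_linear[OF level_has_derivative[OF h z(1)]]]
    by (simp add: mult_commute_abs)
  have "?d \<ge> 0"
  proof (rule ccontr)
    assume "\<not> ?d \<ge> 0"
    then obtain e where e: "e > 0" "\<And>t. 0 < t \<Longrightarrow> t < e \<Longrightarrow> ?\<phi> 1 < ?\<phi> (1 - t)"
      using DERIV_neg_dec_left[OF d] by auto
    define t where "t = min (e / 2) (1 / 2)"
    have t: "0 < t" "t < e" "t < 1" using e(1) by (auto simp: t_def)
    have "norm ((1 - t) *\<^sub>R z) < norm z" using t z(2) by simp
    then have "?\<phi> (1 - t) < level h z" by (rule level_strict_mono[OF h z(1)])
    then show False using e(2)[OF t(1,2)] by simp
  qed
  moreover have "?d \<noteq> 0"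
  proof
    assume d0: "?d = 0"
    \<comment> \<open>A real point whose squared radius is the level at s z. The square root is
      differentiable at s = 1 because the level at z \<noteq> 0 is positive.\<close>
    let ?q = "\<lambda>s. complex_of_real (sqrt (?\<phi> s))"
    have p: "?\<phi> 1 > 0" using level_pos[OF h z] by simp
    have "((\<lambda>s. sqrt (?\<phi> s)) has_real_derivative 0) (at 1)"
      using DERIV_chain2[OF DERIV_real_sqrt[OF p] d] d0 by simp
    then have "(?q has_vector_derivative of_real 0) (at 1)"
      by (rule has_vector_derivative_of_real)
    then have q: "(?q has_derivative (\<lambda>t. 0)) (at 1)"
      by (simp add: has_vector_derivative_def)
    define S where "S = {s::real. 0 < s \<and> s *\<^sub>R z \<in> ball 0 (sqrt 2)}"
    have S: "open S" "1 \<in> S"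
      using z(1) unfolding S_def mem_ball_0
      by (auto intro!: open_Collect_conj open_Collect_less continuous_intros)
    have n: "(norm (?q s))\<^sup>2 = level h (s *\<^sub>R z)" if "s \<in> S" for s
    proof -
      have "s *\<^sub>R z \<in> ball 0 (sqrt 2)" "s *\<^sub>R z \<noteq> 0" using that z(2) by (auto simp only: S_def scaleR_eq_0_iff)
      then have "level h (s *\<^sub>R z) > 0" by (rule level_pos[OF h])
      then show ?thesis by simp
    qed
    have q1: "?q 1 \<in> ball 0 (sqrt 2)" using level_inverse(1)[OF h z(1), of "?q 1"] n[OF S(2)] by simp
    from has_derivative_compose[OF q level_has_derivative[OF k q1]]
    have 0: "((\<lambda>s. level ?k (?q s)) has_derivative (\<lambda>t. 0)) (at 1)"
      using linear_0[OF has_derivative_linear[OF level_has_derivative[OF k q1]]] by simp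
    then have "((\<lambda>s. s\<^sup>2 * (norm z)\<^sup>2) has_derivative (\<lambda>t. 0)) (at 1)"
    proof (rule has_derivative_transform_within_open[OF _ S])
      fix s assume s: "s \<in> S"
      then have "s *\<^sub>R z \<in> ball 0 (sqrt 2)" by (simp only: S_def mem_Collect_eq)
      from level_inverse(2)[OF h this n[OF s]] show "level ?k (?q s) = s\<^sup>2 * (norm z)\<^sup>2"
        by (simp add: power_mult_distrib)
    qed
    moreover have "((\<lambda>s::real. s\<^sup>2 * (norm z)\<^sup>2) has_derivative (\<lambda>t. t * (2 * (norm z)\<^sup>2))) (at 1)"
      by (auto intro!: derivative_eq_intros)
    ultimately have "(\<lambda>t::real. 0) = (\<lambda>t. t * (2 * (norm z)\<^sup>2))"
      by (rule has_derivative_unique)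
    from fun_cong[OF this, of 1] show False using z(2) by simp
  qed
  ultimately show ?thesis by simp
qed


section \<open>Radial motion of the disc and of the whole space\<close>

definition slide_scale :: "real \<Rightarrow> ('p \<Rightarrow> 'p) \<Rightarrow> complex \<Rightarrow> real" where
  "slide_scale t k z = sqrt (1 - t + t * level_quotient k z)"

abbreviation disc_slide :: "real \<Rightarrow> ('p \<Rightarrow> 'p) \<Rightarrow> complex \<Rightarrow> complex" where
  "disc_slide t k \<equiv> \<lambda>z. slide_scale t k z *\<^sub>R z"

text \<open>In use \<open>k\<close> is the inverse of \<open>h\<close> and \<open>Q\<close> is an
  image point h P, so that g (k Q) = g P is the level to be reached at t = 1. Correspondingly
  \<open>level_quotient k\<close> in \<open>slide_scale\<close> is |z|^2 / |z'|^2 as a function of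
  the image point z'.\<close>

definition slide :: "real \<Rightarrow> ('p \<Rightarrow> 'p) \<Rightarrow> 'p \<Rightarrow> 'p" where
  "slide t k Q = ray_point g j0 Q ((1 - t) * g Q + t * g (k Q))"

lemma slide_scale_arg_pos:
  assumes "k \<in> G" "t \<in> {0..1}" "z \<in> ball 0 (sqrt 2)"
  shows "1 - t + t * level_quotient k z > 0"
  using convex_pos[OF assms(2), of 1] level_quotient_pos[OF assms(1,3)] by simp

lemma slide_scale_pos:
  assumes "k \<in> G" "t \<in> {0..1}" "z \<in> ball 0 (sqrt 2)"
  shows "slide_scale t k z > 0"
  using slide_scale_arg_pos[OF assms] by (simp add: slide_scale_def)

lemma norm_disc_slide:
  assumes "k \<in> G" "t \<in> {0..1}" "z \<in> ball 0 (sqrt 2)"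
  shows "(norm (disc_slide t k z))\<^sup>2 = (1 - t) * (norm z)\<^sup>2 + t * level k z"
  using slide_scale_arg_pos[OF assms] level_eq_quotient[OF assms(1,3)]
  by (simp add: slide_scale_def power_mult_distrib algebra_simps)

lemma disc_slide_mem:
  assumes "k \<in> G" "t \<in> {0..1}" "z \<in> ball 0 (sqrt 2)"
  shows "disc_slide t k z \<in> ball 0 (sqrt 2)"
proof -
  have "(norm (disc_slide t k z))\<^sup>2 < (1 - t) * 2 + t * 2"
    unfolding norm_disc_slide[OF assms]
    using assms level_less[OF assms(1,3)] norm_less_sqrt_iff[of z 2] by (intro convex_less) auto
  then show ?thesis by (simp add: norm_less_sqrt_iff del: norm_scaleR)
qed

lemma slide_j0:
  assumes k: "k \<in> G" and t: "t \<in> {0..1}" and p: "(w, z) \<in> cylinder"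
  shows "slide t k (j0 (w, z)) = j0 (w, disc_slide t k z)"
proof -
  have z: "z \<in> ball 0 (sqrt 2)" using p by simp
  define u where "u = (1 - t) * (norm z)\<^sup>2 + t * level k z"
  have u: "u = (norm (disc_slide t k z))\<^sup>2" unfolding u_def norm_disc_slide[OF k t z] ..
  have pos: "slide_scale t k z > 0" by (rule slide_scale_pos[OF k t z])
  have "slide t k (j0 (w, z)) = ray_point g j0 (j0 (w, z)) u"
    unfolding slide_def u_def using g_j0[OF p] level_j0[OF k p] by simp
  also have "\<dots> = j0 (w, (sqrt u / norm z) *\<^sub>R z)"
    using disc_slide_mem[OF k t z] pos
    by (intro ray_point_j0[OF p]) (simp_all add: u norm_less_sqrt_iff del: norm_scaleR)
  also have "(sqrt u / norm z) *\<^sub>R z = disc_slide t k z"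
    using pos by (cases "z = 0") (simp_all add: u)
  finally show ?thesis .
qed

lemma inverse_inverse_level:
  assumes "k \<in> G" "z \<in> ball 0 (sqrt 2)"
  shows "level (inverse_diffeo (inverse_diffeo k)) z = level k z"
proof -
  have P: "j0 (1, z) \<in> L" using assms by (intro j0_mem) auto
  have "inverse_diffeo (inverse_diffeo k) (inverse_diffeo k (k (j0 (1, z)))) = k (j0 (1, z))"
    by (rule inverse_diffeo_left[OF inverse_diffeo_G[OF assms(1)] G_mem[OF assms(1) P]])
  then show ?thesis by (simp add: inverse_diffeo_left[OF assms(1) P] level_def)
qed

text \<open>Directions are kept and the norm of the image is a strictly increasing function of the
  norm, which gives injectivity. Surjectivity is the intermediate value theorem on a ray.\<close>

lemma bij_disc_slide:
  assumes k: "k \<in> G" and t: "t \<in> {0..1}"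
  shows "bij_betw (disc_slide t k) (ball 0 (sqrt 2)) (ball 0 (sqrt 2))"
proof -
  let ?B = "ball (0::complex) (sqrt 2)"
  have less: "norm (disc_slide t k z) < norm (disc_slide t k z')"
    if "norm z < norm z'" "z' \<in> ?B" for z z'
  proof -
    have "z \<in> ?B" using that by auto
    then have "(norm (disc_slide t k z))\<^sup>2 < (norm (disc_slide t k z'))\<^sup>2"
      unfolding norm_disc_slide[OF k t \<open>z \<in> ?B\<close>] norm_disc_slide[OF k t that(2)]
      using that level_strict_mono[OF k that(2,1)]
      by (intro convex_less[OF t]) (simp_all add: power_strict_mono)
    then show ?thesis using power2_less_imp_less norm_ge_zero by blast
  qed
  have inj: "inj_on (disc_slide t k) ?B"
  proof (rule inj_onI)
    fix z z' assume z: "z \<in> ?B" "z' \<in> ?B" and eq: "disc_slide t k z = disc_slide t k z'"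
    have n: "norm z = norm z'" using less[of z z'] less[of z' z] z eq by fastforce
    show "z = z'"
    proof (cases "z = 0")
      case False
      have "(norm z)\<^sup>2 * level_quotient k z = (norm z)\<^sup>2 * level_quotient k z'"
        using level_radial[OF k z(1) n] level_eq_quotient[OF k z(1)] level_eq_quotient[OF k z(2)] n by simp
      then have "slide_scale t k z = slide_scale t k z'" using False by (simp add: slide_scale_def)
      then show ?thesis using eq slide_scale_pos[OF k t z(1)] by simp
    qed (use n in auto)
  qed
  have surj: "y \<in> disc_slide t k ` ?B" if y: "y \<in> ?B" for y
  proof (cases "y = 0")
    case True
    then show ?thesis by (intro image_eqI[of _ _ 0]) auto
  next
    case False
    \<comment> \<open>\<open>z1\<close> is chosen with \<open>level k z1\<close> = |y|^2. At the
      radius \<open>r2\<close>, the maximum of |z1| and |y|, both |r|^2 and the level are at least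
      |y|^2, hence so is their convex combination; as a radius of a point of the disc,
      \<open>r2\<close> stays below sqrt 2.\<close>
    define z1 where "z1 = complex_of_real (sqrt (level (inverse_diffeo k) y))"
    have k': "inverse_diffeo k \<in> G" by (rule inverse_diffeo_G[OF k])
    have n1: "(norm z1)\<^sup>2 = level (inverse_diffeo k) y"
      using level_pos[OF k' y False] by (simp add: z1_def)
    have z1: "z1 \<in> ?B" "level k z1 = (norm y)\<^sup>2"
      using level_inverse[OF k' y n1] inverse_inverse_level[OF k, of z1] by auto
    define r2 where "r2 = max (norm z1) (norm y)"
    have r2_nonneg: "0 \<le> r2" by (simp add: r2_def le_max_iff_disj)
    have r2: "norm z1 \<le> r2" "norm y \<le> r2" "complex_of_real r2 \<in> ?B" "0 \<le> r2"
      using y z1(1) r2_nonneg by (simp_all add: r2_def)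
    let ?f = "\<lambda>r::real. (1 - t) * r\<^sup>2 + t * level k (of_real r)"
    have "level k z1 \<le> level k (of_real r2)"
    proof (cases "norm z1 < r2")
      case True
      then show ?thesis using level_strict_mono[OF k r2(3), of z1] r2(4) by simp
    next
      case False
      then show ?thesis using level_radial[OF k z1(1), of "of_real r2"] r2(1,4) by simp
    qed
    moreover have "(norm y)\<^sup>2 \<le> r2\<^sup>2" using r2(2) by (simp add: power_mono)
    ultimately have "(1 - t) * (norm y)\<^sup>2 + t * (norm y)\<^sup>2 \<le> ?f r2"
      unfolding z1(2)[symmetric] using t by (intro add_mono mult_left_mono) (auto simp: z1(2))
    then have hi: "(norm y)\<^sup>2 \<le> ?f r2" by (simp add: algebra_simps)
    have cont: "continuous_on {0..r2} ?f"
    proof -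
      have "continuous_on ?B (level k)"
        using smooth_on_continuous_iter_partial[OF smooth_level[OF k], of "[]"] by simp
      then have "continuous_on {0..r2} (\<lambda>r. level k (of_real r))"
        by (rule continuous_on_compose2) (use r2(3,4) in \<open>auto intro!: continuous_intros\<close>)
      then show ?thesis by (intro continuous_intros)
    qed
    have "?f 0 \<le> (norm y)\<^sup>2" using level_0[OF k] by simp
    then obtain r where r: "0 \<le> r" "r \<le> r2" "?f r = (norm y)\<^sup>2"
      using IVT'[of ?f 0 "(norm y)\<^sup>2" r2] hi cont r2(4) by auto
    define z where "z = (r / norm y) *\<^sub>R y"
    have nz: "norm z = r" using r(1) False by (simp add: z_def)
    have z: "z \<in> ?B" using nz r r2(3,4) by simp
    have "level k z = level k (of_real r)" using level_radial[OF k z, of "of_real r"] nz r(1) by simp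
    then have "(norm (disc_slide t k z))\<^sup>2 = (norm y)\<^sup>2"
      using norm_disc_slide[OF k t z] r(3) nz by simp
    then have "norm (disc_slide t k z) = norm y" by simp
    then have "slide_scale t k z * r = norm y"
      using slide_scale_pos[OF k t z] nz by simp
    then have "disc_slide t k z = y" using False by (simp add: z_def)
    then show ?thesis using z by blast
  qed
  show ?thesis
    unfolding bij_betw_def using inj surj disc_slide_mem[OF k t] by blast
qed

lemma smooth_slide_scale:
  assumes k: "k \<in> G" and t: "t \<in> {0..1}"
  shows "smooth_on (ball 0 (sqrt 2)) (slide_scale t k)"
proof -
  let ?B = "ball (0::complex) (sqrt 2)"
  have W: "openin (prod_topology point_topology euclidean) (UNIV \<times> ?B)" by (simp add: openin_prod_Times_iff)
  have "diff_family n point_topology (UNIV \<times> ?B) (\<lambda>_. level_quotient k)" for n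
    using smooth_level_quotient[OF k] by (simp add: smooth_on_iff_point_family)
  then have "diff_family n point_topology (UNIV \<times> ?B) (\<lambda>_. slide_scale t k)" for n
    unfolding slide_scale_def
    by (intro diff_family_sqrt_pos[OF W] diff_family_add[OF W] diff_family_const[OF W]
        diff_family_bilinear[OF W bounded_bilinear_mult]) (use slide_scale_arg_pos[OF k t] in auto)
  then show ?thesis by (simp add: smooth_on_iff_point_family)
qed

text \<open>Write m for the scaling factor. Differentiating m^2 |z|^2 = (1 - t) |z|^2 + t
  \<open>level k z\<close> in the direction z gives 2 |z|^2 m (m + m' z) on the left, and a convex
  combination of positive numbers on the right. At z = 0 the term m' z vanishes.\<close>

lemma slide_scale_radial_derivative:
  assumes k: "k \<in> G" and t: "t \<in> {0..1}" and z: "z \<in> ball 0 (sqrt 2)"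
  shows "slide_scale t k z + frechet_derivative (slide_scale t k) (at z) z > 0"
proof -
  let ?m = "slide_scale t k"
  let ?m' = "frechet_derivative ?m (at z)" and ?l' = "frechet_derivative (level k) (at z)"
  have dm: "(?m has_derivative ?m') (at z)"
    using smooth_on_has_derivative[OF smooth_slide_scale[OF k t] z] .
  have m: "?m z > 0" by (rule slide_scale_pos[OF k t z])
  show ?thesis
  proof (cases "z = 0")
    case True
    then show ?thesis using m linear_0[OF has_derivative_linear[OF dm]] by simp
  next
    case False
    have "((\<lambda>y. (1 - t) * (y \<bullet> y) + t * level k y) has_derivative
        (\<lambda>v. (1 - t) * (z \<bullet> v + v \<bullet> z) + t * ?l' v)) (at z)"
      by (intro has_derivative_add has_derivative_mult_right has_derivative_inner has_derivative_ident
          level_has_derivative[OF k z])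
    moreover have "((\<lambda>y. (1 - t) * (y \<bullet> y) + t * level k y) has_derivative
        (\<lambda>v. (z \<bullet> z) * (?m z * ?m' v + ?m' v * ?m z) + (z \<bullet> v + v \<bullet> z) * (?m z * ?m z))) (at z)"
    proof (rule has_derivative_transform_within_open[of "\<lambda>y. (y \<bullet> y) * (?m y * ?m y)"])
      show "((\<lambda>y. (y \<bullet> y) * (?m y * ?m y)) has_derivative
        (\<lambda>v. (z \<bullet> z) * (?m z * ?m' v + ?m' v * ?m z) + (z \<bullet> v + v \<bullet> z) * (?m z * ?m z))) (at z)"
        by (intro has_derivative_mult has_derivative_inner has_derivative_ident dm)
      show "(y \<bullet> y) * (?m y * ?m y) = (1 - t) * (y \<bullet> y) + t * level k y" if "y \<in> ball 0 (sqrt 2)" for y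
        using norm_disc_slide[OF k t that] slide_scale_pos[OF k t that]
        by (simp add: power2_norm_eq_inner[symmetric] power_mult_distrib power2_eq_square mult_ac)
    qed (use z in auto)
    ultimately have "(\<lambda>v. (1 - t) * (z \<bullet> v + v \<bullet> z) + t * ?l' v) =
        (\<lambda>v. (z \<bullet> z) * (?m z * ?m' v + ?m' v * ?m z) + (z \<bullet> v + v \<bullet> z) * (?m z * ?m z))"
      by (rule has_derivative_unique)
    from fun_cong[OF this, of z]
    have "(1 - t) * (2 * (z \<bullet> z)) + t * ?l' z = 2 * (z \<bullet> z) * ?m z * (?m z + ?m' z)"
      by (simp add: algebra_simps)
    moreover have "(1 - t) * (2 * (z \<bullet> z)) + t * ?l' z > 0"
      using level_radial_derivative_pos[OF k z False] False by (intro convex_pos[OF t]) auto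
    ultimately have "0 < (2 * (z \<bullet> z) * ?m z) * (?m z + ?m' z)" by simp
    moreover have "2 * (z \<bullet> z) * ?m z > 0" using m False by simp
    ultimately show ?thesis by (simp only: zero_less_mult_pos)
  qed
qed

definition disc_slide_inv :: "real \<Rightarrow> ('p \<Rightarrow> 'p) \<Rightarrow> complex \<Rightarrow> complex" where
  "disc_slide_inv t k = inv_into (ball 0 (sqrt 2)) (disc_slide t k)"

lemma smooth_disc_slide_inv:
  assumes k: "k \<in> G" and t: "t \<in> {0..1}"
  shows "smooth_on (ball 0 (sqrt 2)) (disc_slide_inv t k)"
proof -
  note b = bij_disc_slide[OF k t]
  have "smooth_on (disc_slide t k ` ball 0 (sqrt 2)) (disc_slide_inv t k)"
    by (intro smooth_on_inverse_scaling smooth_slide_scale slide_scale_pos slide_scale_radial_derivative k t)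
      (auto simp only: disc_slide_inv_def intro: inv_into_f_f[OF bij_betw_imp_inj_on[OF b]])
  then show ?thesis by (simp add: bij_betw_imp_surj_on[OF b])
qed

lemma disc_slide_inv:
  assumes k: "k \<in> G" and t: "t \<in> {0..1}" and y: "y \<in> ball 0 (sqrt 2)"
  shows "disc_slide_inv t k y \<in> ball 0 (sqrt 2)" "disc_slide t k (disc_slide_inv t k y) = y"
  using bij_betwE[OF bij_betw_inv_into[OF bij_disc_slide[OF k t]]] y
    bij_betw_inv_into_right[OF bij_disc_slide[OF k t] y]
  unfolding disc_slide_inv_def by blast+

lemma slide_top: "k \<in> G \<Longrightarrow> Q \<in> L \<Longrightarrow> \<not> g Q < 2 \<Longrightarrow> slide t k Q = Q"
  by (simp add: slide_def ray_point_def)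

lemma slide_mem:
  assumes "k \<in> G" "t \<in> {0..1}" "Q \<in> L"
  shows "slide t k Q \<in> L" and "g (slide t k Q) = (1 - t) * g Q + t * g (k Q)"
proof -
  have "slide t k Q \<in> L \<and> g (slide t k Q) = (1 - t) * g Q + t * g (k Q)"
  proof (cases "g Q < 2")
    case True
    then obtain w z where Q: "(w, z) \<in> cylinder" "Q = j0 (w, z)" using assms(3) by (auto elim: j0_obtain)
    then have z: "z \<in> ball 0 (sqrt 2)" by simp
    have c: "(w, disc_slide t k z) \<in> cylinder" using Q disc_slide_mem[OF assms(1,2) z] by simp
    show ?thesis
      unfolding Q(2) slide_j0[OF assms(1,2) Q(1)] g_j0[OF c] g_j0[OF Q(1)] level_j0[OF assms(1) Q(1)]
        norm_disc_slide[OF assms(1,2) z] using j0_mem[OF c] by simp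
  next
    case False
    then have "g Q = 2" using g_bounds(2)[OF assms(3)] by simp
    then show ?thesis
      using slide_top[OF assms(1,3) False] G_level_2[OF assms(1,3)] assms(3) by (simp add: algebra_simps)
  qed
  then show "slide t k Q \<in> L" "g (slide t k Q) = (1 - t) * g Q + t * g (k Q)" by auto
qed

lemma slide_less_iff:
  assumes "k \<in> G" "t \<in> {0..1}" "Q \<in> L"
  shows "g (slide t k Q) < 2 \<longleftrightarrow> g Q < 2"
proof (cases "g Q < 2")
  case True
  then have "g (k Q) < 2"
    using G_level_2[OF assms(1,3)] g_bounds(2)[OF G_mem[OF assms(1,3)]] by force
  then show ?thesis using True convex_less[OF assms(2) True, of "g (k Q)" 2] slide_mem(2)[OF assms]
    by (simp add: algebra_simps)
qed (simp add: slide_top[OF assms(1,3)])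

lemma bij_slide:
  assumes k: "k \<in> G" and t: "t \<in> {0..1}"
  shows "bij_betw (slide t k) L L"
  unfolding bij_betw_def
proof
  show "inj_on (slide t k) L"
  proof (rule inj_onI)
    fix P Q assume PQ: "P \<in> L" "Q \<in> L" and eq: "slide t k P = slide t k Q"
    have iff: "g P < 2 \<longleftrightarrow> g Q < 2"
      using slide_less_iff[OF k t PQ(1)] slide_less_iff[OF k t PQ(2)] eq by simp
    show "P = Q"
    proof (cases "g P < 2")
      case True
      obtain w z where P: "(w, z) \<in> cylinder" "P = j0 (w, z)" using True PQ by (auto elim: j0_obtain)
      obtain w' z' where Q: "(w', z') \<in> cylinder" "Q = j0 (w', z')" using True iff PQ by (auto elim: j0_obtain)
      have z: "z \<in> ball 0 (sqrt 2)" "z' \<in> ball 0 (sqrt 2)" using P Q by auto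
      have "(w, disc_slide t k z) = (w', disc_slide t k z')"
        using eq P Q disc_slide_mem[OF k t z(1)] disc_slide_mem[OF k t z(2)]
        unfolding P(2) Q(2) slide_j0[OF k t P(1)] slide_j0[OF k t Q(1)]
        by (subst (asm) j0_inject) auto
      then show ?thesis
        using bij_betw_imp_inj_on[OF bij_disc_slide[OF k t]] z P(2) Q(2) by (auto dest: inj_onD)
    next
      case False
      then show ?thesis using eq iff slide_top[OF k PQ(1)] slide_top[OF k PQ(2)] by simp
    qed
  qed
  show "slide t k ` L = L"
  proof
    show "slide t k ` L \<subseteq> L" using slide_mem(1)[OF k t] by blast
    show "L \<subseteq> slide t k ` L"
    proof
      fix Q assume Q: "Q \<in> L"
      show "Q \<in> slide t k ` L"
      proof (cases "g Q < 2")
        case True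
        then obtain w z where wz: "(w, z) \<in> cylinder" "Q = j0 (w, z)" using Q by (auto elim: j0_obtain)
        then have z: "z \<in> ball 0 (sqrt 2)" by simp
        note i = disc_slide_inv[OF k t z]
        have c: "(w, disc_slide_inv t k z) \<in> cylinder" using wz i by simp
        have "Q = slide t k (j0 (w, disc_slide_inv t k z))" using slide_j0[OF k t c] i(2) wz(2) by simp
        then show ?thesis using j0_mem[OF c] by blast
      next
        case False
        then show ?thesis using slide_top[OF k Q] Q by (metis image_eqI)
      qed
    qed
  qed
qed

lemma inv_slide_j0:
  assumes k: "k \<in> G" and t: "t \<in> {0..1}" and p: "(w, z) \<in> cylinder"
  shows "inv_into L (slide t k) (j0 (w, z)) = j0 (w, disc_slide_inv t k z)"
proof -
  have z: "z \<in> ball 0 (sqrt 2)" using p by simp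
  note i = disc_slide_inv[OF k t z]
  have c: "(w, disc_slide_inv t k z) \<in> cylinder" using p i by simp
  have "slide t k (j0 (w, disc_slide_inv t k z)) = j0 (w, z)" using slide_j0[OF k t c] i(2) by simp
  then show ?thesis
    using bij_betw_inv_into_left[OF bij_slide[OF k t] j0_mem[OF c]] by simp
qed

lemma level_mono:
  assumes k: "k \<in> G" and PQ: "P \<in> L" "Q \<in> L" and less: "g P < g Q"
  shows "g (k P) < g (k Q)"
proof -
  have P2: "g P < 2" using less g_bounds(2)[OF PQ(2)] by simp
  then obtain w z where P: "(w, z) \<in> cylinder" "P = j0 (w, z)" using PQ by (auto elim: j0_obtain)
  show ?thesis
  proof (cases "g Q < 2")
    case True
    then obtain w' z' where Q: "(w', z') \<in> cylinder" "Q = j0 (w', z')" using PQ by (auto elim: j0_obtain)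
    have "norm z < norm z'"
      using less g_j0[OF P(1)] g_j0[OF Q(1)] P(2) Q(2) by (auto intro: power2_less_imp_less)
    then show ?thesis
      using level_strict_mono[OF k, of z' z] P Q level_j0[OF k P(1)] level_j0[OF k Q(1)] by auto
  next
    case False
    then have "g (k Q) = 2" using G_level_2[OF k PQ(2)] g_bounds(2)[OF PQ(2)] by simp
    moreover have "g (k P) \<noteq> 2" using G_level_2[OF k PQ(1)] P2 by simp
    ultimately show ?thesis using g_bounds(2)[OF G_mem[OF k PQ(1)]] by simp
  qed
qed

lemma slide_level:
  assumes k: "k \<in> G" and t: "t \<in> {0..1}" and PQ: "P \<in> L" "Q \<in> L"
  shows "g (slide t k P) = g (slide t k Q) \<longleftrightarrow> g P = g Q"
proof -
  have less: "g (slide t k P) < g (slide t k Q)" if "g P < g Q" "P \<in> L" "Q \<in> L" for P Q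
    unfolding slide_mem(2)[OF k t that(2)] slide_mem(2)[OF k t that(3)]
    by (rule convex_less[OF t that(1) level_mono[OF k that(2,3,1)]])
  have "g (slide t k P) = g (slide t k Q)" if "g P = g Q"
    using that G_level[OF k PQ] slide_mem(2)[OF k t PQ(1)] slide_mem(2)[OF k t PQ(2)] by simp
  then show ?thesis using less[OF _ PQ] less[OF _ PQ(2,1)] by (metis less_irrefl linorder_neqE)
qed

lemma slide_level_0:
  assumes k: "k \<in> G" and t: "t \<in> {0..1}" and P: "P \<in> L"
  shows "g (slide t k P) = 0 \<longleftrightarrow> g P = 0"
proof (cases "g P = 0")
  case True
  then show ?thesis using slide_mem(2)[OF k t P] G_level_0[OF k P] by simp
next
  case False
  then have "g P > 0" "g (k P) > 0"
    using g_bounds(1)[OF P] g_bounds(1)[OF G_mem[OF k P]] G_level_0[OF k P] by auto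
  then show ?thesis using slide_mem(2)[OF k t P] convex_pos[OF t] by force
qed

lemma slide_level_2:
  assumes k: "k \<in> G" and t: "t \<in> {0..1}" and P: "P \<in> L"
  shows "g (slide t k P) = 2 \<longleftrightarrow> g P = 2"
  using slide_less_iff[OF k t P] g_bounds(2)[OF P] g_bounds(2)[OF slide_mem(1)[OF k t P]] by auto

end

lemma cis_inj_on: "inj_on cis {a<..<a + 2 * pi}"
proof (rule inj_onI)
  fix x y assume x: "x \<in> {a<..<a + 2 * pi}" and y: "y \<in> {a<..<a + 2 * pi}" and eq: "cis x = cis y"
  then obtain n :: int where n: "x = y + 2 * pi * n"
    using sin_cos_eq_iff[of x y] by (auto simp: cis.code complex_eq_iff)
  have "\<bar>2 * pi * n\<bar> < 2 * pi" using n x y by auto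
  then have "\<bar>real_of_int n\<bar> < 1" by (simp add: abs_mult)
  then have "n = 0" by linarith
  then show "x = y" using n by simp
qed

section \<open>The deformation and its local formula\<close>

context polar_space
begin

text \<open>The target level is written with \<open>g P\<close> and not with the inverse of
  \<open>h\<close>, so that \<open>h\<close> enters explicitly and the formula keeps its form when
  the tubes are exchanged. \<open>restrict\<close> yields the extensional representative.\<close>

definition retract :: "real \<Rightarrow> ('p \<Rightarrow> 'p) \<Rightarrow> 'p \<Rightarrow> 'p" where
  "retract t h = restrict (\<lambda>P. ray_point g j0 (h P) ((1 - t) * g (h P) + t * g P)) L"

lemma retract_eq_slide:
  assumes "h \<in> G" "P \<in> L"
  shows "retract t h P = slide t (inverse_diffeo h) (h P)"
  using assms by (simp add: retract_def slide_def inverse_diffeo_left)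

text \<open>The target levels in the two descriptions add up to 2, so \<open>ray_point_swap\<close>
  applies. This transfers everything proved in the charts of \<open>j0\<close> to those of
  \<open>j1\<close>.\<close>

lemma retract_swap:
  assumes h: "h \<in> G" and t: "t \<in> {0..1}"
  shows "polar_space.retract L (\<lambda>P. 2 - g P) j1 t h = retract t h"
proof -
  interpret sw: polar_space L "\<lambda>P. 2 - g P" j1 j0 by (rule swap)
  have "ray_point (\<lambda>P. 2 - g P) j1 (h P) ((1 - t) * (2 - g (h P)) + t * (2 - g P)) =
      ray_point g j0 (h P) ((1 - t) * g (h P) + t * g P)" if P: "P \<in> L" for P
  proof -
    let ?u = "(1 - t) * g (h P) + t * g P"
    have 1: "(1 - t) * (2 - g (h P)) + t * (2 - g P) = 2 - ?u" by (simp add: algebra_simps)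
    have "0 < ?u \<and> ?u < 2" if "0 < g (h P)" "g (h P) < 2"
    proof -
      have "0 < g P" "g P < 2"
        using that G_level_0[OF h P] G_level_2[OF h P] g_bounds[OF P] by auto
      then show ?thesis using that convex_pos[OF t, of "g (h P)" "g P"] convex_less[OF t, of "g (h P)" 2 "g P" 2]
        by (simp add: algebra_simps)
    qed
    then show ?thesis unfolding 1 by (rule ray_point_swap[OF G_mem[OF h P]])
  qed
  then show ?thesis unfolding sw.retract_def retract_def by (intro restrict_ext) simp
qed

lemma bij_retract:
  assumes h: "h \<in> G" and t: "t \<in> {0..1}"
  shows "bij_betw (retract t h) L L"
proof -
  have "bij_betw (slide t (inverse_diffeo h) \<circ> h) L L"
    by (rule bij_betw_trans[OF G_bij[OF h] bij_slide[OF inverse_diffeo_G[OF h] t]])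
  then show ?thesis by (rule bij_betw_cong[THEN iffD1, rotated]) (simp add: retract_eq_slide[OF h])
qed

lemma g_retract:
  assumes "h \<in> G" "t \<in> {0..1}" "P \<in> L"
  shows "g (retract t h P) = (1 - t) * g (h P) + t * g P"
  using slide_mem(2)[OF inverse_diffeo_G[OF assms(1)] assms(2) G_mem[OF assms(1,3)]]
  by (simp add: retract_eq_slide assms inverse_diffeo_left)

lemma ray_point_self:
  assumes "Q \<in> L" shows "ray_point g j0 Q (g Q) = Q"
proof (cases "g Q < 2")
  case True
  then obtain w z where Q: "(w, z) \<in> cylinder" "Q = j0 (w, z)" using assms by (auto elim: j0_obtain)
  have "(norm z)\<^sup>2 < 2" using Q by (simp add: norm_less_sqrt_iff)
  then have "ray_point g j0 Q (g Q) = j0 (w, (sqrt ((norm z)\<^sup>2) / norm z) *\<^sub>R z)"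
    unfolding Q(2) g_j0[OF Q(1)] by (intro ray_point_j0[OF Q(1)]) auto
  also have "(sqrt ((norm z)\<^sup>2) / norm z) *\<^sub>R z = z" by (cases "z = 0") auto
  finally show ?thesis using Q(2) by simp
qed (simp add: ray_point_def)

lemma inv_retract:
  assumes h: "h \<in> G" and t: "t \<in> {0..1}" and P: "P \<in> L"
  shows "inv_into L (retract t h) P = inverse_diffeo h (inv_into L (slide t (inverse_diffeo h)) P)"
    (is "_ = ?k (inv_into L ?s P)")
proof -
  have k: "?k \<in> G" by (rule inverse_diffeo_G[OF h])
  have m: "inv_into L ?s P \<in> L"
    using bij_betwE[OF bij_betw_inv_into[OF bij_slide[OF k t]]] P by blast
  have "retract t h (?k (inv_into L ?s P)) = ?s (inv_into L ?s P)"
    using retract_eq_slide[OF h G_mem[OF k m]] inverse_diffeo_right[OF h m] by simp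
  also have "\<dots> = P" using bij_betw_inv_into_right[OF bij_slide[OF k t] P] .
  finally show ?thesis
    using bij_betw_inv_into_left[OF bij_retract[OF h t] G_mem[OF k m]] by simp
qed

definition chart0 :: "real \<times> complex \<Rightarrow> 'p" where
  "chart0 = (\<lambda>(\<theta>, z). j0 (cis \<theta>, z))"

definition chart_dom :: "real \<Rightarrow> (real \<times> complex) set" where
  "chart_dom a = {a<..<a + 2 * pi} \<times> ball 0 (sqrt 2)"

lemma inj_on_chart0: "inj_on chart0 (chart_dom a)"
proof (rule inj_onI)
  fix x y assume x: "x \<in> chart_dom a" and y: "y \<in> chart_dom a" and eq: "chart0 x = chart0 y"
  have "(cis (fst x), snd x) = (cis (fst y), snd y)"
    using x y eq by (subst (asm) (2) chart0_def, subst (asm) chart0_def, simp add: split_def, subst (asm) j0_inject)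
      (auto simp: chart_dom_def)
  then show "x = y" using x y inj_onD[OF cis_inj_on[of a]] by (auto simp: chart_dom_def prod_eq_iff)
qed

lemma chart0_mem: "(chart_dom a, chart0) \<in> A"
  using chart_mem[of a] by (simp add: chart_dom_def chart0_def)

lemma slide_chart0:
  assumes k: "k \<in> G" and t: "t \<in> {0..1}" and x: "x \<in> chart_dom a"
  shows "slide t k (chart0 x) = chart0 (fst x, disc_slide t k (snd x))"
    and "(fst x, disc_slide t k (snd x)) \<in> chart_dom a"
proof -
  have z: "snd x \<in> ball 0 (sqrt 2)" and c: "(cis (fst x), snd x) \<in> cylinder"
    using x by (auto simp: chart_dom_def)
  show "slide t k (chart0 x) = chart0 (fst x, disc_slide t k (snd x))"
    using slide_j0[OF k t c] by (simp add: chart0_def split_def)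
  show "(fst x, disc_slide t k (snd x)) \<in> chart_dom a"
    using disc_slide_mem[OF k t z] x by (simp add: chart_dom_def mem_Times_iff)
qed

text \<open>Radial motion keeps the angle, so no point enters or leaves a chart of the tube. Hence
  the local representatives of the deformed maps have the same domains for all t.\<close>

lemma slide_chart_image:
  assumes k: "k \<in> G" and t: "t \<in> {0..1}" and Q: "Q \<in> L"
  shows "slide t k Q \<in> chart0 ` chart_dom a \<longleftrightarrow> Q \<in> chart0 ` chart_dom a"
proof
  assume "Q \<in> chart0 ` chart_dom a"
  then show "slide t k Q \<in> chart0 ` chart_dom a" using slide_chart0[OF k t] by auto
next
  assume "slide t k Q \<in> chart0 ` chart_dom a"
  then obtain y where y: "slide t k Q = chart0 y" "y \<in> chart_dom a" by blast
  have cy: "(cis (fst y), snd y) \<in> cylinder" using y(2) by (auto simp: chart_dom_def)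
  have "g (slide t k Q) < 2"
    using y(1) g_j0[OF cy] cy by (simp add: chart0_def split_def norm_less_sqrt_iff)
  then have "g Q < 2" using slide_less_iff[OF k t Q] by simp
  then obtain w z where wz: "(w, z) \<in> cylinder" "Q = j0 (w, z)" using Q by (auto elim: j0_obtain)
  then have z: "z \<in> ball 0 (sqrt 2)" by simp
  have c: "(w, disc_slide t k z) \<in> cylinder" using wz disc_slide_mem[OF k t z] by simp
  have "j0 (w, disc_slide t k z) = j0 (cis (fst y), snd y)"
    using y(1) slide_j0[OF k t wz(1)] wz(2) by (simp add: chart0_def split_def)
  then have "w = cis (fst y)" unfolding j0_inject[OF c cy] by simp
  then have "Q = chart0 (fst y, z)" using wz(2) by (simp add: chart0_def)
  moreover have "(fst y, z) \<in> chart_dom a" using y(2) z by (simp add: chart_dom_def mem_Times_iff)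
  ultimately show "Q \<in> chart0 ` chart_dom a" by blast
qed

lemma g_chart0: "x \<in> chart_dom a \<Longrightarrow> g (chart0 x) = (norm (snd x))\<^sup>2"
  using g_j0[of "cis (fst x)" "snd x"] by (auto simp: chart0_def split_def chart_dom_def)

text \<open>The factor \<open>c\<close> is prescribed only off the centre, since at the centre it
  multiplies zero. This leaves room for a factor that extends smoothly across the centre.\<close>

lemma retract_rep:
  assumes h: "h \<in> G" and t: "t \<in> {0..1}" and P: "p x \<in> L"
  shows "retract t h (p x) \<in> chart0 ` chart_dom a \<longleftrightarrow> h (p x) \<in> chart0 ` chart_dom a"
    and "h (p x) \<in> chart0 ` chart_dom a \<Longrightarrow> r = chart_rep p (chart_dom a) chart0 h x \<Longrightarrow>
      (snd r \<noteq> 0 \<Longrightarrow> c = sqrt (1 - t + t * (g (p x) * inverse ((norm (snd r))\<^sup>2)))) \<Longrightarrow>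
      chart_rep p (chart_dom a) chart0 (retract t h) x = (fst r, c *\<^sub>R snd r)"
proof -
  let ?k = "inverse_diffeo h"
  have k: "?k \<in> G" by (rule inverse_diffeo_G[OF h])
  have e: "retract t h (p x) = slide t ?k (h (p x))" by (rule retract_eq_slide[OF h P])
  show "retract t h (p x) \<in> chart0 ` chart_dom a \<longleftrightarrow> h (p x) \<in> chart0 ` chart_dom a"
    unfolding e by (rule slide_chart_image[OF k t G_mem[OF h P]])
  assume i: "h (p x) \<in> chart0 ` chart_dom a" and r: "r = chart_rep p (chart_dom a) chart0 h x"
    and c: "snd r \<noteq> 0 \<Longrightarrow> c = sqrt (1 - t + t * (g (p x) * inverse ((norm (snd r))\<^sup>2)))"
  have rm: "r \<in> chart_dom a" "chart0 r = h (p x)" using chart_rep_mem[where h = h and p = p and x = x, OF i] r by auto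
  have z: "snd r \<in> ball 0 (sqrt 2)" and cy: "(cis (fst r), snd r) \<in> cylinder"
    using rm(1) by (auto simp: chart_dom_def)
  have "retract t h (p x) = chart0 (fst r, disc_slide t ?k (snd r))"
    unfolding e rm(2)[symmetric] by (rule slide_chart0(1)[OF k t rm(1)])
  then have "chart_rep p (chart_dom a) chart0 (retract t h) x = (fst r, disc_slide t ?k (snd r))"
    using inv_into_f_f[OF inj_on_chart0 slide_chart0(2)[OF k t rm(1)]] by (simp add: chart_rep_def)
  also have "disc_slide t ?k (snd r) = c *\<^sub>R snd r"
  proof (cases "snd r = 0")
    case False
    have "level ?k (snd r) = g (?k (chart0 r))"
      using level_j0[OF k cy] by (simp add: chart0_def split_def)
    also have "\<dots> = g (p x)" by (simp add: rm(2) inverse_diffeo_left[OF h P])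
    finally have "level_quotient ?k (snd r) = g (p x) * inverse ((norm (snd r))\<^sup>2)"
      using level_eq_quotient[OF k z] False by (simp add: field_simps)
    then show ?thesis using c[OF False] by (simp add: slide_scale_def)
  qed simp
  finally show "chart_rep p (chart_dom a) chart0 (retract t h) x = (fst r, c *\<^sub>R snd r)" .
qed

lemma A_cases:
  assumes "(D, p) \<in> A"
  obtains a where "D = chart_dom a" "p = chart0"
  | a where "D = chart_dom a" "p = (\<lambda>(\<theta>, z). j1 (cis \<theta>, z))"
  using assms unfolding polar_atlas_def chart_dom_def chart0_def by blast

lemma A_mem: "(D, p) \<in> A \<Longrightarrow> x \<in> D \<Longrightarrow> p x \<in> L"
  using man_space by (auto simp: man_space_def)

lemma rep_dom_retract:
  assumes G: "\<And>y. y \<in> topspace Y \<Longrightarrow> \<Phi> y \<in> G" and \<tau>: "\<And>y. y \<in> topspace Y \<Longrightarrow> \<tau> y \<in> {0..1}"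
    and p: "(D, p) \<in> A"
  shows "rep_dom Y D p (chart_dom a) chart0 (\<lambda>y. retract (\<tau> y) (\<Phi> y)) = rep_dom Y D p (chart_dom a) chart0 \<Phi>"
  unfolding rep_dom_def using retract_rep(1)[where p = p, OF G \<tau> A_mem[OF p]] by blast

lemma diff_family_retract:
  assumes \<Phi>: "continuous_map Y (smooth_topology A A) \<Phi>" and G: "\<And>y. y \<in> topspace Y \<Longrightarrow> \<Phi> y \<in> G"
    and \<tau>: "continuous_map Y euclidean \<tau>" "\<And>y. y \<in> topspace Y \<Longrightarrow> \<tau> y \<in> {0..1}"
    and p: "(D, p) \<in> A"
  shows "diff_family k Y (rep_dom Y D p (chart_dom a) chart0 \<Phi>)
    (\<lambda>y. chart_rep p (chart_dom a) chart0 (retract (\<tau> y) (\<Phi> y)))"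
proof -
  let ?E = "chart_dom a" and ?q = "chart0"
  let ?r = "\<lambda>y. chart_rep p ?E ?q (\<Phi> y)"
  define W where "W = rep_dom Y D p ?E ?q \<Phi>"
  have W: "openin (prod_topology Y euclidean) W"
    and r: "\<And>k. diff_family k Y W ?r"
    unfolding W_def by (rule smooth_topology_eval[OF \<Phi> p chart0_mem])+
  have Wd: "y \<in> topspace Y" "x \<in> D" "\<Phi> y (p x) \<in> ?q ` ?E" "\<Phi> y \<in> G" "\<tau> y \<in> {0..1}" "p x \<in> L"
    if "(y, x) \<in> W" for y x
    using that G \<tau>(2) A_mem[OF p] by (auto simp: W_def rep_dom_def)
  have sndx: "diff_family k Y W (\<lambda>y. snd)" for k
    by (rule diff_family_linear[OF W bounded_linear_snd])
  have rn: "g (\<Phi> y (p x)) = (norm (snd (?r y x)))\<^sup>2" if "(y, x) \<in> W" for y x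
    using chart_rep_mem[where h = "\<Phi> y" and p = p and x = x, OF Wd(3)[OF that]] g_chart0 by metis
  \<comment> \<open>Any smooth positive family \<open>s\<close> that equals the ratio of levels off
    the centre will do; the two kinds of source charts supply different ones.\<close>
  have combine: "diff_family k Y W (\<lambda>y. chart_rep p ?E ?q (retract (\<tau> y) (\<Phi> y)))"
    if s: "\<And>k. diff_family k Y W s" and pos: "\<And>y x. (y, x) \<in> W \<Longrightarrow> s y x > 0"
      and eq: "\<And>y x. (y, x) \<in> W \<Longrightarrow> snd (?r y x) \<noteq> 0 \<Longrightarrow> s y x = g (p x) * inverse ((norm (snd (?r y x)))\<^sup>2)"
    for s
  proof -
    have "diff_family k Y W (\<lambda>y x. sqrt (1 - \<tau> y + \<tau> y * s y x))"
    proof (rule diff_family_sqrt_pos[OF W])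
      have c: "continuous_map Y euclidean (\<lambda>y. 1 - \<tau> y)"
        by (intro continuous_map_diff \<tau>(1)) simp
      show "diff_family k Y W (\<lambda>y x. 1 - \<tau> y + \<tau> y * s y x)"
        by (intro diff_family_add[OF W] diff_family_const[OF W]
            diff_family_bilinear[OF W bounded_bilinear_mult] s \<tau>(1) c)
      show "1 - \<tau> y + \<tau> y * s y x > 0" if "(y, x) \<in> W" for y x
        using convex_pos[OF Wd(5)[OF that], of 1] pos[OF that] by simp
    qed
    then have "diff_family k Y W (\<lambda>y x. (fst (?r y x), sqrt (1 - \<tau> y + \<tau> y * s y x) *\<^sub>R snd (?r y x)))"
      by (intro diff_family_Pair[OF W] diff_family_bilinear[OF W bounded_bilinear_scaleR]
          diff_family_bounded_linear[OF W bounded_linear_fst] diff_family_bounded_linear[OF W bounded_linear_snd] r)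
    then show ?thesis
    proof (rule diff_family_cong[OF W, rotated])
      fix y x assume yx: "(y, x) \<in> W"
      show "(fst (?r y x), sqrt (1 - \<tau> y + \<tau> y * s y x) *\<^sub>R snd (?r y x)) =
          chart_rep p ?E ?q (retract (\<tau> y) (\<Phi> y)) x"
        by (rule sym[OF retract_rep(2)[where p = p and x = x, OF Wd(4,5,6,3)[OF yx] refl]]) (use eq[OF yx] in simp)
    qed
  qed
  from p have "diff_family k Y W (\<lambda>y. chart_rep p ?E ?q (retract (\<tau> y) (\<Phi> y)))" (is ?goal)
  proof (cases rule: A_cases)
    case (1 b)
    \<comment> \<open>Here |z'|^2 = |z|^2 q(z), with q the quotient of \<open>\<Phi> y\<close>
      itself; the ratio of levels is 1 / q(z), which is smooth across z = 0 and depends continuously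
      on \<open>y\<close>.\<close>
    let ?s = "\<lambda>y x. inverse (level_quotient (\<Phi> y) (snd x))"
    have lq: "level_quotient (\<Phi> y) (snd x) > 0" if "(y, x) \<in> W" for y x
      using level_quotient_pos[OF Wd(4)[OF that], of "snd x"] Wd(2)[OF that] 1 by (auto simp: chart_dom_def)
    show ?goal
    proof (rule combine[of ?s])
      have "diff_family k Y W (\<lambda>y x. level_quotient (\<Phi> y) (snd x))" for k
        by (rule diff_family_compose[OF W _ sndx diff_family_level_quotient[OF \<Phi> G]])
          (use Wd(1,2) 1 in \<open>auto simp: chart_dom_def\<close>)
      then show "diff_family k Y W ?s" for k by (rule diff_family_inverse_pos[OF W _ lq])
      fix y x assume yx: "(y, x) \<in> W"
      show "?s y x > 0" using lq[OF yx] by simp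
      assume nz: "snd (?r y x) \<noteq> 0"
      have x: "x \<in> chart_dom b" and z: "snd x \<in> ball 0 (sqrt 2)" and cy: "(cis (fst x), snd x) \<in> cylinder"
        using Wd(2)[OF yx] 1(1) by (auto simp: chart_dom_def)
      have "(norm (snd (?r y x)))\<^sup>2 = level (\<Phi> y) (snd x)"
        using rn[OF yx] level_j0[OF Wd(4)[OF yx] cy] 1(2) by (simp add: chart0_def split_def)
      also have "\<dots> = (norm (snd x))\<^sup>2 * level_quotient (\<Phi> y) (snd x)"
        by (rule level_eq_quotient[OF Wd(4)[OF yx] z])
      finally have n: "(norm (snd (?r y x)))\<^sup>2 = (norm (snd x))\<^sup>2 * level_quotient (\<Phi> y) (snd x)" .
      then have "snd x \<noteq> 0" using nz by auto
      then show "?s y x = g (p x) * inverse ((norm (snd (?r y x)))\<^sup>2)"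
        using g_chart0[OF x] 1(2) unfolding n by simp
    qed
  next
    case (2 b)
    \<comment> \<open>Source points in this tube have level 2 - |z|^2 > 0, so their images are off
      the centre and the ratio is smooth as it stands.\<close>
    let ?s = "\<lambda>y x. (2 - (norm (snd x))\<^sup>2) * inverse ((norm (snd (?r y x)))\<^sup>2)"
    have gp: "g (p x) = 2 - (norm (snd x))\<^sup>2" "g (p x) > 0" if "(y, x) \<in> W" for y x
    proof -
      have cy: "(cis (fst x), snd x) \<in> cylinder"
        using Wd(2)[OF that] 2(1) by (auto simp: chart_dom_def)
      show gx: "g (p x) = 2 - (norm (snd x))\<^sup>2" using g_j1[OF cy] 2(2) by (simp add: split_def)
      show "g (p x) > 0" unfolding gx using cy by (simp add: norm_less_sqrt_iff)
    qed
    have nz: "(norm (snd (?r y x)))\<^sup>2 > 0" if "(y, x) \<in> W" for y x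
      using rn[OF that] gp(2)[OF that] G_level_0[OF Wd(4,6)[OF that]] by fastforce
    show ?goal
    proof (rule combine[of ?s])
      show "diff_family k Y W ?s" for k
        by (intro diff_family_bilinear[OF W bounded_bilinear_mult] diff_family_diff[OF W]
            diff_family_const[OF W] diff_family_norm_power2[OF W] diff_family_inverse_pos[OF W] sndx
            diff_family_bounded_linear[OF W bounded_linear_snd] r nz) auto
      fix y x assume yx: "(y, x) \<in> W"
      show "?s y x > 0" using nz[OF yx] gp[OF yx] by simp
      show "?s y x = g (p x) * inverse ((norm (snd (?r y x)))\<^sup>2)" using gp(1)[OF yx] by simp
    qed
  qed
  then show ?thesis by (simp only: W_def)
qed

text \<open>In a chart of the tube \<open>j0\<close> the inverse first undoes the disc slide,
  keeping the angle, and then applies the inverse of \<open>h\<close>, which is smooth into every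
  chart \<open>q\<close>.\<close>

lemma smooth_inv_retract:
  assumes h: "h \<in> G" and t: "t \<in> {0..1}" and q: "(E, q) \<in> A"
  shows "smooth_on {x \<in> chart_dom a. inv_into L (retract t h) (chart0 x) \<in> q ` E}
    (chart_rep chart0 E q (inv_into L (retract t h)))"
proof -
  let ?k = "inverse_diffeo h" and ?P = point_topology and ?D = "chart_dom a"
  have k: "?k \<in> G" by (rule inverse_diffeo_G[OF h])
  define f where "f x = (fst x, disc_slide_inv t ?k (snd x))" for x :: "real \<times> complex"
  have fD: "f x \<in> ?D" if "x \<in> ?D" for x
    using disc_slide_inv(1)[OF k t, of "snd x"] that by (auto simp: f_def chart_dom_def)
  have eq: "inv_into L (retract t h) (chart0 x) = ?k (chart0 (f x))" if x: "x \<in> ?D" for x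
  proof -
    have c: "(cis (fst x), snd x) \<in> cylinder" using x by (auto simp: chart_dom_def)
    show ?thesis
      using inv_retract[OF h t j0_mem[OF c]] inv_slide_j0[OF k t c]
      by (simp add: chart0_def f_def split_def)
  qed
  have S: "{x \<in> ?D. inv_into L (retract t h) (chart0 x) \<in> q ` E} = {x \<in> ?D. f x \<in> {x \<in> ?D. ?k (chart0 x) \<in> q ` E}}"
    using eq fD by auto
  let ?S = "{x \<in> ?D. f x \<in> {x \<in> ?D. ?k (chart0 x) \<in> q ` E}}"
  have sk: "smooth_on {x \<in> ?D. ?k (chart0 x) \<in> q ` E} (chart_rep chart0 E q ?k)"
    by (rule smooth_maps_rep[OF G_smooth_maps[OF k] chart0_mem q])
  have D: "openin (prod_topology ?P euclidean) (UNIV \<times> ?D)"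
    by (simp add: openin_prod_Times_iff chart_dom_def open_Times)
  have f: "diff_family n ?P (UNIV \<times> ?D) (\<lambda>_. f)" for n
  proof -
    have "diff_family n ?P (UNIV \<times> ball 0 (sqrt 2)) (\<lambda>_. disc_slide_inv t ?k)"
      using smooth_disc_slide_inv[OF k t] by (simp add: smooth_on_iff_point_family)
    then have "diff_family n ?P (UNIV \<times> ?D) (\<lambda>_ x. disc_slide_inv t ?k (snd x))"
      by (rule diff_family_compose[OF D _ diff_family_linear[OF D bounded_linear_snd], rotated])
        (auto simp: chart_dom_def)
    then show ?thesis
      unfolding f_def by (intro diff_family_Pair[OF D] diff_family_linear[OF D bounded_linear_fst])
  qed
  have So: "openin (prod_topology ?P euclidean) (UNIV \<times> ?S)"
  proof -
    have "openin (prod_topology ?P euclidean) {(u, x) \<in> UNIV \<times> ?D. (u, f x) \<in> UNIV \<times> {x \<in> ?D. ?k (chart0 x) \<in> q ` E}}"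
      using smooth_on_imp_open[OF sk]
      by (intro openin_family_preimage[OF D _ diff_family_imp_joint_cont[OF f]]) (simp add: openin_prod_Times_iff)
    moreover have "{(u :: unit, x) \<in> UNIV \<times> ?D. (u, f x) \<in> UNIV \<times> {x \<in> ?D. ?k (chart0 x) \<in> q ` E}} = UNIV \<times> ?S"
      by auto
    ultimately show ?thesis by (simp only:)
  qed
  then have oS: "open ?S" using openin_prod_slice[OF So, of "()"] by simp
  have "diff_family n ?P (UNIV \<times> ?S) (\<lambda>_ x. chart_rep chart0 E q ?k (f x))" for n
  proof -
    have 1: "diff_family n ?P (UNIV \<times> ?S) (\<lambda>_. f)" by (rule diff_family_subset[OF f]) auto
    have 2: "diff_family n ?P (UNIV \<times> {x \<in> ?D. ?k (chart0 x) \<in> q ` E}) (\<lambda>_. chart_rep chart0 E q ?k)"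
      using sk by (rule smooth_on_diff_family) auto
    show ?thesis by (rule diff_family_compose[OF So _ 1 2]) auto
  qed
  then have "smooth_on ?S (\<lambda>x. chart_rep chart0 E q ?k (f x))"
    using smooth_on_iff_point_family[OF oS] by blast
  then show ?thesis
    unfolding S by (rule smooth_on_cong) (use eq in \<open>auto simp: chart_rep_def\<close>)
qed


section \<open>Smoothness and continuity of the deformation in all charts\<close>

lemma retract_family_chart0:
  assumes \<Phi>: "continuous_map Y (smooth_topology A A) \<Phi>" and G: "\<And>y. y \<in> topspace Y \<Longrightarrow> \<Phi> y \<in> G"
    and \<tau>: "continuous_map Y euclidean \<tau>" "\<And>y. y \<in> topspace Y \<Longrightarrow> \<tau> y \<in> {0..1}"
    and p: "(D, p) \<in> A"
  shows "openin (prod_topology Y euclidean) (rep_dom Y D p (chart_dom a) chart0 (\<lambda>y. retract (\<tau> y) (\<Phi> y)))"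
    and "diff_family k Y (rep_dom Y D p (chart_dom a) chart0 (\<lambda>y. retract (\<tau> y) (\<Phi> y)))
      (\<lambda>y. chart_rep p (chart_dom a) chart0 (retract (\<tau> y) (\<Phi> y)))"
  using smooth_topology_eval(1)[OF \<Phi> p chart0_mem] diff_family_retract[OF \<Phi> G \<tau> p]
  by (simp_all only: rep_dom_retract[OF G \<tau>(2) p])

lemma retract_family:
  assumes \<Phi>: "continuous_map Y (smooth_topology A A) \<Phi>" and G: "\<And>y. y \<in> topspace Y \<Longrightarrow> \<Phi> y \<in> G"
    and \<tau>: "continuous_map Y euclidean \<tau>" "\<And>y. y \<in> topspace Y \<Longrightarrow> \<tau> y \<in> {0..1}"
    and p: "(D, p) \<in> A" and q: "(E, q) \<in> A"
  shows "openin (prod_topology Y euclidean) (rep_dom Y D p E q (\<lambda>y. retract (\<tau> y) (\<Phi> y)))"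
    and "diff_family k Y (rep_dom Y D p E q (\<lambda>y. retract (\<tau> y) (\<Phi> y)))
      (\<lambda>y. chart_rep p E q (retract (\<tau> y) (\<Phi> y)))"
proof -
  interpret sw: polar_space L "\<lambda>P. 2 - g P" j1 j0 by (rule swap)
  have sA: "sw.A = A" by (rule polar_atlas_swap)
  let ?W = "rep_dom Y D p E q (\<lambda>y. retract (\<tau> y) (\<Phi> y))"
  let ?r = "\<lambda>y. chart_rep p E q (retract (\<tau> y) (\<Phi> y))"
  have "openin (prod_topology Y euclidean) ?W \<and> diff_family k Y ?W ?r"
    using q
  proof (cases rule: A_cases)
    case (1 a)
    show ?thesis unfolding 1 using retract_family_chart0[OF \<Phi> G \<tau> p] by blast
  next
    case (2 a)
    have q': "E = sw.chart_dom a" "q = sw.chart0"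
      unfolding 2 by (auto simp: sw.chart_dom_def chart_dom_def sw.chart0_def)
    \<comment> \<open>The exchanged space has the same atlas and the same group \<open>G\<close>, so
      its result for its own first tube covers the target charts of the second.\<close>
    note sw = sw.retract_family_chart0[unfolded sA level_diffeos_swap, OF \<Phi> G \<tau> p, where a = a, folded q']
    have req: "sw.retract (\<tau> y) (\<Phi> y) = retract (\<tau> y) (\<Phi> y)" if "y \<in> topspace Y" for y
      by (rule retract_swap[OF G[OF that] \<tau>(2)[OF that]])
    have W: "rep_dom Y D p E q (\<lambda>y. sw.retract (\<tau> y) (\<Phi> y)) = ?W"
      by (auto simp: rep_dom_def req)
    note o = sw(1)[unfolded W]
    moreover have "diff_family k Y ?W ?r"
      by (rule diff_family_cong[OF o _ sw(2)[unfolded W]]) (auto simp: rep_dom_def req)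
    ultimately show ?thesis by blast
  qed
  then show "openin (prod_topology Y euclidean) ?W" "diff_family k Y ?W ?r" by auto
qed

text \<open>Smoothness for fixed \<open>h\<close> and \<open>t\<close> is the case of a one-point
  parameter space in the statement on families.\<close>

lemma smooth_map_retract:
  assumes h: "h \<in> G" and t: "t \<in> {0..1}"
  shows "smooth_map A A (retract t h)"
  unfolding smooth_map_iff
proof (intro conjI allI impI)
  show "retract t h ` man_space A \<subseteq> man_space A"
    using bij_betw_imp_surj_on[OF bij_retract[OF h t]] by (simp add: man_space)
  fix D p E q assume p: "(D, p) \<in> A" and q: "(E, q) \<in> A"
  from retract_family[OF G_constant_family[OF h] _ _ _ p q, of "\<lambda>_. t"] h t
  have "smooth_on {x. ((), x) \<in> rep_dom point_topology D p E q (\<lambda>_. retract t h)} (chart_rep p E q (retract t h))"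
    by (intro smooth_on_slice[where F = "\<lambda>_. chart_rep p E q (retract t h)" and X = point_topology]) auto
  then show "smooth_on {x \<in> D. retract t h (p x) \<in> q ` E} (chart_rep p E q (retract t h))"
    by (simp add: rep_dom_def)
qed

lemma smooth_map_inv_retract:
  assumes h: "h \<in> G" and t: "t \<in> {0..1}"
  shows "smooth_map A A (inv_into L (retract t h))"
  unfolding smooth_map_iff
proof (intro conjI allI impI)
  interpret sw: polar_space L "\<lambda>P. 2 - g P" j1 j0 by (rule swap)
  have sA: "sw.A = A" by (rule polar_atlas_swap)
  show "inv_into L (retract t h) ` man_space A \<subseteq> man_space A"
    using bij_betw_imp_surj_on[OF bij_betw_inv_into[OF bij_retract[OF h t]]] by (simp add: man_space)
  fix D p E q assume p: "(D, p) \<in> A" and q: "(E, q) \<in> A"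
  from p show "smooth_on {x \<in> D. inv_into L (retract t h) (p x) \<in> q ` E} (chart_rep p E q (inv_into L (retract t h)))"
  proof (cases rule: A_cases)
    case (1 a)
    show ?thesis unfolding 1 by (rule smooth_inv_retract[OF h t q])
  next
    case (2 a)
    have p': "D = sw.chart_dom a" "p = sw.chart0"
      unfolding 2 by (auto simp: sw.chart_dom_def chart_dom_def sw.chart0_def)
    show ?thesis
      using sw.smooth_inv_retract[unfolded sA level_diffeos_swap, OF h t q, of a] unfolding p' retract_swap[OF h t] .
  qed
qed

lemma retract_G:
  assumes h: "h \<in> G" and t: "t \<in> {0..1}"
  shows "retract t h \<in> G"
proof -
  have k: "inverse_diffeo h \<in> G" by (rule inverse_diffeo_G[OF h])
  have "retract t h \<in> diffeos A"
    using bij_retract[OF h t] smooth_map_retract[OF h t] smooth_map_inv_retract[OF h t]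
    by (simp add: diffeos_def diffeomorphism_def man_space retract_def)
  then show ?thesis
    unfolding level_diffeos_def
    using slide_level[OF k t] slide_level_0[OF k t] slide_level_2[OF k t] G_mem[OF h]
      G_level[OF h] G_level_0[OF h] G_level_2[OF h]
    by (simp add: man_space retract_eq_slide[OF h])
qed

lemma continuous_map_retract:
  assumes \<Phi>: "continuous_map Y (smooth_topology A A) \<Phi>" and G: "\<And>y. y \<in> topspace Y \<Longrightarrow> \<Phi> y \<in> G"
    and \<tau>: "continuous_map Y euclidean \<tau>" "\<And>y. y \<in> topspace Y \<Longrightarrow> \<tau> y \<in> {0..1}"
  shows "continuous_map Y (smooth_topology A A) (\<lambda>y. retract (\<tau> y) (\<Phi> y))"
  by (intro continuous_map_into_smooth_topology A_nonempty G_smooth_maps retract_G retract_family[OF \<Phi> G \<tau>] G \<tau>(2))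

section \<open>The strong deformation retraction\<close>

definition level_preserving :: "('p \<Rightarrow> 'p) set" where
  "level_preserving = {h \<in> diffeos A. \<forall>P\<in>L. g (h P) = g P}"

lemma level_preserving_subset: "level_preserving \<subseteq> G"
  by (auto simp: level_preserving_def level_diffeos_def man_space)

text \<open>The target level (1 - t) g P + t g P is the one where h P already lies, so no point
  moves.\<close>

lemma retract_level_preserving:
  assumes "h \<in> level_preserving" "t \<in> {0..1}"
  shows "retract t h = h"
proof -
  have h: "h \<in> G" using assms level_preserving_subset by blast
  have "h \<in> extensional L" using h by (simp add: level_diffeos_def diffeos_def man_space)
  then show ?thesis
    using assms(1) ray_point_self[OF G_mem[OF h]] unfolding retract_def
    by (intro extensionalityI[of _ L]) (simp_all add: level_preserving_def algebra_simps)
qed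

lemma retract_0:
  assumes h: "h \<in> G"
  shows "retract 0 h = h"
proof -
  have "h \<in> extensional L" using h by (simp add: level_diffeos_def diffeos_def man_space)
  then show ?thesis
    using ray_point_self[OF G_mem[OF h]] unfolding retract_def
    by (intro extensionalityI[of _ L]) simp_all
qed

lemma retract_1:
  assumes h: "h \<in> G"
  shows "retract 1 h \<in> level_preserving"
  using retract_G[OF h, of 1] g_retract[OF h, of 1] by (simp add: level_preserving_def level_diffeos_def)

text \<open>One continuity statement serves twice: over the parameter space \<open>G\<close> with t
  = 1 it gives the retraction, and over [0,1] \<times> \<open>G\<close> it gives the
  homotopy.\<close>

theorem strong_deformation_retract:
  "strong_deformation_retract_of_space level_preserving (subtopology (smooth_topology A A) G)"
proof -
  define X where "X = subtopology (smooth_topology A A) G"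
  have X: "topspace X = G"
    using G_smooth_maps by (auto simp: X_def topspace_smooth_topology[OF A_nonempty A_nonempty])
  have r: "continuous_map X X (retract 1)"
    unfolding X_def
    by (intro continuous_map_into_subtopology continuous_map_retract[of _ "\<lambda>h. h" "\<lambda>_. 1"])
      (use X retract_G in \<open>auto simp: X_def intro: continuous_map_from_subtopology\<close>)
  have rm: "retraction_maps X (subtopology X level_preserving) (retract 1) id"
    unfolding retraction_maps_def
  proof (intro conjI ballI)
    show "continuous_map X (subtopology X level_preserving) (retract 1)"
      by (intro continuous_map_into_subtopology r) (use X retract_1 in auto)
    show "continuous_map (subtopology X level_preserving) X id"
      by (simp add: continuous_map_from_subtopology)
    show "retract 1 (id h) = h" if "h \<in> topspace (subtopology X level_preserving)" for h
      using that retract_level_preserving[of h 1] by simp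
  qed
  have "homotopic_with (\<lambda>f. \<forall>s\<in>level_preserving. f s = s) X X id (retract 1)"
  proof (subst homotopic_with)
    show "(\<forall>s\<in>level_preserving. h s = s) \<longleftrightarrow> (\<forall>s\<in>level_preserving. k s = s)"
      if "\<And>x. x \<in> topspace X \<Longrightarrow> h x = k x" for h k :: "('p \<Rightarrow> 'p) \<Rightarrow> 'p \<Rightarrow> 'p"
      using that X level_preserving_subset by (metis subsetD)
    let ?Y = "prod_topology (top_of_set {0..1::real}) X"
    have Y: "topspace ?Y = {0..1} \<times> G" by (simp add: X)
    have "continuous_map ?Y X (\<lambda>y. retract (fst y) (snd y))"
      unfolding X_def
    proof (intro continuous_map_into_subtopology continuous_map_retract)
      show "continuous_map (prod_topology (top_of_set {0..1}) (subtopology (smooth_topology A A) G)) (smooth_topology A A) snd"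
        by (rule continuous_map_into_fulltopology[OF continuous_map_snd])
      show "continuous_map (prod_topology (top_of_set {0..1}) (subtopology (smooth_topology A A) G)) euclidean fst"
        by (rule continuous_map_into_fulltopology[OF continuous_map_fst])
    qed (use Y retract_G in \<open>auto simp: X_def\<close>)
    then show "\<exists>h. continuous_map ?Y X h \<and> (\<forall>x\<in>topspace X. h (0, x) = id x) \<and>
        (\<forall>x\<in>topspace X. h (1, x) = retract 1 x) \<and> (\<forall>t\<in>{0..1}. \<forall>s\<in>level_preserving. h (t, s) = s)"
      using retract_0 X retract_level_preserving by (intro exI[of _ "\<lambda>y. retract (fst y) (snd y)"]) auto
  qed
  then show ?thesis
    unfolding strong_deformation_retract_of_space_def X_def[symmetric]
    using X level_preserving_subset rm by auto
qed

end

section \<open>Lens spaces\<close>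

context
  fixes \<xi> :: "complex \<times> complex \<Rightarrow> complex \<times> complex"
  assumes \<xi>: "bij_betw \<xi> torus torus"
begin

lemma lens_class_eq_iff:
  assumes "p \<in> two_tori" "q \<in> two_tori"
  shows "lens_class \<xi> p = lens_class \<xi> q \<longleftrightarrow> (p, q) \<in> lens_rel \<xi>"
  unfolding lens_class_def using eq_equiv_class_iff[OF equiv_lens_rel[OF \<xi>] assms] .

lemma lens_class_glue:
  assumes "x \<in> torus"
  shows "lens_class \<xi> (x, 0) = lens_class \<xi> (\<xi> x, 1)"
proof -
  have "\<xi> x \<in> torus" using \<xi> assms bij_betwE by blast
  then have "(x, 0) \<in> two_tori" "(\<xi> x, 1) \<in> two_tori"
    using assms torus_subset by (auto simp: two_tori_def)
  moreover have "((x, 0), (\<xi> x, 1)) \<in> lens_rel \<xi>"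
    unfolding lens_rel_eq[OF \<xi>] glue_def using assms by blast
  ultimately show ?thesis by (simp only: lens_class_eq_iff)
qed

lemma lens_class_mem: "p \<in> two_tori \<Longrightarrow> lens_class \<xi> p \<in> lens_space \<xi>"
  by (simp add: lens_class_def lens_space_def quotientI)

lemma lens_class_eq:
  assumes "p \<in> solid_torus" "q \<in> solid_torus" "i \<in> {0, 1}"
  shows "lens_class \<xi> (p, i) = lens_class \<xi> (q, i) \<longleftrightarrow> p = q"
proof -
  have "(p, i) \<in> two_tori" "(q, i) \<in> two_tori" using assms by (auto simp: two_tori_def)
  then show ?thesis
    unfolding lens_class_eq_iff[OF \<open>(p, i) \<in> two_tori\<close> \<open>(q, i) \<in> two_tori\<close>] lens_rel_eq[OF \<xi>]
    by (auto simp: glue_def)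
qed

end

text \<open>Indexing the two halves by \<open>i\<close> treats \<open>\<xi>\<close> and its inverse at once.\<close>

definition lens_glue :: "(complex \<times> complex \<Rightarrow> complex \<times> complex) \<Rightarrow> nat \<Rightarrow> complex \<times> complex \<Rightarrow> complex \<times> complex" where
  "lens_glue \<xi> i = (if i = 0 then \<xi> else inv_into torus \<xi>)"

definition lens_j :: "(complex \<times> complex \<Rightarrow> complex \<times> complex) \<Rightarrow> nat \<Rightarrow> complex \<times> complex \<Rightarrow> lens_point" where
  "lens_j \<xi> i = (if i = 0 then lens_j0 \<xi> else lens_j1 \<xi>)"

text \<open>On the tube \<open>i\<close> this is the squared radius, so that both halves share the
  same formulas.\<close>

definition lens_level :: "nat \<Rightarrow> lens_point \<Rightarrow> real" where
  "lens_level i P = (if i = 0 then polar_fun P else 2 - polar_fun P)"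

lemma norm_sphere_divide: "z \<noteq> 0 \<Longrightarrow> norm (z / of_real (norm z) :: complex) = 1"
  by (simp add: norm_divide)

context
  fixes \<xi> :: "complex \<times> complex \<Rightarrow> complex \<times> complex" and i :: nat
  assumes \<xi>: "bij_betw \<xi> torus torus" and i: "i \<in> {0, 1}"
begin

lemma lens_glue_bij: "bij_betw (lens_glue \<xi> i) torus torus"
  using \<xi> bij_betw_inv_into[OF \<xi>] by (simp add: lens_glue_def)

lemma lens_glue_inverse: "x \<in> torus \<Longrightarrow> lens_glue \<xi> (1 - i) (lens_glue \<xi> i x) = x"
  using i bij_betw_inv_into_left[OF \<xi>] bij_betw_inv_into_right[OF \<xi>] by (auto simp: lens_glue_def)

lemma lens_class_lens_glue: "x \<in> torus \<Longrightarrow> lens_class \<xi> (x, i) = lens_class \<xi> (lens_glue \<xi> i x, 1 - i)"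
proof -
  assume x: "x \<in> torus"
  have "inv_into torus \<xi> x \<in> torus" using bij_betwE[OF bij_betw_inv_into[OF \<xi>]] x by blast
  from lens_class_glue[OF \<xi> this] lens_class_glue[OF \<xi> x]
  show ?thesis using i bij_betw_inv_into_right[OF \<xi> x] by (auto simp: lens_glue_def)
qed

lemma lens_j_inner: "norm z \<le> 1 \<Longrightarrow> lens_j \<xi> i (w, z) = lens_class \<xi> ((w, z), i)"
  using i by (auto simp: lens_j_def lens_j0_def lens_j1_def)

text \<open>For |z| = 1 the definition takes the inner branch; there the gluing relation makes the
  outer formula agree with it, so that the two branches overlap.\<close>

lemma lens_j_outer:
  assumes w: "norm w = 1" and z: "1 \<le> norm z" and ab: "lens_glue \<xi> i (w, z / of_real (norm z)) = (a, b)"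
  shows "lens_j \<xi> i (w, z) = lens_class \<xi> ((a, of_real (sqrt (2 - (norm z)\<^sup>2)) * b), 1 - i)"
proof (cases "norm z = 1")
  case True
  have "(w, z) \<in> torus" using w True by (simp add: torus_def)
  then show ?thesis using lens_class_lens_glue[of "(w, z)"] ab True by (simp add: lens_j_inner)
next
  case False
  then show ?thesis using i ab z
    by (auto simp: lens_j_def lens_j0_def lens_j1_def lens_glue_def)
qed

lemma lens_glue_torus:
  assumes "norm w = 1" "z \<noteq> 0" "lens_glue \<xi> i (w, z / of_real (norm z)) = (a, b)"
  shows "norm a = 1" "norm b = 1"
proof -
  have "(w, z / of_real (norm z)) \<in> torus" using assms by (simp add: torus_def norm_sphere_divide)
  then have "(a, b) \<in> torus" using bij_betwE[OF lens_glue_bij] assms(3) by metis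
  then show "norm a = 1" "norm b = 1" by (auto simp: torus_def)
qed

end

section \<open>The two halves of a lens space as tubes of a polar space\<close>

lemma lens_level_class:
  assumes "bij_betw \<xi> torus torus" "norm w = 1" "norm z \<le> 1" "i \<in> {0, 1}" "l \<in> {0, 1}"
  shows "lens_level i (lens_class \<xi> ((w, z), l)) = (if i = l then (norm z)\<^sup>2 else 2 - (norm z)\<^sup>2)"
  using polar_fun_class[OF assms(1), of w z l] assms
  by (auto simp: lens_level_def two_tori_def solid_torus_def)

text \<open>The radius change r \<mapsto> sqrt (2 - r^2) is an involution, and the gluing maps of
  the two halves are inverse to each other. For |z| \<ge> 1 the formula is the outer branch of half
  \<open>i\<close>; for |z| < 1 it is the outer branch of the other half read backwards.\<close>

lemma lens_j_transition:
  assumes \<xi>: "bij_betw \<xi> torus torus" and i: "i \<in> {0, 1}"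
    and w: "norm w = 1" and z: "z \<noteq> 0" "norm z < sqrt 2"
    and ab: "lens_glue \<xi> i (w, z / of_real (norm z)) = (a, b)"
  shows "lens_j \<xi> i (w, z) = lens_j \<xi> (1 - i) (a, of_real (sqrt (2 - (norm z)\<^sup>2)) * b)"
proof -
  have z2: "(norm z)\<^sup>2 < 2" using z(2) by (simp add: norm_less_sqrt_iff)
  have i': "1 - i \<in> {0, 1}" using i by auto
  note n = lens_glue_torus[OF \<xi> i w z(1) ab]
  show ?thesis
  proof (cases "1 \<le> norm z")
    case True
    then have "1 \<le> (norm z)\<^sup>2" by simp
    then have "norm (of_real (sqrt (2 - (norm z)\<^sup>2)) * b) \<le> 1" using n z2 by (simp add: norm_mult)
    then show ?thesis
      using lens_j_outer[OF \<xi> i w True ab] lens_j_inner[OF \<xi> i'] by simp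
  next
    case False
    \<comment> \<open>The point in the other half has radius \<open>?s\<close> \<ge> 1, so the outer
      branch of that half applies to it and leads back to half \<open>i\<close>.\<close>
    let ?s = "sqrt (2 - (norm z)\<^sup>2)"
    have "(norm z)\<^sup>2 \<le> 1" using False by (simp add: power_le_one)
    then have s: "1 \<le> ?s" by simp
    have t: "(w, z / of_real (norm z)) \<in> torus" using w z(1) by (simp add: torus_def norm_sphere_divide)
    have ns: "norm (of_real ?s * b) = ?s" using n s by (simp add: norm_mult)
    have "of_real ?s * b / of_real (norm (of_real ?s * b)) = b" unfolding ns using s by simp
    then have "lens_glue \<xi> (1 - i) (a, of_real ?s * b / of_real (norm (of_real ?s * b))) = (w, z / of_real (norm z))"
      using lens_glue_inverse[OF \<xi> i t] ab by simp
    from lens_j_outer[OF \<xi> i' n(1) _ this] s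
    have "lens_j \<xi> (1 - i) (a, of_real ?s * b) =
        lens_class \<xi> ((w, of_real (sqrt (2 - ?s\<^sup>2)) * (z / of_real (norm z))), 1 - (1 - i))"
      unfolding ns by simp
    also have "sqrt (2 - ?s\<^sup>2) = norm z" using z2 by simp
    also have "of_real (norm z) * (z / of_real (norm z)) = z" using z(1) by simp
    also have "1 - (1 - i) = i" using i by auto
    finally show ?thesis using lens_j_inner[OF \<xi> i, of z w] False by simp
  qed
qed

lemma lens_j_level:
  assumes \<xi>: "bij_betw \<xi> torus torus" and i: "i \<in> {0, 1}" and w: "norm w = 1" and z: "norm z < sqrt 2"
  shows "lens_j \<xi> i (w, z) \<in> lens_space \<xi>" "lens_level i (lens_j \<xi> i (w, z)) = (norm z)\<^sup>2"
proof -
  have z2: "(norm z)\<^sup>2 < 2" using z by (simp add: norm_less_sqrt_iff)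
  have "lens_j \<xi> i (w, z) \<in> lens_space \<xi> \<and> lens_level i (lens_j \<xi> i (w, z)) = (norm z)\<^sup>2"
  proof (cases "norm z \<le> 1")
    case True
    have "((w, z), i) \<in> two_tori" using w True i by (auto simp: two_tori_def solid_torus_def)
    from lens_class_mem[OF \<xi> this] lens_level_class[OF \<xi> w True i i]
    show ?thesis by (simp add: lens_j_inner[OF \<xi> i True])
  next
    case False
    obtain a b where ab: "lens_glue \<xi> i (w, z / of_real (norm z)) = (a, b)" by fastforce
    have z0: "z \<noteq> 0" using False by auto
    note n = lens_glue_torus[OF \<xi> i w z0 ab]
    let ?y = "of_real (sqrt (2 - (norm z)\<^sup>2)) * b"
    have "1 \<le> (norm z)\<^sup>2" using False by simp
    then have y: "norm ?y \<le> 1" "(norm ?y)\<^sup>2 = 2 - (norm z)\<^sup>2" using n z2 by (simp_all add: norm_mult)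
    have i': "1 - i \<in> {0, 1}" "i \<noteq> 1 - i" using i by auto
    have "((a, ?y), 1 - i) \<in> two_tori" using n y(1) i' by (auto simp: two_tori_def solid_torus_def)
    from lens_class_mem[OF \<xi> this] lens_level_class[OF \<xi> n(1) y(1) i i'(1)] y(2) i'(2)
    show ?thesis using lens_j_outer[OF \<xi> i w _ ab] False by simp
  qed
  then show "lens_j \<xi> i (w, z) \<in> lens_space \<xi>" "lens_level i (lens_j \<xi> i (w, z)) = (norm z)\<^sup>2" by auto
qed

text \<open>The level determines |z|, hence the same branch is used for both points. Within one
  solid torus distinct points have distinct classes; this settles the inner branch, and on the outer
  one the injectivity of the gluing map finishes.\<close>

lemma lens_j_inj_on:
  assumes \<xi>: "bij_betw \<xi> torus torus" and i: "i \<in> {0, 1}"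
  shows "inj_on (lens_j \<xi> i) cylinder"
proof (rule inj_onI, clarify)
  fix w z w' z' assume wz: "w \<in> sphere 0 1" "z \<in> ball 0 (sqrt 2)" "w' \<in> sphere 0 1" "z' \<in> ball 0 (sqrt 2)"
    and eq: "lens_j \<xi> i (w, z) = lens_j \<xi> i (w', z')"
  then have w: "norm w = 1" "norm w' = 1" and z: "norm z < sqrt 2" "norm z' < sqrt 2" by auto
  have "(norm z)\<^sup>2 = (norm z')\<^sup>2"
    using lens_j_level(2)[OF \<xi> i w(1) z(1)] lens_j_level(2)[OF \<xi> i w(2) z(2)] eq by simp
  then have n: "norm z = norm z'" by simp
  show "w = w' \<and> z = z'"
  proof (cases "norm z \<le> 1")
    case True
    have "(w, z) \<in> solid_torus" "(w', z') \<in> solid_torus" using True w n by (auto simp: solid_torus_def)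
    then show ?thesis
      using eq True n lens_class_eq[OF \<xi> _ _ i] by (simp add: lens_j_inner[OF \<xi> i])
  next
    case False
    have z0: "z \<noteq> 0" "z' \<noteq> 0" using False n by auto
    obtain a b where ab: "lens_glue \<xi> i (w, z / of_real (norm z)) = (a, b)" by fastforce
    obtain a' b' where ab': "lens_glue \<xi> i (w', z' / of_real (norm z')) = (a', b')" by fastforce
    note m = lens_glue_torus[OF \<xi> i w(1) z0(1) ab] and m' = lens_glue_torus[OF \<xi> i w(2) z0(2) ab']
    let ?s = "sqrt (2 - (norm z)\<^sup>2)"
    have "(norm z)\<^sup>2 < 2" using z by (simp add: norm_less_sqrt_iff)
    moreover have "1 \<le> (norm z)\<^sup>2" using False by simp
    ultimately have s: "0 < ?s" "?s \<le> 1" by auto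
    have i': "1 - i \<in> {0, 1}" using i by auto
    have "lens_class \<xi> ((a, of_real ?s * b), 1 - i) = lens_class \<xi> ((a', of_real ?s * b'), 1 - i)"
      using eq lens_j_outer[OF \<xi> i w(1) _ ab] lens_j_outer[OF \<xi> i w(2) _ ab'] False n by simp
    moreover have "(a, of_real ?s * b) \<in> solid_torus" "(a', of_real ?s * b') \<in> solid_torus"
      using m m' s by (auto simp: solid_torus_def norm_mult)
    ultimately have "(a, of_real ?s * b) = (a', of_real ?s * b')"
      using lens_class_eq[OF \<xi> _ _ i'] by blast
    then have "(a, b) = (a', b')" using s by auto
    moreover have "(w, z / of_real (norm z)) \<in> torus" "(w', z' / of_real (norm z')) \<in> torus"
      using w z0 by (auto simp: torus_def norm_sphere_divide)
    ultimately have "(w, z / of_real (norm z)) = (w', z' / of_real (norm z'))"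
      using ab ab' bij_betw_imp_inj_on[OF lens_glue_bij[OF \<xi> i]] by (metis inj_onD)
    then show ?thesis using n z0 by auto
  qed
qed

lemma lens_j_image:
  assumes \<xi>: "bij_betw \<xi> torus torus" and i: "i \<in> {0, 1}"
  shows "lens_j \<xi> i ` cylinder = {P \<in> lens_space \<xi>. lens_level i P < 2}"
proof
  show "lens_j \<xi> i ` cylinder \<subseteq> {P \<in> lens_space \<xi>. lens_level i P < 2}"
    using lens_j_level[OF \<xi> i] by (auto simp: norm_less_sqrt_iff)
  show "{P \<in> lens_space \<xi>. lens_level i P < 2} \<subseteq> lens_j \<xi> i ` cylinder"
  proof safe
    fix P assume "P \<in> lens_space \<xi>" and l: "lens_level i P < 2"
    then obtain w z k where P: "P = lens_class \<xi> ((w, z), k)" and w: "norm w = 1" and z: "norm z \<le> 1" and k: "k \<in> {0, 1}"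
      unfolding lens_space_def lens_class_def quotient_def two_tori_def solid_torus_def by auto
    have z': "norm z < sqrt 2" using z by (simp add: order_le_less_trans)
    have Pk: "P = lens_j \<xi> k (w, z)" using lens_j_inner[OF \<xi> k z] P by simp
    show "P \<in> lens_j \<xi> i ` cylinder"
    proof (cases "k = i")
      case True
      then show ?thesis using Pk w z' by (intro image_eqI[of _ _ "(w, z)"]) auto
    next
      case False
      then have ki: "1 - k = i" using k i by auto
      \<comment> \<open>A level below 2 excludes the core circle of the other solid torus, where
        there is no direction z / |z|.\<close>
      have "2 - (norm z)\<^sup>2 < 2" using lens_level_class[OF \<xi> w z i k] l P False by auto
      then have z0: "z \<noteq> 0" by auto
      obtain a b where ab: "lens_glue \<xi> k (w, z / of_real (norm z)) = (a, b)" by fastforce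
      note n = lens_glue_torus[OF \<xi> k w z0 ab]
      have "P = lens_j \<xi> i (a, of_real (sqrt (2 - (norm z)\<^sup>2)) * b)"
        unfolding Pk using lens_j_transition[OF \<xi> k w z0 z' ab] ki by simp
      moreover have "norm (of_real (sqrt (2 - (norm z)\<^sup>2)) * b) < sqrt 2"
      proof -
        have "(norm z)\<^sup>2 \<le> 1" using z by (simp add: power_le_one)
        then have "norm (of_real (sqrt (2 - (norm z)\<^sup>2)) * b) = sqrt (2 - (norm z)\<^sup>2)"
          using n by (simp add: norm_mult)
        also have "\<dots> < sqrt 2" using z0 by simp
        finally show ?thesis .
      qed
      ultimately show ?thesis using n by (intro image_eqI) auto
    qed
  qed
qed

text \<open>For the axiom \<open>ray\<close>: the transition between the tubes acts on (w, z / |z|)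
  by \<xi> and on radii by r^2 + r'^2 = 2. Scaling z by a positive factor keeps the direction, so
  only the relation between the radii remains to be compared.\<close>

lemma lens_polar_space:
  assumes \<xi>: "bij_betw \<xi> torus torus"
  shows "polar_space (lens_space \<xi>) polar_fun (lens_j0 \<xi>) (lens_j1 \<xi>)"
proof
  have j: "lens_j0 \<xi> = lens_j \<xi> 0" "lens_j1 \<xi> = lens_j \<xi> 1" by (auto simp: lens_j_def)
  have l0: "lens_level 0 = polar_fun" and l1: "lens_level 1 = (\<lambda>P. 2 - polar_fun P)"
    by (auto simp: lens_level_def)
  show "bij_betw (lens_j0 \<xi>) cylinder {P \<in> lens_space \<xi>. polar_fun P < 2}"
    unfolding bij_betw_def j using lens_j_inj_on[OF \<xi>, of 0] lens_j_image[OF \<xi>, of 0] by (simp add: l0)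
  show "bij_betw (lens_j1 \<xi>) cylinder {P \<in> lens_space \<xi>. polar_fun P > 0}"
    unfolding bij_betw_def j using lens_j_inj_on[OF \<xi>, of 1] lens_j_image[OF \<xi>, of 1] by (simp add: lens_level_def)
  show "polar_fun (lens_j0 \<xi> (w, z)) = (norm z)\<^sup>2" if "(w, z) \<in> cylinder" for w z
    using lens_j_level(2)[OF \<xi>, of 0 w z] that by (simp add: l0 j)
  show g1: "polar_fun (lens_j1 \<xi> (w, z)) = 2 - (norm z)\<^sup>2" if "(w, z) \<in> cylinder" for w z
    using lens_j_level(2)[OF \<xi>, of 1 w z] that by (simp add: lens_level_def j)
  fix w z w' z' s s'
  assume p: "(w, z) \<in> cylinder" and p': "(w', z') \<in> cylinder" and eq: "lens_j0 \<xi> (w, z) = lens_j1 \<xi> (w', z')"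
    and s: "0 < s" "0 < s'" and ss: "s\<^sup>2 * (norm z)\<^sup>2 + s'\<^sup>2 * (norm z')\<^sup>2 = 2"
  have w: "norm w = 1" "norm w' = 1" and z: "norm z < sqrt 2" "norm z' < sqrt 2" using p p' by auto
  have nn: "(norm z)\<^sup>2 = 2 - (norm z')\<^sup>2"
    using lens_j_level(2)[OF \<xi>, of 0 w z] w z g1[OF p'] eq by (simp add: l0 j)
  have z0: "z \<noteq> 0" "z' \<noteq> 0"
    using nn z norm_less_sqrt_iff[of z 2] norm_less_sqrt_iff[of z' 2] by auto
  obtain a b where ab: "lens_glue \<xi> 0 (w, z / of_real (norm z)) = (a, b)" by fastforce
  note m = lens_glue_torus[OF \<xi> _ w(1) z0(1) ab, simplified]
  have "lens_j \<xi> 1 (w', z') = lens_j \<xi> 1 (a, of_real (sqrt (2 - (norm z)\<^sup>2)) * b)"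
    using lens_j_transition[OF \<xi> _ w(1) z0(1) z(1) ab] eq by (simp add: j)
  moreover have "sqrt (2 - (norm z)\<^sup>2) = norm z'" using nn by simp
  ultimately have "lens_j \<xi> 1 (w', z') = lens_j \<xi> 1 (a, of_real (norm z') * b)" by simp
  then have wz': "w' = a" "z' = of_real (norm z') * b"
    using inj_onD[OF lens_j_inj_on[OF \<xi>, of 1], of "(w', z')" "(a, of_real (norm z') * b)"] p' m z
    by (auto simp: norm_mult)
  have "s'\<^sup>2 * (norm z')\<^sup>2 > 0" using s z0 by simp
  then have "(norm (s *\<^sub>R z))\<^sup>2 < 2" using ss by (simp add: power_mult_distrib)
  then have sz: "norm (s *\<^sub>R z) < sqrt 2" by (simp only: norm_less_sqrt_iff)
  have "(s *\<^sub>R z) / of_real (norm (s *\<^sub>R z)) = z / of_real (norm z)"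
  proof -
    have n: "norm (s *\<^sub>R z) = s * norm z" using s by simp
    show ?thesis unfolding n using s by (simp add: scaleR_conv_of_real)
  qed
  then have "lens_j \<xi> 0 (w, s *\<^sub>R z) = lens_j \<xi> 1 (a, of_real (sqrt (2 - (norm (s *\<^sub>R z))\<^sup>2)) * b)"
    using lens_j_transition[OF \<xi> _ w(1) _ sz, of 0 a b] ab s z0 by simp
  also have "2 - (norm (s *\<^sub>R z))\<^sup>2 = (s' * norm z')\<^sup>2" using ss by (simp add: power_mult_distrib)
  also have "of_real (sqrt ((s' * norm z')\<^sup>2)) * b = s' *\<^sub>R z'"
    using s by (subst wz'(2)) (simp add: scaleR_conv_of_real)
  finally show "lens_j0 \<xi> (w, s *\<^sub>R z) = lens_j1 \<xi> (w', s' *\<^sub>R z')" by (simp add: j wz'(1))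
qed

section \<open>From leaves to levels\<close>

lemma lens_atlas_eq: "lens_atlas \<xi> = polar_atlas (lens_j0 \<xi>) (lens_j1 \<xi>)"
  by (simp add: lens_atlas_def polar_atlas_def)

theorem theorem2p2:
  fixes \<xi> :: "complex \<times> complex \<Rightarrow> complex \<times> complex"
  assumes "diffeomorphism torus_atlas torus_atlas \<xi>"
  shows "strong_deformation_retract_of_space (diff_lp \<xi>)
           (subtopology (smooth_topology (lens_atlas \<xi>) (lens_atlas \<xi>)) (diff_fol_plus \<xi>))"
proof -
  have \<xi>: "bij_betw \<xi> torus torus"
    using assms by (simp add: diffeomorphism_def man_space_torus_atlas)
  interpret polar_space "lens_space \<xi>" polar_fun "lens_j0 \<xi>" "lens_j1 \<xi>"
    by (rule lens_polar_space[OF \<xi>])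
  let ?L = "lens_space \<xi>" and ?A = "lens_atlas \<xi>"
  have A: "A = ?A" by (simp add: lens_atlas_eq)
  have bij: "bij_betw h ?L ?L" if "h \<in> diffeos ?A" for h
    using that by (simp add: diffeos_def diffeomorphism_def man_space A[symmetric])
  have leaf: "polar_leaf \<xi> t = {P \<in> ?L. polar_fun P = t}" for t by (simp add: polar_leaf_def)
  have fol: "polar_foliation \<xi> = polar_leaf \<xi> ` {0..2}" by (simp add: polar_foliation_def)
  have rng: "polar_fun P \<in> {0..2}" if "P \<in> ?L" for P using g_bounds[OF that] by simp
  have "diff_lp \<xi> = level_preserving"
  proof -
    have "(\<forall>l\<in>polar_foliation \<xi>. h ` l = l) \<longleftrightarrow> (\<forall>P\<in>?L. polar_fun (h P) = polar_fun P)"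
      if h: "h \<in> diffeos ?A" for h
    proof
      assume *: "\<forall>l\<in>polar_foliation \<xi>. h ` l = l"
      show "\<forall>P\<in>?L. polar_fun (h P) = polar_fun P"
      proof
        fix P assume P: "P \<in> ?L"
        then have "h ` polar_leaf \<xi> (polar_fun P) = polar_leaf \<xi> (polar_fun P)" using * rng by (simp add: fol)
        moreover have "P \<in> polar_leaf \<xi> (polar_fun P)" using P by (simp add: leaf)
        ultimately have "h P \<in> polar_leaf \<xi> (polar_fun P)" by blast
        then show "polar_fun (h P) = polar_fun P" by (simp add: leaf)
      qed
    next
      assume *: "\<forall>P\<in>?L. polar_fun (h P) = polar_fun P"
      \<comment> \<open>Every point keeps its level, so the image lies in the leaf; since
        \<open>h\<close> is onto, a point of the leaf has a preimage, and it has the same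
        level.\<close>
      have "h ` polar_leaf \<xi> t = polar_leaf \<xi> t" for t
      proof
        show "h ` polar_leaf \<xi> t \<subseteq> polar_leaf \<xi> t"
          using * bij_betwE[OF bij[OF h]] by (auto simp: leaf)
        show "polar_leaf \<xi> t \<subseteq> h ` polar_leaf \<xi> t"
        proof
          fix R assume R: "R \<in> polar_leaf \<xi> t"
          then have "R \<in> h ` ?L" using bij_betw_imp_surj_on[OF bij[OF h]] by (simp add: leaf)
          then obtain Q where Q: "Q \<in> ?L" "R = h Q" by blast
          then show "R \<in> h ` polar_leaf \<xi> t" using R * by (auto simp: leaf)
        qed
      qed
      then show "\<forall>l\<in>polar_foliation \<xi>. h ` l = l" by (auto simp: fol)
    qed
    then show ?thesis
      unfolding diff_lp_def leaf_preserving_diffeos_def level_preserving_def A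
      by (intro Collect_cong conj_cong refl)
  qed
  moreover have "diff_fol_plus \<xi> = G"
  proof (intro equalityI subsetI)
    fix h assume "h \<in> diff_fol_plus \<xi>"
    then have h: "h \<in> diffeos ?A" and lf: "\<And>t. t \<in> {0..2} \<Longrightarrow> h ` polar_leaf \<xi> t \<in> polar_foliation \<xi>"
      and l0: "h ` polar_leaf \<xi> 0 = polar_leaf \<xi> 0" and l2: "h ` polar_leaf \<xi> 2 = polar_leaf \<xi> 2"
      by (auto simp: diff_fol_plus_def foliated_diffeos_def fol)
    note b = bij[OF h]
    have inj: "P = Q" if "h P = h Q" "P \<in> ?L" "Q \<in> ?L" for P Q
      using bij_betw_imp_inj_on[OF b] that by (auto dest: inj_onD)
    \<comment> \<open>A point mapped into the leaf is also the image of a point of that leaf, and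
      injectivity of \<open>h\<close> identifies the two.\<close>
    have same: "polar_fun (h P) = t \<longleftrightarrow> polar_fun P = t" if P: "P \<in> ?L" and t: "h ` polar_leaf \<xi> t = polar_leaf \<xi> t" for P t
    proof -
      have "h P \<in> ?L" using b P bij_betwE by blast
      then show ?thesis using t P inj unfolding leaf by blast
    qed
    have "polar_fun (h P) = polar_fun (h Q) \<longleftrightarrow> polar_fun P = polar_fun Q" if P: "P \<in> ?L" and Q: "Q \<in> ?L" for P Q
    proof -
      obtain s where s: "h ` polar_leaf \<xi> (polar_fun P) = polar_leaf \<xi> s" using lf[OF rng[OF P]] by (auto simp: fol)
      have hP: "polar_fun (h P) = s" using s P unfolding leaf by blast
      have hQ: "h Q \<in> ?L" using b Q bij_betwE by blast
      have "polar_fun (h Q) = s \<longleftrightarrow> Q \<in> polar_leaf \<xi> (polar_fun P)"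
      proof
        assume "polar_fun (h Q) = s"
        then have "h Q \<in> h ` polar_leaf \<xi> (polar_fun P)" unfolding s using hQ by (simp add: leaf)
        then show "Q \<in> polar_leaf \<xi> (polar_fun P)" using inj Q unfolding leaf by blast
      next
        assume "Q \<in> polar_leaf \<xi> (polar_fun P)"
        then have "h Q \<in> polar_leaf \<xi> s" unfolding s[symmetric] by blast
        then show "polar_fun (h Q) = s" by (simp add: leaf)
      qed
      moreover have "Q \<in> polar_leaf \<xi> (polar_fun P) \<longleftrightarrow> polar_fun Q = polar_fun P"
        using Q by (simp add: leaf)
      ultimately show ?thesis unfolding hP by metis
    qed
    then show "h \<in> G"
      unfolding level_diffeos_def man_space using h same l0 l2 by (simp add: A)
  next
    fix h assume hG: "h \<in> G"
    then have h: "h \<in> diffeos ?A" by (simp add: level_diffeos_def A)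
    note b = bij[OF h]
    have img: "h ` polar_leaf \<xi> (polar_fun P) = polar_leaf \<xi> (polar_fun (h P))" if P: "P \<in> ?L" for P
    proof
      show "h ` polar_leaf \<xi> (polar_fun P) \<subseteq> polar_leaf \<xi> (polar_fun (h P))"
        using G_mem[OF hG] G_level[OF hG _ P] by (auto simp: leaf)
      show "polar_leaf \<xi> (polar_fun (h P)) \<subseteq> h ` polar_leaf \<xi> (polar_fun P)"
      proof
        fix R assume R: "R \<in> polar_leaf \<xi> (polar_fun (h P))"
        then have "R \<in> h ` ?L" using bij_betw_imp_surj_on[OF b] by (simp add: leaf)
        then obtain Q where Q: "Q \<in> ?L" "R = h Q" by blast
        then have "polar_fun Q = polar_fun P" using R G_level[OF hG Q(1) P] by (simp add: leaf)
        then show "R \<in> h ` polar_leaf \<xi> (polar_fun P)" using Q by (auto simp: leaf)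
      qed
    qed
    \<comment> \<open>No leaf is empty: levels t < 2 are attained on a ray of the first tube, and t
      = 2 on the central circle of the second. Thus \<open>img\<close> applies to every
      leaf.\<close>
    have ex: "\<exists>P\<in>?L. polar_fun P = t" if "t \<in> {0..2}" for t
    proof (cases "t < 2")
      case True
      have c: "(1, of_real (sqrt t)) \<in> cylinder" using that True by simp
      show ?thesis using j0_mem[OF c] g_j0[OF c] that by auto
    next
      case False
      have c: "(1, 0) \<in> cylinder" by simp
      show ?thesis using j1_mem[OF c] g_j1[OF c] that False by auto
    qed
    have "h ` polar_leaf \<xi> t \<in> polar_foliation \<xi>" if "t \<in> {0..2}" for t
      using ex[OF that] img rng[OF G_mem[OF hG]] by (auto simp: fol)
    moreover have "h ` polar_leaf \<xi> 0 = polar_leaf \<xi> 0"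
      using ex[of 0] img G_level_0[OF hG] by fastforce
    moreover have "h ` polar_leaf \<xi> 2 = polar_leaf \<xi> 2"
      using ex[of 2] img G_level_2[OF hG] by fastforce
    ultimately show "h \<in> diff_fol_plus \<xi>"
      using h by (auto simp: diff_fol_plus_def foliated_diffeos_def fol)
  qed
  ultimately show ?thesis using strong_deformation_retract by (simp add: A)
qed

end
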